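(* Let $D\ge1$ and let $S\subset\mathbb{R}^D$ be a Borel set. Then $\dim_H(S)$ equals the supremum of all $\delta$ such that $S$ is $\delta$-dimensionally Hausdorff winning, and $\dim_P(S)$ equals the supremum of all $\delta$ such that $S$ is $\delta$-dimensionally packing winning.
   Context: Given $0<\beta<1$ and $\delta$, the $\delta$-dimensional Hausdorff (resp. packing) $\beta$-game on $\mathbb{R}^D$ is played by Alice and Bob alternately, Alice first. Alice first chooses a radius $\rho_0>0$; set $\rho_k=\beta^k\rho_0$. On turn $k$ ($k=0,1,2,\dots$) Alice chooses a nonempty $3\rho_k$-separated set $A_k\subset\mathbb{R}^D$ and Bob responds with a ball $B_k=B(x_k,\rho_k)$ with $x_k\in A_k$. $A_0$ may be any finite set (nonempty, $3\rho_0$-separated); for $k\ge0$ Alice must choose $A_{k+1}\subset B(x_k,(1-\beta)\rho_k)$, so $B_0\supset B_1\supset\cdots$. The outcome is $x_\infty=\lim_k x_k$. Alice's lower and upper scores are $\underline\delta(\mathcal A)=\liminf_{k\to\infty}\frac1k\sum_{i=0}^k\frac{\log\#(A_i)}{-\log\beta}$ and $\overline\delta(\mathcal A)=\limsup_{k\to\infty}\frac1k\sum_{i=0}^k\frac{\log\#(A_i)}{-\log\beta}$. $S$ is $\delta$-dimensionally Hausdorff (resp. packing) $\beta$-winning if Alice has a strategy guaranteeing simultaneously that $x_\infty\in S$ and that her lower (resp. upper) score is at least $\delta$. $S$ is $\delta$-dimensionally Hausdorff (resp. packing) winning if it is $\delta$-dimensionally Hausdorff (resp. packing) $\beta$-winning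 for all sufficiently small $\beta>0$. $\dim_H,\dim_P$ denote Hausdorff and packing dimension. *)

theory Defs
  imports "HOL-Analysis.Analysis"
begin

section \<open>Hausdorff dimension\<close>

text \<open>The gauge \<^term>\<open>diameter U powr s\<close> is only used for \<open>s > 0\<close>, since \<open>0 powr 0 = 0\<close> in HOL;
  restricting to \<open>s > 0\<close> does not affect the infimum that defines the dimension. Boundedness of the
  covering sets is required because \<^const>\<open>diameter\<close> is unspecified on unbounded sets. Covering
  sets may be empty, so finite covers are included. Both dimensions take values in \<open>[0,\<infinity>]\<close>
  and give \<open>0\<close> on the empty set.\<close>

definition hausdorff_premeasure :: "real \<Rightarrow> real \<Rightarrow> 'a::metric_space set \<Rightarrow> ennreal" where
  "hausdorff_premeasure s \<epsilon> S =
     (INF U \<in> {U :: nat \<Rightarrow> 'a set.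
                 S \<subseteq> (\<Union>i. U i) \<and> (\<forall>i. bounded (U i) \<and> diameter (U i) \<le> \<epsilon>)}.
        \<Sum>i. ennreal (diameter (U i) powr s))"

definition hausdorff_measure :: "real \<Rightarrow> 'a::metric_space set \<Rightarrow> ennreal" where
  "hausdorff_measure s S = (SUP \<epsilon> \<in> {0<..}. hausdorff_premeasure s \<epsilon> S)"

definition hausdorff_dim :: "'a::metric_space set \<Rightarrow> ennreal" where
  "hausdorff_dim S = (INF s \<in> {s. 0 < s \<and> hausdorff_measure s S = 0}. ennreal s)"

section \<open>Packing dimension\<close>

text \<open>A packing is a countable set of pairs (centre, radius) whose closed balls are pairwise
  disjoint. The weight of a ball is \<open>(2 r)\<^sup>s\<close>, the \<open>s\<close>-th power of its diameter in Euclidean space.\<close>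

definition packings :: "real \<Rightarrow> 'a::metric_space set \<Rightarrow> ('a \<times> real) set set" where
  "packings \<epsilon> S =
     {C. countable C \<and> C \<subseteq> S \<times> {0<..\<epsilon>} \<and> disjoint_family_on (\<lambda>(x, r). cball x r) C}"

definition packing_premeasure_scale :: "real \<Rightarrow> real \<Rightarrow> 'a::metric_space set \<Rightarrow> ennreal" where
  "packing_premeasure_scale s \<epsilon> S =
     (SUP C \<in> packings \<epsilon> S. \<Sum>\<^sub>\<infinity>(x, r)\<in>C. ennreal ((2 * r) powr s))"

definition packing_premeasure :: "real \<Rightarrow> 'a::metric_space set \<Rightarrow> ennreal" where
  "packing_premeasure s S = (INF \<epsilon> \<in> {0<..}. packing_premeasure_scale s \<epsilon> S)"

definition packing_measure :: "real \<Rightarrow> 'a::metric_space set \<Rightarrow> ennreal" where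
  "packing_measure s S =
     (INF T \<in> {T :: nat \<Rightarrow> 'a set. S \<subseteq> (\<Union>i. T i)}. \<Sum>i. packing_premeasure s (T i))"

definition packing_dim :: "'a::metric_space set \<Rightarrow> ennreal" where
  "packing_dim S = (INF s \<in> {s. 0 < s \<and> packing_measure s S = 0}. ennreal s)"

section \<open>The Hausdorff and packing games\<close>

definition separated_set :: "real \<Rightarrow> 'a::metric_space set \<Rightarrow> bool" where
  "separated_set \<rho> A \<longleftrightarrow> (\<forall>x\<in>A. \<forall>y\<in>A. x \<noteq> y \<longrightarrow> \<rho> \<le> dist x y)"

text \<open>Bob's \<open>k\<close>-th ball \<open>B(x\<^sub>k, \<rho>\<^sub>k)\<close> is determined by its centre, so the history of a game before
  turn \<open>k\<close> is the list \<open>xs = [x\<^sub>0, \<dots>, x\<^sub>k\<^sub>-\<^sub>1]\<close>, and the move Alice makes is \<open>A\<^sub>k = \<sigma> xs\<close> for a strategy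
  \<open>\<sigma>\<close> depending on the whole history. Here \<open>\<rho>\<^sub>k = \<beta>\<^sup>k \<rho>\<^sub>0\<close>.\<close>

definition legal_alice_move :: "real \<Rightarrow> real \<Rightarrow> 'a::metric_space list \<Rightarrow> 'a set \<Rightarrow> bool" where
  "legal_alice_move \<beta> \<rho>0 xs A \<longleftrightarrow>
     A \<noteq> {} \<and> separated_set (3 * (\<beta> ^ length xs * \<rho>0)) A \<and>
     (if xs = [] then finite A
      else A \<subseteq> cball (last xs) ((1 - \<beta>) * (\<beta> ^ (length xs - 1) * \<rho>0)))"

definition legal_history :: "('a list \<Rightarrow> 'a set) \<Rightarrow> 'a list \<Rightarrow> bool" where
  "legal_history \<sigma> xs \<longleftrightarrow> (\<forall>k<length xs. xs ! k \<in> \<sigma> (take k xs))"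

text \<open>Alice's moves must be legal after every finite history that is consistent with her strategy.
  Legality along complete plays only would make a strategy that gets stuck vacuously legal.\<close>

definition legal_strategy ::
  "real \<Rightarrow> real \<Rightarrow> ('a::metric_space list \<Rightarrow> 'a set) \<Rightarrow> bool" where
  "legal_strategy \<beta> \<rho>0 \<sigma> \<longleftrightarrow>
     (\<forall>xs. legal_history \<sigma> xs \<longrightarrow> legal_alice_move \<beta> \<rho>0 xs (\<sigma> xs))"

definition alice_moves :: "('a list \<Rightarrow> 'a set) \<Rightarrow> (nat \<Rightarrow> 'a) \<Rightarrow> nat \<Rightarrow> 'a set" where
  "alice_moves \<sigma> x k = \<sigma> (map x [0..<k])"

definition bob_play :: "('a list \<Rightarrow> 'a set) \<Rightarrow> (nat \<Rightarrow> 'a) \<Rightarrow> bool" where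
  "bob_play \<sigma> x \<longleftrightarrow> (\<forall>k. x k \<in> alice_moves \<sigma> x k)"

text \<open>The average has \<open>k + 1\<close> terms but is divided by \<open>k\<close>; the value at \<open>k = 0\<close> is irrelevant for the
  limits.\<close>

definition average_score :: "real \<Rightarrow> (nat \<Rightarrow> 'a set) \<Rightarrow> nat \<Rightarrow> real" where
  "average_score \<beta> A k = 1 / real k * (\<Sum>i=0..k. ln (real (card (A i))) / (- ln \<beta>))"

definition lower_score :: "real \<Rightarrow> (nat \<Rightarrow> 'a set) \<Rightarrow> ereal" where
  "lower_score \<beta> A = liminf (\<lambda>k. ereal (average_score \<beta> A k))"

definition upper_score :: "real \<Rightarrow> (nat \<Rightarrow> 'a set) \<Rightarrow> ereal" where
  "upper_score \<beta> A = limsup (\<lambda>k. ereal (average_score \<beta> A k))"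

definition hausdorff_beta_winning :: "real \<Rightarrow> real \<Rightarrow> 'a::metric_space set \<Rightarrow> bool" where
  "hausdorff_beta_winning \<beta> \<delta> S \<longleftrightarrow>
     (\<exists>\<rho>0>0. \<exists>\<sigma>. legal_strategy \<beta> \<rho>0 \<sigma> \<and>
        (\<forall>x. bob_play \<sigma> x \<longrightarrow>
           (\<exists>x_inf\<in>S. x \<longlonglongrightarrow> x_inf) \<and> ereal \<delta> \<le> lower_score \<beta> (alice_moves \<sigma> x)))"

definition packing_beta_winning :: "real \<Rightarrow> real \<Rightarrow> 'a::metric_space set \<Rightarrow> bool" where
  "packing_beta_winning \<beta> \<delta> S \<longleftrightarrow>
     (\<exists>\<rho>0>0. \<exists>\<sigma>. legal_strategy \<beta> \<rho>0 \<sigma> \<and>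
        (\<forall>x. bob_play \<sigma> x \<longrightarrow>
           (\<exists>x_inf\<in>S. x \<longlonglongrightarrow> x_inf) \<and> ereal \<delta> \<le> upper_score \<beta> (alice_moves \<sigma> x)))"

definition hausdorff_winning :: "real \<Rightarrow> 'a::metric_space set \<Rightarrow> bool" where
  "hausdorff_winning \<delta> S \<longleftrightarrow> (\<forall>\<^sub>F \<beta> in at_right 0. hausdorff_beta_winning \<beta> \<delta> S)"

definition packing_winning :: "real \<Rightarrow> 'a::metric_space set \<Rightarrow> bool" where
  "packing_winning \<delta> S \<longleftrightarrow> (\<forall>\<^sub>F \<beta> in at_right 0. packing_beta_winning \<beta> \<delta> S)"

end

theory Submission
  imports Defs "HOL-Real_Asymp.Real_Asymp"
begin

text \<open>\<^bold>\<open>Lower bound on the dimension.\<close> If \<open>S\<close> is null in dimension \<open>t < \<delta>\<close>, it is covered infinitely often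
  by small sets \<open>U\<close>, each at its own level \<open>k\<close>, with \<open>\<Sum> \<beta>\<^sup>k\<^sup>t\<close> finite. As Alice's points are separated, \<open>U\<close> meets at most
  one of the balls offered on each turn up to \<open>k\<close>, so a derandomised uniform play of Bob hits only
  finitely many \<open>U\<close> on whose level the product of the \<open>#A\<^sub>i\<close> is at least \<open>\<beta>\<close> to the power \<open>-k t\<close>; as the
  outcome lies in \<open>S\<close>, the score is too low.

  \<^bold>\<open>Upper bound on the dimension.\<close> Alice keeps a piece of \<open>S\<close> and a subadditive functional \<open>\<Phi>\<close> of it.
  Among the dyadic subcells she picks some, far apart from each other, such that whichever one Bob
  chooses, \<open>\<Phi>\<close> drops at most by the factor \<open>c(\<beta>) #A\<close>, where \<open>ln c(\<beta>) / -ln \<beta>\<close> tends to \<open>0\<close>. For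
  Hausdorff dimension, \<open>\<Phi>\<close> is the dyadic net content. For packing dimension the game is divided into
  blocks, and in each of them \<open>\<Phi>\<close> counts the cells at the level of the end of the block that meet the
  piece in a set of large dimension. To end up in \<open>S\<close> rather than in its closure, Alice represents
  \<open>S\<close> as a projection of a closed subset of the product with Baire space, and bounds (or fixes)
  more and more of the coordinates; for the net content, continuity from below makes this cheap.\<close>

section \<open>Dyadic cells\<close>

text \<open>No measure on \<open>S\<close> is constructed. Bob may answer with any offered point, so
  Alice needs a family all of whose members are heavy, and a subadditive functional is enough for
  that. Among finitely many weights of total \<open>w\<close>, some subfamily \<open>J\<close> has
  every weight at least \<open>w / card J\<close>, up to a harmonic number: weights decaying like
  \<open>1 / n\<close> are the worst case. A residue class modulo \<open>12 * d\<close>,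
  \<open>d\<close> the dimension of the space, keeps the chosen cells far apart and costs
  \<open>(12 * d) ^ d\<close>. The two losses make up \<open>step_loss\<close>, which grows only
  like \<open>ln (1 / \<beta>)\<close>; so its logarithm is negligible against
  \<open>- ln \<beta>\<close>, but only as \<open>\<beta>\<close> tends to 0.

  The two games differ in when the functional can be compared with a power of
  \<open>\<beta>\<close>. The net content of a set in a small cell is small on every turn, which
  controls the liminf. Box counts are known to be large at selected levels only, and the comparison
  is made when such a level is reached; this controls the limsup. In the first game each coordinate
  bound costs a factor 2. In the second, a coordinate is fixed between blocks for free, since the
  next level is chosen afterwards.\<close>

text \<open>Removing again and again an element that satisfies the hypothesis, one meets values at
  most \<open>V / n\<close>, \<open>V / (n - 1)\<close>, ..., \<open>V / 1\<close>. Used in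
  contrapositive form: a large sum forces a subfamily that is uniformly heavy for its size.\<close>

lemma sum_le_harm_mult:
  fixes a :: "'b \<Rightarrow> real"
  assumes "finite I" "0 \<le> V"
    and "\<And>J. J \<subseteq> I \<Longrightarrow> J \<noteq> {} \<Longrightarrow> \<exists>i\<in>J. real (card J) * a i \<le> V"
  shows "sum a I \<le> harm (card I) * V"
  using assms
proof (induction "card I" arbitrary: I)
  case 0
  then show ?case by (simp add: harm_def)
next
  case (Suc n)
  then have "I \<noteq> {}" by auto
  with Suc.prems(3) obtain i where i: "i \<in> I" "real (card I) * a i \<le> V" by blast
  have cn: "card (I - {i}) = n" using Suc i by simp
  have "sum a (I - {i}) \<le> harm (card (I - {i})) * V"
  proof (rule Suc.hyps(1))
    show "n = card (I - {i})" "finite (I - {i})" "0 \<le> V" using cn Suc.prems by auto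
    show "\<exists>i\<in>J. real (card J) * a i \<le> V" if "J \<subseteq> I - {i}" "J \<noteq> {}" for J
      using that by (intro Suc.prems(3)) auto
  qed
  moreover have "a i \<le> inverse (of_nat (Suc n)) * V"
    using i Suc.hyps(2) by (simp add: field_simps)
  moreover have "sum a I = a i + sum a (I - {i})"
    using i Suc.prems by (simp add: sum.remove)
  ultimately show ?case
    using cn Suc.hyps(2)[symmetric] by (simp add: harm_Suc algebra_simps)
qed

lemma harm_le_1_plus_ln: "harm n \<le> 1 + ln (real n)" if "n > 0"
proof -
  have "harm n - ln (real n) \<le> harm 1 - ln (real 1)"
    using euler_mascheroni_sequence_decreasing[of 1 n] that by simp
  then show ?thesis by (simp add: harm_def)
qed

section \<open>Dyadic indices, cell corners and residue classes\<close>

text \<open>The fibres are half-open cubes of side \<open>1 / 2 ^ j\<close>; they partition the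
  space and nest exactly, with no boundary cases.\<close>

definition dyadic_index :: "nat \<Rightarrow> real ^ 'n \<Rightarrow> 'n \<Rightarrow> int" where
  "dyadic_index j x = (\<lambda>i. \<lfloor>2 ^ j * x $ i\<rfloor>)"

definition dyadic_corner :: "nat \<Rightarrow> ('n \<Rightarrow> int) \<Rightarrow> real ^ 'n" where
  "dyadic_corner j z = (\<chi> i. real_of_int (z i) / 2 ^ j)"

lemma dyadic_index_corner [simp]: "dyadic_index j (dyadic_corner j z) = z"
  by (simp add: dyadic_index_def dyadic_corner_def)

lemma dyadic_index_div:
  assumes "j \<le> j'"
  shows "dyadic_index j x i = dyadic_index j' x i div 2 ^ (j' - j)"
proof -
  have "(2::real) ^ j * x $ i = (2 ^ j' * x $ i) / real_of_int (2 ^ (j' - j))"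
    using assms by (subst of_int_power) (simp add: power_diff)
  then show ?thesis
    unfolding dyadic_index_def by (metis floor_divide_real_eq_div zero_le_numeral zero_le_power)
qed

lemma dyadic_index_coarser:
  assumes "j \<le> j'" "dyadic_index j' x = dyadic_index j' y"
  shows "dyadic_index j x = dyadic_index j y"
  using assms by (auto simp: dyadic_index_div fun_eq_iff)

text \<open>The norm is bounded by the sum of the coordinates, hence the factor
  \<open>CARD('n)\<close> instead of its square root. Only constants are affected.\<close>

lemma dist_dyadic_cell_le:
  fixes x y :: "real ^ 'n::finite"
  assumes "dyadic_index j x = dyadic_index j y"
  shows "dist x y \<le> real CARD('n) / 2 ^ j"
proof -
  have "\<bar>(x - y) $ i\<bar> \<le> 1 / 2 ^ j" for i
  proof -
    have "\<lfloor>2 ^ j * x $ i\<rfloor> = \<lfloor>2 ^ j * y $ i\<rfloor>"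
      using assms by (metis dyadic_index_def)
    then have "\<bar>2 ^ j * x $ i - 2 ^ j * y $ i\<bar> < 1" by linarith
    moreover have "2 ^ j * \<bar>(x - y) $ i\<bar> = \<bar>2 ^ j * x $ i - 2 ^ j * y $ i\<bar>"
      by (simp add: abs_mult flip: right_diff_distrib)
    ultimately have "2 ^ j * \<bar>(x - y) $ i\<bar> < 1" by linarith
    then show ?thesis by (simp add: field_simps)
  qed
  then have "(\<Sum>i\<in>UNIV. \<bar>(x - y) $ i\<bar>) \<le> of_nat CARD('n) * (1 / 2 ^ j)"
    by (intro sum_bounded_above) auto
  then show ?thesis
    using norm_le_l1_cart[of "x - y"] by (simp add: dist_norm)
qed

lemma
  fixes p :: "real ^ 'n::finite"
  assumes "j \<le> j'"
  shows finite_dyadic_subcells: "finite {dyadic_index j' y |y. dyadic_index j y = dyadic_index j p}" (is "finite ?I")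
    and card_dyadic_subcells_le:
      "card {dyadic_index j' y |y. dyadic_index j y = dyadic_index j p} \<le> (2 ^ (j' - j)) ^ CARD('n)"
proof -
  let ?d = "2 ^ (j' - j) :: int" and ?z = "dyadic_index j p"
  let ?P = "PiE UNIV (\<lambda>i. {?z i * ?d..<?z i * ?d + ?d})"
  have fin: "finite ?P" by (intro finite_PiE) auto
  have card: "card ?P = (2 ^ (j' - j)) ^ CARD('n)"
    by (subst card_PiE) (simp_all add: nat_power_eq)
  have sub: "?I \<subseteq> ?P"
  proof clarify
    fix y assume "dyadic_index j y = dyadic_index j p"
    then have "dyadic_index j' y i div ?d = ?z i" for i
      using dyadic_index_div[OF assms, of y i] by simp
    moreover have "dyadic_index j' y i = dyadic_index j' y i div ?d * ?d + dyadic_index j' y i mod ?d"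
      "0 \<le> dyadic_index j' y i mod ?d" "dyadic_index j' y i mod ?d < ?d" for i
      by (simp_all only: div_mult_mod_eq pos_mod_sign pos_mod_bound zero_less_power zero_less_numeral)
    ultimately have "?z i * ?d \<le> dyadic_index j' y i \<and> dyadic_index j' y i < ?z i * ?d + ?d" for i
      by (metis add_strict_left_mono le_add_same_cancel1)
    then show "dyadic_index j' y \<in> ?P" by auto
  qed
  show "finite ?I" using sub fin by (rule finite_subset)
  show "card ?I \<le> (2 ^ (j' - j)) ^ CARD('n)" using card_mono[OF fin sub] card by simp
qed

text \<open>A nonzero coordinate difference is a multiple of \<open>M\<close>. This is how a residue
  class yields the separation that the game demands.\<close>

lemma dist_dyadic_corner_ge:
  fixes z z' :: "'n::finite \<Rightarrow> int" and M :: int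
  assumes "z \<noteq> z'" "\<And>i. z i mod M = z' i mod M" "M > 0"
  shows "real_of_int M / 2 ^ j \<le> dist (dyadic_corner j z) (dyadic_corner j z')"
proof -
  obtain i where "z i \<noteq> z' i" using assms(1) by auto
  moreover have "M dvd z i - z' i" using assms(2) by (metis mod_eq_dvd_iff)
  ultimately have "M \<le> \<bar>z i - z' i\<bar>"
    using assms(3) by (metis abs_of_pos dvd_imp_le_int eq_iff_diff_eq_0)
  then have "real_of_int M / 2 ^ j \<le> \<bar>real_of_int (z i) / 2 ^ j - real_of_int (z' i) / 2 ^ j\<bar>"
    by (simp flip: diff_divide_distrib of_int_diff of_int_abs add: divide_right_mono)
  also have "\<dots> \<le> norm (dyadic_corner j z - dyadic_corner j z')"
    using component_le_norm_cart[of "dyadic_corner j z - dyadic_corner j z'" i]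
    by (simp add: dyadic_corner_def)
  finally show ?thesis by (simp add: dist_norm)
qed

text \<open>Some residue class carries at least its share of the total, at the price of the number
  of classes. Inside it the harmonic estimate gives a set \<open>J\<close> whose members are all
  heavy relative to \<open>card J\<close>, so that Bob's choice does not matter.\<close>

lemma exists_heavy_residue_class:
  fixes a :: "('n::finite \<Rightarrow> int) \<Rightarrow> real" and M :: int
  assumes "finite I" "0 < sum a I" "\<And>z. 0 \<le> a z" "M > 0"
  obtains J where "J \<subseteq> I" "J \<noteq> {}" "\<And>z z' i. z \<in> J \<Longrightarrow> z' \<in> J \<Longrightarrow> z i mod M = z' i mod M"
    "\<And>z. z \<in> J \<Longrightarrow> sum a I \<le> real (nat M) ^ CARD('n) * harm (card I) * (real (card J) * a z)"
proof -
  define r where "r z = (\<lambda>i. z i mod M)" for z :: "'n \<Rightarrow> int"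
  let ?R = "PiE (UNIV :: 'n set) (\<lambda>i. {0..<M})"
  let ?K = "\<lambda>c. {z\<in>I. r z = c}"
  have finR: "finite ?R" by (intro finite_PiE) auto
  have cardR: "card ?R = nat M ^ CARD('n)" by (subst card_PiE) auto
  have "sum a I = (\<Sum>c\<in>?R. sum a (?K c))"
    by (rule sum.group[symmetric]) (use assms finR in \<open>auto simp: r_def\<close>)
  moreover have "\<exists>c\<in>?R. sum a I \<le> real (card ?R) * sum a (?K c)"
  proof (rule ccontr)
    assume "\<not> ?thesis"
    then have *: "\<And>c. c \<in> ?R \<Longrightarrow> real (card ?R) * sum a (?K c) < sum a I" by force
    have "?R \<noteq> {}" using assms(4) by (auto simp: PiE_eq_empty_iff)
    then have "(\<Sum>c\<in>?R. real (card ?R) * sum a (?K c)) < (\<Sum>c\<in>?R. sum a I)"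
      by (intro sum_strict_mono * finR)
    then show False
      using \<open>sum a I = _\<close> by (simp flip: sum_distrib_left)
  qed
  then obtain c K where K_def: "K = ?K c" and c: "c \<in> ?R" "sum a I \<le> real (card ?R) * sum a K"
    by blast
  \<comment> \<open>The threshold at which the harmonic estimate would be an equality, so that any
    smaller bound contradicts it.\<close>
  define V where "V = sum a K / harm (card K)"
  have Kpos: "0 < sum a K"
    using c assms(2) by (smt (verit) mult_nonneg_nonpos of_nat_0_le_iff)
  have "K \<noteq> {}" using Kpos by auto
  have finK: "finite K" using assms by (simp add: K_def)
  have cardK: "card K > 0" using \<open>K \<noteq> {}\<close> finK by (simp add: card_gt_0_iff)
  then have hp: "harm (card K) > (0::real)" by (rule harm_pos)
  have "\<exists>J. J \<subseteq> K \<and> J \<noteq> {} \<and> (\<forall>z\<in>J. V \<le> real (card J) * a z)"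
  proof (rule ccontr)
    assume neg: "\<not> ?thesis"
    let ?T = "\<lambda>J. real (card J) * Min (a ` J)"
    \<comment> \<open>A maximum over the finitely many subsets makes the strict inequalities
      uniform, since \<open>sum_le_harm_mult\<close> takes one non-strict bound. The inserted 0
      keeps \<open>?W\<close> nonnegative.\<close>
    let ?W = "Max (insert 0 (?T ` (Pow K - {{}})))"
    have ex: "\<exists>i\<in>J. real (card J) * a i < V" if "J \<subseteq> K" "J \<noteq> {}" for J
      using neg that by (meson not_less)
    have Tless: "?T J < V" if "J \<subseteq> K" "J \<noteq> {}" for J
    proof -
      from ex[OF that] obtain i where i: "i \<in> J" "real (card J) * a i < V" ..
      have "finite J" using that finK by (meson finite_subset)
      then have "Min (a ` J) \<le> a i" using i by simp
      then have "?T J \<le> real (card J) * a i" by (rule mult_left_mono) simp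
      then show ?thesis using i(2) by (rule le_less_trans)
    qed
    have finT: "finite (insert 0 (?T ` (Pow K - {{}})))" using finK by simp
    have "0 < V" using hp Kpos by (simp add: V_def)
    then have "\<forall>t\<in>insert 0 (?T ` (Pow K - {{}})). t < V"
      using Tless by auto
    then have W: "?W < V" using Max_less_iff[OF finT] by blast
    have "sum a K \<le> harm (card K) * ?W"
    proof (rule sum_le_harm_mult[OF finK])
      show "0 \<le> ?W" by (rule Max_ge[OF finT]) simp
      fix J assume J: "J \<subseteq> K" "J \<noteq> {}"
      then have "finite J" using finK by (meson finite_subset)
      then have "Min (a ` J) \<in> a ` J" using J by simp
      then obtain i where "i \<in> J" "a i = Min (a ` J)" by (metis imageE)
      moreover have "?T J \<le> ?W" by (rule Max_ge[OF finT]) (use J in blast)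
      ultimately show "\<exists>i\<in>J. real (card J) * a i \<le> ?W" by metis
    qed
    also have "\<dots> < harm (card K) * V" using W hp by (rule mult_strict_left_mono)
    finally show False using hp by (simp add: V_def)
  qed
  then obtain J where J: "J \<subseteq> K" "J \<noteq> {}" "\<And>z. z \<in> J \<Longrightarrow> V \<le> real (card J) * a z" by blast
  show ?thesis
  proof
    show "J \<subseteq> I" "J \<noteq> {}" using J by (auto simp: K_def)
    show "z i mod M = z' i mod M" if "z \<in> J" "z' \<in> J" for z z' i
    proof -
      have "r z = r z'" using that J(1) by (auto simp: K_def)
      then show ?thesis unfolding r_def by metis
    qed
    fix z assume z: "z \<in> J"
    have mono: "harm (card K) \<le> (harm (card I) :: real)"
      by (intro harm_mono card_mono) (use assms in \<open>auto simp: K_def\<close>)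
    have "sum a K \<le> harm (card K) * (real (card J) * a z)"
      using J(3)[OF z] hp by (simp add: V_def field_simps)
    also have "\<dots> \<le> harm (card I) * (real (card J) * a z)"
      using mono assms(3) by (intro mult_right_mono) auto
    finally have "real (card ?R) * sum a K \<le> real (card ?R) * (harm (card I) * (real (card J) * a z))"
      by (rule mult_left_mono) simp
    with c(2) show "sum a I \<le> real (nat M) ^ CARD('n) * harm (card I) * (real (card J) * a z)"
      unfolding cardR by (simp add: algebra_simps)
  qed
qed

section \<open>Dyadic net content\<close>

definition dyadic_cell :: "nat \<times> ('n \<Rightarrow> int) \<Rightarrow> (real ^ 'n) set" where
  "dyadic_cell q = {x. dyadic_index (fst q) x = snd q}"

text \<open>Side lengths replace diameters, which changes weights by a constant factor only. As an
  integral over counting measure, the weight obeys Fatou's lemma.\<close>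

definition cell_weight :: "real \<Rightarrow> (nat \<times> ('n::finite \<Rightarrow> int)) set \<Rightarrow> ennreal" where
  "cell_weight s V =
     (\<integral>\<^sup>+q. ennreal ((1 / 2 ^ fst q) powr s) * indicator V q \<partial>count_space UNIV)"

text \<open>A content rather than a measure: covers are not forced to be fine. Hence a set inside
  one cell has content at most the weight of that cell, which bounds what is left on Alice's board
  after each turn.\<close>

definition dyadic_content :: "real \<Rightarrow> (real ^ 'n::finite) set \<Rightarrow> ennreal" where
  "dyadic_content s E = (INF V \<in> {V. E \<subseteq> \<Union>(dyadic_cell ` V)}. cell_weight s V)"

lemma dyadic_content_le_cell_weight:
  "E \<subseteq> \<Union>(dyadic_cell ` V) \<Longrightarrow> dyadic_content s E \<le> cell_weight s V"
  unfolding dyadic_content_def by (intro INF_lower) auto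

lemma dyadic_content_mono: "E \<subseteq> F \<Longrightarrow> dyadic_content s E \<le> dyadic_content s F"
  unfolding dyadic_content_def by (intro INF_superset_mono) auto

lemma dyadic_content_cell_le:
  assumes "E \<subseteq> dyadic_cell q"
  shows "dyadic_content s E \<le> ennreal ((1 / 2 ^ fst q) powr s)"
proof -
  have "dyadic_content s E \<le> cell_weight s {q}"
    using assms by (intro dyadic_content_le_cell_weight) auto
  also have "cell_weight s {q} = ennreal ((1 / 2 ^ fst q) powr s)"
    unfolding cell_weight_def by (simp add: nn_integral_indicator_singleton)
  finally show ?thesis .
qed

lemma exists_dyadic_cover:
  assumes "dyadic_content s E < \<infinity>" "0 < e"
  obtains V where "E \<subseteq> \<Union>(dyadic_cell ` V)" "cell_weight s V \<le> dyadic_content s E + ennreal e"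
proof -
  have "dyadic_content s E < dyadic_content s E + ennreal e"
    using assms ennreal_add_left_cancel_less[of "dyadic_content s E" 0 "ennreal e"] by simp
  then obtain V where "E \<subseteq> \<Union>(dyadic_cell ` V)" "cell_weight s V < dyadic_content s E + ennreal e"
    unfolding dyadic_content_def[of s E] INF_less_iff by blast
  then show ?thesis using that less_imp_le by blast
qed

lemma dyadic_content_Un_le: "dyadic_content s (E \<union> F) \<le> dyadic_content s E + dyadic_content s F"
proof (rule ennreal_le_epsilon)
  fix e :: real
  assume fin: "dyadic_content s E + dyadic_content s F < top" and e: "0 < e"
  obtain V where V: "E \<subseteq> \<Union>(dyadic_cell ` V)" "cell_weight s V \<le> dyadic_content s E + ennreal (e / 2)"
    using exists_dyadic_cover[of s E "e / 2"] fin e by (auto simp: ennreal_add_less_top)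
  obtain W where W: "F \<subseteq> \<Union>(dyadic_cell ` W)" "cell_weight s W \<le> dyadic_content s F + ennreal (e / 2)"
    using exists_dyadic_cover[of s F "e / 2"] fin e by (auto simp: ennreal_add_less_top)
  have "dyadic_content s (E \<union> F) \<le> cell_weight s (V \<union> W)"
    using V W by (intro dyadic_content_le_cell_weight) blast
  also have "\<dots> \<le> cell_weight s V + cell_weight s W"
    unfolding cell_weight_def
    by (subst nn_integral_add[symmetric]) (auto intro!: nn_integral_mono simp: indicator_def)
  also have "\<dots> \<le> (dyadic_content s E + ennreal (e / 2)) + (dyadic_content s F + ennreal (e / 2))"
    using V W by (intro add_mono)
  also have "\<dots> = dyadic_content s E + dyadic_content s F + ennreal e"
    using e by (simp add: ac_simps flip: ennreal_plus)
  finally show "dyadic_content s (E \<union> F) \<le> dyadic_content s E + dyadic_content s F + ennreal e" .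
qed

lemma dyadic_content_empty [simp]: "dyadic_content s {} = 0"
  using dyadic_content_le_cell_weight[of "{}" "{}" s] by (simp add: cell_weight_def)

lemma dyadic_content_UN_le:
  "finite I \<Longrightarrow> dyadic_content s (\<Union>i\<in>I. E i) \<le> (\<Sum>i\<in>I. dyadic_content s (E i))"
proof (induction rule: finite_induct)
  case (insert i I)
  have "dyadic_content s (\<Union>i\<in>insert i I. E i) \<le> dyadic_content s (E i) + dyadic_content s (\<Union>i\<in>I. E i)"
    using dyadic_content_Un_le by simp
  also have "\<dots> \<le> dyadic_content s (E i) + (\<Sum>i\<in>I. dyadic_content s (E i))"
    by (intro add_left_mono insert.IH)
  finally show ?case using insert by simp
qed simp

section \<open>Continuity of the net content from below\<close>

definition coarsest_cells :: "(nat \<times> ('n::finite \<Rightarrow> int)) set \<Rightarrow> (nat \<times> ('n \<Rightarrow> int)) set" where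
  "coarsest_cells U = {q\<in>U. \<forall>q'\<in>U. fst q' < fst q \<longrightarrow> \<not> dyadic_cell q \<subseteq> dyadic_cell q'}"

lemma dyadic_cell_nested:
  "x \<in> dyadic_cell q \<Longrightarrow> x \<in> dyadic_cell q' \<Longrightarrow> fst q \<le> fst q' \<Longrightarrow> dyadic_cell q' \<subseteq> dyadic_cell q"
  unfolding dyadic_cell_def by clarsimp (metis dyadic_index_coarser)

lemma dyadic_cell_unique:
  "x \<in> dyadic_cell q \<Longrightarrow> x \<in> dyadic_cell q' \<Longrightarrow> fst q = fst q' \<Longrightarrow> q = q'"
  unfolding dyadic_cell_def by (simp add: prod_eq_iff)

text \<open>The cell of least level around \<open>x\<close> survives. The bound on its level says
  that the cell around a fixed point never becomes finer when covers are merged, so that it finally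
  stabilises.\<close>

lemma coarsest_cells_cover:
  assumes "q \<in> U" "x \<in> dyadic_cell q"
  obtains q' where "q' \<in> coarsest_cells U" "x \<in> dyadic_cell q'" "fst q' \<le> fst q"
proof -
  let ?P = "\<lambda>q. q \<in> U \<and> x \<in> dyadic_cell q"
  obtain q' where q': "?P q'" "\<And>q''. ?P q'' \<Longrightarrow> fst q' \<le> fst q''"
    using ex_has_least_nat[of ?P q fst] assms by blast
  then have "q' \<in> coarsest_cells U"
    unfolding coarsest_cells_def by (auto simp: not_le[symmetric])
  then show ?thesis using that q' assms by blast
qed

text \<open>The cells discarded from \<open>W \<union> V\<close>, together with the common ones, still cover \<open>E\<close>: of two
  different cells containing a point, the finer one is discarded.\<close>

lemma dyadic_content_add_coarsest_le:
  assumes "E \<subseteq> \<Union>(dyadic_cell ` W)" "E \<subseteq> \<Union>(dyadic_cell ` V)"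
  shows "dyadic_content s E + cell_weight s (coarsest_cells (W \<union> V)) \<le> cell_weight s W + cell_weight s V"
proof -
  let ?A = "coarsest_cells (W \<union> V)"
  define B where "B = (W \<union> V - ?A) \<union> (W \<inter> V)"
  have "E \<subseteq> \<Union>(dyadic_cell ` B)"
  proof
    fix x assume "x \<in> E"
    then obtain q q' where q: "q \<in> W" "x \<in> dyadic_cell q" "q' \<in> V" "x \<in> dyadic_cell q'"
      using assms by blast
    consider "q = q'" | "fst q < fst q'" | "fst q' < fst q"
      using q dyadic_cell_unique by (metis linorder_neqE_nat)
    then show "x \<in> \<Union>(dyadic_cell ` B)"
    proof cases
      case 1
      then show ?thesis using q by (auto simp: B_def)
    next
      case 2
      then have "q' \<notin> ?A"
        using q dyadic_cell_nested[of x q q'] by (auto simp: coarsest_cells_def)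
      then show ?thesis using q by (auto simp: B_def)
    next
      case 3
      then have "q \<notin> ?A"
        using q dyadic_cell_nested[of x q' q] by (auto simp: coarsest_cells_def)
      then show ?thesis using q by (auto simp: B_def)
    qed
  qed
  then have "dyadic_content s E + cell_weight s ?A \<le> cell_weight s B + cell_weight s ?A"
    by (intro add_right_mono dyadic_content_le_cell_weight)
  \<comment> \<open>A cell counted in both \<open>B\<close> and \<open>?A\<close> lies in
    \<open>W\<close> and in \<open>V\<close>, so it is counted twice on the right as well.\<close>
  also have "\<dots> \<le> cell_weight s W + cell_weight s V"
    unfolding cell_weight_def
    by (subst (1 2) nn_integral_add[symmetric])
       (auto intro!: nn_integral_mono simp: indicator_def B_def coarsest_cells_def)
  finally show ?thesis .
qed

text \<open>Fatou's lemma: for a cell that is eventually in \<open>W n\<close>, the indicators are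
  eventually 1.\<close>

lemma cell_weight_eventually_le:
  fixes W :: "nat \<Rightarrow> (nat \<times> ('n::finite \<Rightarrow> int)) set"
  shows "cell_weight s {q. \<forall>\<^sub>F n in sequentially. q \<in> W n} \<le> liminf (\<lambda>n. cell_weight s (W n))"
proof -
  have "cell_weight s {q. \<forall>\<^sub>F n in sequentially. q \<in> W n} \<le>
     (\<integral>\<^sup>+q. liminf (\<lambda>n. ennreal ((1 / 2 ^ fst q) powr s) * indicator (W n) q) \<partial>count_space UNIV)"
    unfolding cell_weight_def
  proof (rule nn_integral_mono)
    fix q :: "nat \<times> ('n \<Rightarrow> int)"
    let ?w = "ennreal ((1 / 2 ^ fst q) powr s)"
    show "?w * indicator {q. \<forall>\<^sub>F n in sequentially. q \<in> W n} q
      \<le> liminf (\<lambda>n. ?w * indicator (W n) q)"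
    proof (cases "\<forall>\<^sub>F n in sequentially. q \<in> W n")
      case True
      then have "?w \<le> liminf (\<lambda>n. ?w * indicator (W n) q)"
        by (intro Liminf_bounded) (auto elim!: eventually_mono)
      then show ?thesis using True by simp
    qed simp
  qed
  also have "\<dots> \<le> liminf (\<lambda>n. cell_weight s (W n))"
    unfolding cell_weight_def by (intro nn_integral_liminf) simp
  finally show ?thesis .
qed

text \<open>Near-optimal covers \<open>V n\<close> of the \<open>E n\<close> are merged into covers
  \<open>W n\<close>, keeping the coarsest cells. As \<open>E n\<close> is covered by both
  \<open>W n\<close> and \<open>V (Suc n)\<close>, \<open>dyadic_content_add_coarsest_le\<close>
  shows that a merger adds only the error of \<open>V (Suc n)\<close>, and these errors sum to at
  most \<open>e\<close>. Around each point the cells of \<open>W n\<close> stabilise; the stable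
  cells cover the union, and Fatou's lemma bounds their weight. No measurability of the
  \<open>E n\<close> enters, so projections are allowed.\<close>

lemma dyadic_content_incseq_UN_le:
  assumes "incseq E"
  shows "dyadic_content s (\<Union>n. E n) \<le> (SUP n. dyadic_content s (E n))" (is "_ \<le> ?L")
proof (rule ennreal_le_epsilon)
  fix e :: real
  assume fin: "?L < top" and e: "0 < e"
  have le: "dyadic_content s (E n) \<le> ?L" for n by (rule SUP_upper) simp
  then have fin': "dyadic_content s (E n) < \<infinity>" for n
    using fin by (metis infinity_ennreal_def le_less_trans)
  have "\<exists>V. E n \<subseteq> \<Union>(dyadic_cell ` V) \<and>
     cell_weight s V \<le> dyadic_content s (E n) + ennreal (e / 2 ^ Suc n)" for n
    using exists_dyadic_cover[OF fin', of "e / 2 ^ Suc n" n] e by (metis zero_less_divide_iff zero_less_numeral zero_less_power)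
  then obtain V where V: "\<And>n. E n \<subseteq> \<Union>(dyadic_cell ` V n)"
    "\<And>n. cell_weight s (V n) \<le> dyadic_content s (E n) + ennreal (e / 2 ^ Suc n)"
    by metis
  define W where "W = rec_nat (V 0) (\<lambda>n w. coarsest_cells (w \<union> V (Suc n)))"
  have W_Suc: "W (Suc n) = coarsest_cells (W n \<union> V (Suc n))" for n by (simp add: W_def)
  have cover: "E n \<subseteq> \<Union>(dyadic_cell ` W n)" for n
  proof (cases n)
    case 0
    then show ?thesis using V(1)[of 0] by (simp add: W_def)
  next
    case (Suc m)
    show ?thesis
    proof
      fix x assume "x \<in> E n"
      then obtain q where "q \<in> W m \<union> V (Suc m)" "x \<in> dyadic_cell q" using V(1)[of n] Suc by blast
      then obtain q' where "q' \<in> W n" "x \<in> dyadic_cell q'"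
        using coarsest_cells_cover W_Suc Suc by metis
      then show "x \<in> \<Union>(dyadic_cell ` W n)" by blast
    qed
  qed
  have weight: "cell_weight s (W n) \<le> dyadic_content s (E n) + ennreal (e * (1 - 1 / 2 ^ Suc n))" for n
  proof (induction n)
    case 0
    then show ?case using V(2)[of 0] by (simp add: W_def)
  next
    case (Suc n)
    have "dyadic_content s (E n) + cell_weight s (W (Suc n)) \<le> cell_weight s (W n) + cell_weight s (V (Suc n))"
      unfolding W_Suc
      using cover V(1)[of "Suc n"] incseq_SucD[OF assms, of n]
      by (intro dyadic_content_add_coarsest_le) auto
    also have "\<dots> \<le> (dyadic_content s (E n) + ennreal (e * (1 - 1 / 2 ^ Suc n))) +
       (dyadic_content s (E (Suc n)) + ennreal (e / 2 ^ Suc (Suc n)))"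
      by (intro add_mono Suc.IH V(2))
    also have "\<dots> = dyadic_content s (E n) + (dyadic_content s (E (Suc n)) +
       (ennreal (e * (1 - 1 / 2 ^ Suc n)) + ennreal (e / 2 ^ Suc (Suc n))))"
      by (simp only: ac_simps)
    also have "ennreal (e * (1 - 1 / 2 ^ Suc n)) + ennreal (e / 2 ^ Suc (Suc n)) =
        ennreal (e * (1 - 1 / 2 ^ Suc (Suc n)))"
    proof -
      have "(1::real) \<le> 2 * 2 ^ n" by (metis one_le_numeral one_le_power power_Suc)
      then show ?thesis using e by (subst ennreal_plus[symmetric]) (auto simp: field_simps)
    qed
    \<comment> \<open>The content of \<open>E n\<close> is finite and is cancelled on both
      sides.\<close>
    finally show ?case
      using fin'[of n] by (auto simp: ennreal_add_left_cancel_le)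
  qed
  define W' where "W' = {q. \<forall>\<^sub>F n in sequentially. q \<in> W n}"
  have "(\<Union>n. E n) \<subseteq> \<Union>(dyadic_cell ` W')"
  proof
    fix x assume "x \<in> (\<Union>n. E n)"
    then obtain m where m: "x \<in> E m" by blast
    \<comment> \<open>The coarsest cell that ever covers \<open>x\<close> from stage
      \<open>m\<close> on cannot be replaced later, since a replacement would be strictly
      coarser.\<close>
    let ?P = "\<lambda>q. \<exists>n\<ge>m. q \<in> W n \<and> x \<in> dyadic_cell q"
    obtain q0 where "?P q0" using cover[of m] m by blast
    then obtain q where q: "?P q" "\<And>q'. ?P q' \<Longrightarrow> fst q \<le> fst q'"
      using ex_has_least_nat[of ?P q0 fst] by blast
    then obtain N where N: "N \<ge> m" "q \<in> W N" "x \<in> dyadic_cell q" by blast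
    have "q \<in> W n" if "n \<ge> N" for n
      using that
    proof (induction rule: dec_induct)
      case base
      then show ?case by (rule N(2))
    next
      case (step n)
      then obtain q' where q': "q' \<in> W (Suc n)" "x \<in> dyadic_cell q'" "fst q' \<le> fst q"
        using coarsest_cells_cover[of q "W n \<union> V (Suc n)" x] N W_Suc by (metis UnI1)
      moreover have "fst q \<le> fst q'" using q(2)[of q'] q' step N by (meson le_SucI le_trans)
      ultimately have "q' = q" using dyadic_cell_unique N by (metis le_antisym)
      then show ?case using q' by simp
    qed
    then have "q \<in> W'" unfolding W'_def eventually_sequentially by blast
    then show "x \<in> \<Union>(dyadic_cell ` W')" using N by blast
  qed
  then have "dyadic_content s (\<Union>n. E n) \<le> cell_weight s W'"
    by (rule dyadic_content_le_cell_weight)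
  also have "\<dots> \<le> liminf (\<lambda>n. cell_weight s (W n))"
    unfolding W'_def by (rule cell_weight_eventually_le)
  also have "\<dots> \<le> liminf (\<lambda>n::nat. ?L + ennreal e)"
  proof (intro Liminf_mono always_eventually allI)
    fix n
    have "ennreal (e * (1 - 1 / 2 ^ Suc n)) \<le> ennreal e"
      using e one_le_power[of "2::real" "Suc n"] by (intro ennreal_leI mult_left_le) auto
    then show "cell_weight s (W n) \<le> ?L + ennreal e"
      using weight[of n] le[of n] by (meson add_mono order_trans)
  qed
  also have "\<dots> = ?L + ennreal e" by (simp add: Liminf_const)
  finally show "dyadic_content s (\<Union>n. E n) \<le> ?L + ennreal e" .
qed

text \<open>Continuity from below upgrades finite subadditivity to countable unions of null
  sets.\<close>

lemma dyadic_content_UN_null: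
  assumes "\<And>n::nat. dyadic_content s (E n) = 0"
  shows "dyadic_content s (\<Union>n. E n) = 0"
proof -
  have "dyadic_content s (\<Union>n. \<Union>i\<in>{..n}. E i) \<le> (SUP n. dyadic_content s (\<Union>i\<in>{..n}. E i))"
    by (intro dyadic_content_incseq_UN_le monoI UN_mono) auto
  also have "\<dots> \<le> 0"
    using dyadic_content_UN_le[of "{.._}" s E] assms by (intro SUP_least) (metis finite_atMost sum.neutral)
  also have "(\<Union>n. \<Union>i\<in>{..n}. E i) = (\<Union>n. E n)" by auto
  finally show ?thesis by simp
qed

section \<open>Null net content and Hausdorff measure\<close>

text \<open>In a cover of tiny total weight every single cell is tiny, so for null sets the content
  sees the same covers as the measure.\<close>

lemma hausdorff_measure_eq_0_if_dyadic_content_eq_0: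
  fixes E :: "(real ^ 'n::finite) set"
  assumes "0 < s" "dyadic_content s E = 0"
  shows "hausdorff_measure s E = 0"
proof -
  let ?D = "real CARD('n)"
  have D: "?D > 0" by simp
  have "hausdorff_premeasure s \<epsilon> E \<le> ennreal e" if "\<epsilon> > 0" "e > 0" for \<epsilon> e
  proof -
    \<comment> \<open>The first bound controls the sum after passing from sides to diameters; the
      second one forces each diameter below \<open>\<epsilon>\<close>.\<close>
    define b where "b = min (e / ?D powr s) ((\<epsilon> / ?D) powr s)"
    have b: "b > 0" using that D by (simp add: b_def)
    obtain V where V: "E \<subseteq> \<Union>(dyadic_cell ` V)" "cell_weight s V \<le> ennreal b"
      using exists_dyadic_cover[of s E b] assms b by auto
    \<comment> \<open>Cells are enumerated through \<open>to_nat\<close>. Indices outside its range,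
      or of cells not in \<open>V\<close>, give the empty set, whose diameter contributes
      \<open>0 powr s = 0\<close>.\<close>
    define U where "U i = (if i \<in> range (to_nat :: nat \<times> ('n \<Rightarrow> int) \<Rightarrow> nat) \<and> from_nat i \<in> V
      then dyadic_cell (from_nat i :: nat \<times> ('n \<Rightarrow> int)) else {})" for i
    have dist: "dist x y \<le> ?D * (1 / 2 ^ fst q)" if "x \<in> dyadic_cell q" "y \<in> dyadic_cell q"
      for x y :: "real ^ 'n" and q
      using that dist_dyadic_cell_le[of "fst q" x y] by (simp add: dyadic_cell_def)
    have bdd: "bounded (dyadic_cell q)" for q :: "nat \<times> ('n \<Rightarrow> int)"
    proof (cases "dyadic_cell q = {}")
      case False
      then obtain x where "x \<in> dyadic_cell q" by blast
      then show ?thesis using dist[of x q] unfolding bounded_def by blast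
    qed simp
    have diam: "diameter (dyadic_cell q) \<le> ?D * (1 / 2 ^ fst q)" for q :: "nat \<times> ('n \<Rightarrow> int)"
    proof (rule diameter_le)
      show "dyadic_cell q \<noteq> {} \<or> 0 \<le> ?D * (1 / 2 ^ fst q)" by simp
      fix x y :: "real ^ 'n" assume "x \<in> dyadic_cell q" "y \<in> dyadic_cell q"
      then show "norm (x - y) \<le> ?D * (1 / 2 ^ fst q)"
        using dist by (simp add: dist_norm)
    qed
    have small: "?D * (1 / 2 ^ fst q) \<le> \<epsilon>" if "q \<in> V" for q
    proof -
      have "ennreal ((1 / 2 ^ fst q) powr s) = cell_weight s {q}"
        unfolding cell_weight_def by (simp add: nn_integral_indicator_singleton)
      also have "\<dots> \<le> cell_weight s V"
        unfolding cell_weight_def using that by (intro nn_integral_mono) (auto simp: indicator_def)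
      finally have "ennreal ((1 / 2 ^ fst q) powr s) \<le> ennreal b" using V(2) by (rule order_trans)
      then have "(1 / 2 ^ fst q) powr s \<le> (\<epsilon> / ?D) powr s" using b by (simp add: b_def)
      then have "1 / 2 ^ fst q \<le> \<epsilon> / ?D"
        using powr_less_mono2[of s "\<epsilon> / ?D" "1 / 2 ^ fst q"] \<open>0 < s\<close> \<open>\<epsilon> > 0\<close> D by fastforce
      then show ?thesis by (simp add: field_simps)
    qed
    have "hausdorff_premeasure s \<epsilon> E \<le> (\<Sum>i. ennreal (diameter (U i) powr s))"
      unfolding hausdorff_premeasure_def
    proof (intro INF_lower CollectI conjI allI)
      show "E \<subseteq> (\<Union>i. U i)"
      proof
        fix x assume "x \<in> E"
        then obtain q where "q \<in> V" "x \<in> dyadic_cell q" using V by blast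
        then have "x \<in> U (to_nat q)" by (simp add: U_def)
        then show "x \<in> (\<Union>i. U i)" by blast
      qed
      show "bounded (U i)" for i by (simp add: U_def bdd)
      show "diameter (U i) \<le> \<epsilon>" for i
        using order_trans[OF diam small] \<open>\<epsilon> > 0\<close> by (simp add: U_def)
    qed
    also have "\<dots> = (\<integral>\<^sup>+i. ennreal (diameter (U i) powr s) \<partial>count_space UNIV)"
      by (simp add: nn_integral_count_space_nat)
    also have "\<dots> = (\<integral>\<^sup>+i. ennreal (diameter (U i) powr s) * indicator (range (to_nat :: nat \<times> ('n \<Rightarrow> int) \<Rightarrow> nat)) i \<partial>count_space UNIV)"
      by (intro nn_integral_cong) (auto simp: U_def indicator_def)
    also have "\<dots> = (\<integral>\<^sup>+i. ennreal (diameter (U i) powr s) \<partial>count_space (range (to_nat :: nat \<times> ('n \<Rightarrow> int) \<Rightarrow> nat)))"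
      by (simp add: nn_integral_count_space_indicator)
    also have "\<dots> = (\<integral>\<^sup>+q. ennreal (diameter (U (to_nat (q :: nat \<times> ('n \<Rightarrow> int)))) powr s) \<partial>count_space UNIV)"
      by (rule nn_integral_bij_count_space[symmetric]) (simp add: inj_on_imp_bij_betw)
    also have "\<dots> \<le> (\<integral>\<^sup>+q. ennreal (?D powr s) * (ennreal ((1 / 2 ^ fst q) powr s) * indicator V q) \<partial>count_space UNIV)"
    proof (intro nn_integral_mono)
      fix q :: "nat \<times> ('n \<Rightarrow> int)"
      have "diameter (dyadic_cell q) powr s \<le> (?D * (1 / 2 ^ fst q)) powr s"
        using diam[of q] bdd[of q] \<open>0 < s\<close> by (intro powr_mono2) (auto intro: diameter_ge_0)
      also have "\<dots> = ?D powr s * (1 / 2 ^ fst q) powr s" by (rule powr_mult)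
      finally have "diameter (dyadic_cell q) powr s \<le> ?D powr s * (1 / 2 ^ fst q) powr s" .
      then show "ennreal (diameter (U (to_nat q)) powr s)
         \<le> ennreal (?D powr s) * (ennreal ((1 / 2 ^ fst q) powr s) * indicator V q)"
        using \<open>0 < s\<close> by (auto simp: U_def indicator_def intro!: ennreal_leI simp flip: ennreal_mult)
    qed
    also have "\<dots> = ennreal (?D powr s) * cell_weight s V"
      unfolding cell_weight_def by (simp add: nn_integral_cmult)
    also have "\<dots> \<le> ennreal (?D powr s) * ennreal b" by (intro mult_left_mono V(2)) simp
    also have "\<dots> \<le> ennreal e"
    proof -
      have "?D powr s * b \<le> ?D powr s * (e / ?D powr s)" by (intro mult_left_mono) (auto simp: b_def)
      then show ?thesis by (simp add: ennreal_leI flip: ennreal_mult')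
    qed
    finally show ?thesis .
  qed
  then have "hausdorff_premeasure s \<epsilon> E \<le> 0" if "\<epsilon> > 0" for \<epsilon>
    using that by (metis add_0 ennreal_le_epsilon)
  then have "hausdorff_measure s E \<le> 0"
    unfolding hausdorff_measure_def by (intro SUP_least) simp
  then show ?thesis by simp
qed

section \<open>Suslin sets\<close>

text \<open>Sequential closedness in the product with Baire space: there, convergence means that
  each coordinate is eventually constant.\<close>

definition seq_closed :: "('a::metric_space \<times> (nat \<Rightarrow> nat)) set \<Rightarrow> bool" where
  "seq_closed C \<longleftrightarrow> (\<forall>Y F y f. (\<forall>k. (Y k, F k) \<in> C) \<and> Y \<longlonglongrightarrow> y \<and>
     (\<forall>i. \<forall>\<^sub>F k in sequentially. F k i = f i) \<longrightarrow> (y, f) \<in> C)"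

definition suslin :: "'a::metric_space set \<Rightarrow> bool" where
  "suslin S \<longleftrightarrow> (\<exists>C. seq_closed C \<and> S = fst ` C)"

lemma seq_closedD:
  assumes "seq_closed C" "\<And>k. (Y k, F k) \<in> C" "Y \<longlonglongrightarrow> y"
    "\<And>i. \<forall>\<^sub>F k in sequentially. F k i = f i"
  shows "(y, f) \<in> C"
  using assms unfolding seq_closed_def by blast

lemma suslin_closed:
  assumes "closed S"
  shows "suslin S"
  unfolding suslin_def
proof (intro exI conjI)
  show "seq_closed (S \<times> UNIV)"
    unfolding seq_closed_def using assms by (auto intro: closed_sequentially)
qed simp

text \<open>Coordinate 0 of the witness names a set of the union that contains the point. In a
  convergent sequence it is eventually constant, so the limit stays in one
  \<open>C n\<close>.\<close>

lemma suslin_UN: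
  assumes "\<And>n::nat. suslin (S n)"
  shows "suslin (\<Union>n. S n)"
proof -
  obtain C where C: "\<And>n. seq_closed (C n)" "\<And>n. S n = fst ` C n"
    using assms unfolding suslin_def by metis
  let ?C = "{(x, f). (x, \<lambda>i. f (Suc i)) \<in> C (f 0)}"
  have "seq_closed ?C"
    unfolding seq_closed_def
  proof (intro allI impI, elim conjE)
    fix Y y and F :: "nat \<Rightarrow> nat \<Rightarrow> nat" and f
    assume *: "\<forall>k. (Y k, F k) \<in> ?C" "Y \<longlonglongrightarrow> y" "\<forall>i. \<forall>\<^sub>F k in sequentially. F k i = f i"
    then obtain K where K: "\<And>k. k \<ge> K \<Longrightarrow> F k 0 = f 0" by (meson eventually_sequentially)
    have "(y, \<lambda>i. f (Suc i)) \<in> C (f 0)"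
    proof (rule seq_closedD[OF C(1)])
      show "(Y (k + K), \<lambda>i. F (k + K) (Suc i)) \<in> C (f 0)" for k
        using *(1)[rule_format, of "k + K"] K[of "k + K"] by simp
      show "(\<lambda>k. Y (k + K)) \<longlonglongrightarrow> y" using * by (simp add: LIMSEQ_ignore_initial_segment)
      show "\<forall>\<^sub>F k in sequentially. F (k + K) (Suc i) = f (Suc i)" for i
        using *(3) by (subst eventually_sequentially_seg) simp
    qed
    then show "(y, f) \<in> ?C" by simp
  qed
  moreover have "(\<Union>n. S n) = fst ` ?C"
  proof (intro equalityI subsetI)
    fix x assume "x \<in> (\<Union>n. S n)"
    then obtain n f where "(x, f) \<in> C n" by (auto simp: C)
    then have "(x, \<lambda>i. case i of 0 \<Rightarrow> n | Suc i \<Rightarrow> f i) \<in> ?C" by simp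
    then show "x \<in> fst ` ?C" by (rule image_eqI[rotated]) simp
  next
    fix x assume "x \<in> fst ` ?C"
    then obtain f where "(x, \<lambda>i. f (Suc i)) \<in> C (f 0)" by auto
    then show "x \<in> (\<Union>n. S n)" unfolding C(2) by (metis UN_I UNIV_I fst_conv imageI)
  qed
  ultimately show ?thesis unfolding suslin_def by (intro exI[of _ ?C] conjI)
qed

text \<open>One sequence carries witnesses for all the sets, interleaved by the pairing
  function.\<close>

lemma suslin_INT:
  assumes "\<And>n::nat. suslin (S n)"
  shows "suslin (\<Inter>n. S n)"
proof -
  obtain C where C: "\<And>n. seq_closed (C n)" "\<And>n. S n = fst ` C n"
    using assms unfolding suslin_def by metis
  let ?C = "{(x, f). \<forall>n. (x, \<lambda>i. f (prod_encode (n, i))) \<in> C n}"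
  have "seq_closed ?C"
    unfolding seq_closed_def
  proof (intro allI impI, elim conjE)
    fix Y y and F :: "nat \<Rightarrow> nat \<Rightarrow> nat" and f
    assume *: "\<forall>k. (Y k, F k) \<in> ?C" "Y \<longlonglongrightarrow> y" "\<forall>i. \<forall>\<^sub>F k in sequentially. F k i = f i"
    have "(y, \<lambda>i. f (prod_encode (n, i))) \<in> C n" for n
      by (rule seq_closedD[OF C(1), of Y "\<lambda>k i. F k (prod_encode (n, i))"]) (use * in auto)
    then show "(y, f) \<in> ?C" by simp
  qed
  moreover have "(\<Inter>n. S n) = fst ` ?C"
  proof (intro equalityI subsetI)
    fix x assume "x \<in> (\<Inter>n. S n)"
    then have "\<forall>n. x \<in> fst ` C n" by (simp add: C(2))
    then have "\<forall>n. \<exists>f. (x, f) \<in> C n" by force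
    then obtain f where f: "\<And>n. (x, f n) \<in> C n" by metis
    then have "(x, \<lambda>m. case prod_decode m of (n, i) \<Rightarrow> f n i) \<in> ?C" by simp
    then show "x \<in> fst ` ?C" by (rule image_eqI[rotated]) simp
  next
    fix x assume "x \<in> fst ` ?C"
    then obtain f where "(x, f) \<in> ?C" by force
    then have "(x, \<lambda>i. f (prod_encode (n, i))) \<in> C n" for n by simp
    then show "x \<in> (\<Inter>n. S n)" unfolding C(2) by (metis INT_I fst_conv imageI)
  qed
  ultimately show ?thesis unfolding suslin_def by (intro exI[of _ ?C] conjI)
qed

text \<open>An open set is a countable union of closed sets, by the distance to its complement. The
  whole space is treated apart because \<open>infdist x {} = 0\<close> by convention.\<close>

lemma suslin_open:
  fixes S :: "'a::metric_space set"
  assumes "open S"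
  shows "suslin S"
proof (cases "S = UNIV")
  case True
  then show ?thesis by (simp add: suslin_closed)
next
  case False
  have "x \<in> S \<longleftrightarrow> (\<exists>n. 1 / real (Suc n) \<le> infdist x (- S))" for x
  proof -
    have "x \<in> S \<longleftrightarrow> infdist x (- S) \<noteq> 0"
      using in_closed_iff_infdist_zero[of "- S" x] assms False by auto
    also have "\<dots> \<longleftrightarrow> 0 < infdist x (- S)" using infdist_nonneg[of x "- S"] by linarith
    also have "\<dots> \<longleftrightarrow> (\<exists>n. 1 / real (Suc n) \<le> infdist x (- S))"
    proof
      assume "0 < infdist x (- S)"
      then show "\<exists>n. 1 / real (Suc n) \<le> infdist x (- S)"
        by (meson nat_approx_posE less_imp_le)
    next
      assume "\<exists>n. 1 / real (Suc n) \<le> infdist x (- S)"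
      then obtain n where "1 / real (Suc n) \<le> infdist x (- S)" ..
      moreover have "0 < 1 / real (Suc n)" by simp
      ultimately show "0 < infdist x (- S)" by linarith
    qed
    finally show ?thesis .
  qed
  then have "S = (\<Union>n. {x. 1 / real (Suc n) \<le> infdist x (- S)})" by blast
  moreover have "suslin (\<Union>n. {x. 1 / real (Suc n) \<le> infdist x (- S)})"
    by (intro suslin_UN suslin_closed closed_Collect_le continuous_intros)
  ultimately show ?thesis by simp
qed

lemma suslin_borel:
  fixes S :: "'a::metric_space set"
  assumes "S \<in> sets borel"
  shows "suslin S"
proof -
  have "S \<in> sigma_sets UNIV {S. open S}" using assms by (simp add: sets_borel)
  \<comment> \<open>Complements of Suslin sets need not be Suslin, so the induction carries both a
    set and its complement.\<close>
  then have "suslin S \<and> suslin (- S)"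
  proof (induction rule: sigma_sets.induct)
    case (Basic S)
    then show ?case by (simp add: suslin_open suslin_closed closed_Compl)
  next
    case Empty
    then show ?case by (simp add: suslin_closed)
  next
    case (Compl S)
    then show ?case by (simp add: Compl_eq_Diff_UNIV[symmetric])
  next
    case (Union S)
    then show ?case by (simp add: suslin_UN suslin_INT Compl_UN)
  qed
  then show ?thesis by blast
qed

text \<open>A diagonal argument: the bounds on the coordinates make the second components range over a
  compact subset of Baire space.\<close>

lemma seq_closed_limit:
  assumes C: "seq_closed C" "\<And>k. (Y k, F k) \<in> C" "Y \<longlonglongrightarrow> y"
    and bound: "\<And>i. \<exists>u K. \<forall>k\<ge>K. F k i \<le> u"
  shows "y \<in> fst ` C"
proof -
  let ?P = "\<lambda>n g. infinite {k. \<forall>i<n. F k i = g i}"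
  have "\<exists>g. \<forall>n. ?P n (g n) \<and> (\<forall>i<n. g (Suc n) i = g n i)"
  proof (rule dependent_nat_choice)
    show "\<exists>g. ?P 0 g" by simp
    fix g n assume inf: "?P n g"
    obtain u K where uK: "\<forall>k\<ge>K. F k n \<le> u" using bound by blast
    let ?S = "{k. \<forall>i<n. F k i = g i} - {..<K}"
    have "infinite ?S" using inf by (simp add: Diff_infinite_finite)
    moreover have "(\<lambda>k. F k n) ` ?S \<subseteq> {..u}"
    proof (rule image_subsetI)
      fix k assume "k \<in> ?S"
      then have "K \<le> k" by (simp add: not_less)
      then show "F k n \<in> {..u}" using uK by blast
    qed
    then have "finite ((\<lambda>k. F k n) ` ?S)" by (rule finite_subset) simp
    ultimately obtain k0 where k0: "infinite {k\<in>?S. F k n = F k0 n}"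
      using pigeonhole_infinite[of ?S "\<lambda>k. F k n"] by blast
    have "{k\<in>?S. F k n = F k0 n} \<subseteq> {k. \<forall>i<Suc n. F k i = (g(n := F k0 n)) i}"
      by (auto simp: less_Suc_eq)
    then have "?P (Suc n) (g(n := F k0 n))" using k0 by (meson finite_subset)
    then show "\<exists>g'. ?P (Suc n) g' \<and> (\<forall>i<n. g' i = g i)" by (intro exI conjI) auto
  qed
  then obtain g where g: "\<And>n. ?P n (g n)" "\<And>n i. i < n \<Longrightarrow> g (Suc n) i = g n i" by blast
  have stable: "g n i = g (Suc i) i" if "Suc i \<le> n" for n i
    using that by (induction rule: dec_induct) (auto simp: g(2))
  have "\<exists>k\<ge>n. \<forall>i<n. F k i = g n i" for n
    using g(1)[of n] unfolding infinite_nat_iff_unbounded_le by blast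
  then obtain r where r: "\<And>n. r n \<ge> n" "\<And>n i. i < n \<Longrightarrow> F (r n) i = g n i" by metis
  have "(y, \<lambda>i. g (Suc i) i) \<in> C"
  proof (rule seq_closedD[OF C(1)])
    show "(Y (r n), F (r n)) \<in> C" for n by (rule C)
    have "filterlim r at_top sequentially"
      using r(1) by (intro filterlim_at_top_mono[OF filterlim_ident]) auto
    then show "(\<lambda>n. Y (r n)) \<longlonglongrightarrow> y" using C(3) by (rule filterlim_compose[rotated])
    show "\<forall>\<^sub>F n in sequentially. F (r n) i = g (Suc i) i" for i
    proof (rule eventually_sequentiallyI)
      fix n assume "Suc i \<le> n"
      then show "F (r n) i = g (Suc i) i" using r(2)[of i n] stable[of i n] by simp
    qed
  qed
  then show ?thesis by force
qed

section \<open>Playing the game as Bob\<close>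

lemma legal_history_snoc:
  "legal_history \<sigma> (xs @ [a]) \<longleftrightarrow> legal_history \<sigma> xs \<and> a \<in> \<sigma> xs"
proof
  assume L: "legal_history \<sigma> (xs @ [a])"
  have "xs ! k \<in> \<sigma> (take k xs)" if "k < length xs" for k
    using L that unfolding legal_history_def by (auto dest!: spec[of _ k] simp: nth_append)
  moreover have "a \<in> \<sigma> xs"
    using L unfolding legal_history_def by (auto dest!: spec[of _ "length xs"])
  ultimately show "legal_history \<sigma> xs \<and> a \<in> \<sigma> xs" by (simp add: legal_history_def)
next
  assume "legal_history \<sigma> xs \<and> a \<in> \<sigma> xs"
  then show "legal_history \<sigma> (xs @ [a])"
    unfolding legal_history_def by (auto simp: nth_append less_Suc_eq)
qed

lemma legal_history_Nil [simp]: "legal_history \<sigma> []"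
  by (simp add: legal_history_def)

lemma bob_play_imp_legal_history: "bob_play \<sigma> x \<Longrightarrow> legal_history \<sigma> (map x [0..<n])"
  by (induction n) (auto simp: legal_history_snoc bob_play_def alice_moves_def)

text \<open>Later moves are finite because a bounded separated set in a Heine-Borel space is finite.
  This matters, as an infinite move would have \<open>card\<close> equal to 0.\<close>

lemma legal_move_finite_nonempty:
  fixes \<sigma> :: "'a::heine_borel list \<Rightarrow> 'a set"
  assumes "legal_strategy \<beta> \<rho>0 \<sigma>" "0 < \<beta>" "0 < \<rho>0" "legal_history \<sigma> xs"
  shows "finite (\<sigma> xs)" "\<sigma> xs \<noteq> {}"
proof -
  have L: "legal_alice_move \<beta> \<rho>0 xs (\<sigma> xs)" using assms by (simp add: legal_strategy_def)
  then show "\<sigma> xs \<noteq> {}" by (simp add: legal_alice_move_def)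
  show "finite (\<sigma> xs)"
  proof (cases "xs = []")
    case True
    then show ?thesis using L by (simp add: legal_alice_move_def)
  next
    case False
    then have "bounded (\<sigma> xs)"
      using L bounded_subset bounded_cball by (metis legal_alice_move_def)
    moreover have "separated_set (3 * (\<beta> ^ length xs * \<rho>0)) (\<sigma> xs)"
      using L by (simp add: legal_alice_move_def)
    then have "uniform_discrete (\<sigma> xs)"
      unfolding uniform_discrete_def separated_set_def
      using assms by (intro exI[of _ "3 * (\<beta> ^ length xs * \<rho>0)"]) (meson not_le mult_pos_pos zero_less_numeral zero_less_power)
    ultimately show ?thesis using uniform_discrete_finite_iff by blast
  qed
qed

text \<open>The radii \<open>(1 - \<beta>) * \<beta> ^ m * \<rho>0\<close> telescope, as for nested
  balls.\<close>

lemma bob_play_dist_le: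
  fixes x :: "nat \<Rightarrow> 'a::metric_space"
  assumes "legal_strategy \<beta> \<rho>0 \<sigma>" "0 < \<beta>" "\<beta> < 1" "0 < \<rho>0" "bob_play \<sigma> x"
  shows "dist (x j) (x (j + m)) \<le> \<beta> ^ j * \<rho>0"
proof -
  have step: "dist (x m) (x (Suc m)) \<le> (1 - \<beta>) * (\<beta> ^ m * \<rho>0)" for m
  proof -
    have "legal_alice_move \<beta> \<rho>0 (map x [0..<Suc m]) (\<sigma> (map x [0..<Suc m]))"
      using assms bob_play_imp_legal_history unfolding legal_strategy_def by blast
    then have "\<sigma> (map x [0..<Suc m]) \<subseteq> cball (x m) ((1 - \<beta>) * (\<beta> ^ m * \<rho>0))"
      by (simp add: legal_alice_move_def split: if_splits)
    moreover have "x (Suc m) \<in> \<sigma> (map x [0..<Suc m])"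
      using assms(5) unfolding bob_play_def alice_moves_def by blast
    ultimately show ?thesis by auto
  qed
  have "dist (x j) (x (j + m)) \<le> (\<beta> ^ j - \<beta> ^ (j + m)) * \<rho>0" for m
  proof (induction m)
    case (Suc m)
    have "dist (x j) (x (j + Suc m)) \<le> dist (x j) (x (j + m)) + dist (x (j + m)) (x (Suc (j + m)))"
      using dist_triangle by simp
    also have "\<dots> \<le> (\<beta> ^ j - \<beta> ^ (j + m)) * \<rho>0 + (1 - \<beta>) * (\<beta> ^ (j + m) * \<rho>0)"
      by (intro add_mono Suc step)
    finally show ?case by (simp add: algebra_simps)
  qed simp
  moreover have "(\<beta> ^ j - \<beta> ^ (j + m)) * \<rho>0 \<le> \<beta> ^ j * \<rho>0" for m
    using assms by (intro mult_right_mono) auto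
  ultimately show ?thesis
    using order_trans by blast
qed

lemma limit_in_bob_balls:
  fixes x :: "nat \<Rightarrow> 'a::metric_space"
  assumes "legal_strategy \<beta> \<rho>0 \<sigma>" "0 < \<beta>" "\<beta> < 1" "0 < \<rho>0" "bob_play \<sigma> x" "x \<longlonglongrightarrow> y"
  shows "y \<in> cball (x j) (\<beta> ^ j * \<rho>0)"
proof -
  have "x (m + j) \<in> cball (x j) (\<beta> ^ j * \<rho>0)" for m
    using bob_play_dist_le[OF assms(1-5), of j m] by (simp add: add.commute)
  moreover have "(\<lambda>m. x (m + j)) \<longlonglongrightarrow> y" using assms(6) by (rule LIMSEQ_ignore_initial_segment)
  ultimately show ?thesis by (rule closed_sequentially[OF closed_cball])
qed

lemma bob_play_convergent:
  fixes x :: "nat \<Rightarrow> 'a::complete_space"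
  assumes "legal_strategy \<beta> \<rho>0 \<sigma>" "0 < \<beta>" "\<beta> < 1" "0 < \<rho>0" "bob_play \<sigma> x"
  shows "convergent x"
proof (intro Cauchy_convergent metric_CauchyI)
  fix e :: real assume "0 < e"
  then obtain j where j: "\<beta> ^ j < e / (2 * \<rho>0)"
    using real_arch_pow_inv[of "e / (2 * \<rho>0)" \<beta>] assms by auto
  have "dist (x m) (x n) < e" if "m \<ge> j" "n \<ge> j" for m n
  proof -
    have "dist (x m) (x n) \<le> dist (x j) (x m) + dist (x j) (x n)" by (metis dist_commute dist_triangle)
    also have "\<dots> \<le> \<beta> ^ j * \<rho>0 + \<beta> ^ j * \<rho>0"
      using bob_play_dist_le[OF assms, of j "m - j"] bob_play_dist_le[OF assms, of j "n - j"] that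
      by (intro add_mono) auto
    also have "\<dots> < e" using j assms(4) by (simp add: field_simps)
    finally show ?thesis .
  qed
  then show "\<exists>M. \<forall>m\<ge>M. \<forall>n\<ge>M. dist (x m) (x n) < e" by blast
qed

text \<open>Along a history that still hits \<open>U i\<close>, up to turn \<open>k i\<close>, the charge of \<open>U i\<close> is \<open>(\<beta> ^ k i) powr t\<close>
  divided by the probability of that history under uniformly random play of Bob. Since \<open>U i\<close> meets
  at most one of the balls offered on each of these turns, the charge is a supermartingale, and Bob
  can always move without increasing the total charge.\<close>

lemma bob_avoids_small_sets:
  fixes \<sigma> :: "'a::heine_borel list \<Rightarrow> 'a set" and U :: "nat \<Rightarrow> 'a set"
  assumes \<beta>: "0 < \<beta>" "\<beta> < 1" and \<rho>0: "0 < \<rho>0" and legal: "legal_strategy \<beta> \<rho>0 \<sigma>"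
    and small: "\<And>i x y. x \<in> U i \<Longrightarrow> y \<in> U i \<Longrightarrow> dist x y < \<beta> ^ k i * \<rho>0"
    and summable: "summable (\<lambda>i. if U i = {} then 0 else (\<beta> ^ k i) powr t)"
  obtains x where "bob_play \<sigma> x"
    "\<And>y. x \<longlonglongrightarrow> y \<Longrightarrow>
       finite {i. y \<in> U i \<and> 1 \<le> (\<Prod>j\<le>k i. real (card (alice_moves \<sigma> x j))) * (\<beta> ^ k i) powr t}"
proof -
  define N where "N xs = (\<Prod>j<length xs. real (card (\<sigma> (take j xs))))" for xs
  define hit where "hit i xs \<longleftrightarrow> U i \<noteq> {} \<and> (\<forall>j<length xs. U i \<inter> cball (xs ! j) (\<beta> ^ j * \<rho>0) \<noteq> {})" for i xs
  define g where "g i xs = (if hit i xs then ennreal (N xs * (\<beta> ^ k i) powr t) else 0)" for i xs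
  \<comment> \<open>Cutting the history off after turn \<open>k i\<close> freezes the charge of
    \<open>U i\<close> from then on.\<close>
  define \<Psi> where "\<Psi> xs = (\<Sum>i. g i (take (Suc (k i)) xs))" for xs
  have N_snoc: "N (xs @ [a]) = N xs * real (card (\<sigma> xs))" for xs a
    by (simp add: N_def)
  have hit_snoc: "hit i (xs @ [a]) \<longleftrightarrow> hit i xs \<and> U i \<inter> cball a (\<beta> ^ length xs * \<rho>0) \<noteq> {}" for i xs a
    by (auto simp: hit_def nth_append less_Suc_eq)
  have N_nonneg: "0 \<le> N xs" for xs by (simp add: N_def prod_nonneg)
  have g_avg: "(\<Sum>a\<in>\<sigma> xs. g i (xs @ [a])) \<le> of_nat (card (\<sigma> xs)) * g i xs"
    if xs: "legal_history \<sigma> xs" "length xs \<le> k i" for xs i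
  proof (cases "\<exists>a\<in>\<sigma> xs. hit i (xs @ [a])")
    case False
    then have "(\<Sum>a\<in>\<sigma> xs. g i (xs @ [a])) = 0" by (auto simp: g_def)
    then show ?thesis by simp
  next
    case True
    then obtain a where a: "a \<in> \<sigma> xs" "hit i (xs @ [a])" by blast
    have fin: "finite (\<sigma> xs)" by (rule legal_move_finite_nonempty[OF legal \<beta>(1) \<rho>0 xs(1)])
    have "\<not> hit i (xs @ [b])" if b: "b \<in> \<sigma> xs" "b \<noteq> a" for b
    proof
      assume "hit i (xs @ [b])"
      then obtain u v where uv: "u \<in> U i" "dist a u \<le> \<beta> ^ length xs * \<rho>0"
        "v \<in> U i" "dist b v \<le> \<beta> ^ length xs * \<rho>0"
        using a(2) by (auto simp: hit_snoc)
      have "dist u v < \<beta> ^ k i * \<rho>0" using uv by (intro small)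
      also have "\<dots> \<le> \<beta> ^ length xs * \<rho>0"
        using \<beta> \<rho>0 xs(2) by (intro mult_right_mono power_decreasing) auto
      \<comment> \<open>Two radii and the diameter of \<open>U i\<close> add up to less than three
        radii; this is the use of the factor 3 in the rules.\<close>
      finally have "dist a b < 3 * (\<beta> ^ length xs * \<rho>0)"
        using uv dist_triangle[of a b u] dist_triangle[of u b v] by (simp add: dist_commute)
      moreover have "separated_set (3 * (\<beta> ^ length xs * \<rho>0)) (\<sigma> xs)"
        using legal xs(1) by (simp add: legal_strategy_def legal_alice_move_def)
      ultimately show False using a b by (force simp: separated_set_def)
    qed
    then have "(\<Sum>a\<in>\<sigma> xs. g i (xs @ [a])) = (\<Sum>b\<in>{a}. g i (xs @ [b]))"
      using fin a by (intro sum.mono_neutral_right) (auto simp: g_def)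
    also have "\<dots> = of_nat (card (\<sigma> xs)) * g i xs"
      using a N_nonneg by (simp add: g_def hit_snoc N_snoc ennreal_mult' ac_simps flip: ennreal_of_nat_eq_real_of_nat)
    finally show ?thesis by simp
  qed
  have \<Psi>0: "\<Psi> [] < top"
  proof -
    have "\<Psi> [] = (\<Sum>i. ennreal (if U i = {} then 0 else (\<beta> ^ k i) powr t))"
      unfolding \<Psi>_def by (intro suminf_cong) (simp add: g_def hit_def N_def)
    also have "\<dots> < top" using summable by (subst suminf_ennreal2) auto
    finally show ?thesis .
  qed
  \<comment> \<open>The sum over all moves is at most \<open>card (\<sigma> xs)\<close> times the
    present charge, so not every move can increase it. Finiteness of the charge is kept as an
    invariant.\<close>
  have choice: "\<exists>a\<in>\<sigma> xs. \<Psi> (xs @ [a]) \<le> \<Psi> xs" if xs: "legal_history \<sigma> xs" "\<Psi> xs < top" for xs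
  proof (rule ccontr)
    assume "\<not> ?thesis"
    then have less: "\<And>a. a \<in> \<sigma> xs \<Longrightarrow> \<Psi> xs < \<Psi> (xs @ [a])" by force
    have fin: "finite (\<sigma> xs)" "\<sigma> xs \<noteq> {}" by (rule legal_move_finite_nonempty[OF legal \<beta>(1) \<rho>0 xs(1)])+
    have "(\<Sum>a\<in>\<sigma> xs. \<Psi> (xs @ [a])) = (\<Sum>i. \<Sum>a\<in>\<sigma> xs. g i (take (Suc (k i)) (xs @ [a])))"
      unfolding \<Psi>_def by (rule suminf_sum[symmetric]) simp
    also have "\<dots> \<le> (\<Sum>i. of_nat (card (\<sigma> xs)) * g i (take (Suc (k i)) xs))"
    proof (rule suminf_le)
      fix i
      show "(\<Sum>a\<in>\<sigma> xs. g i (take (Suc (k i)) (xs @ [a]))) \<le> of_nat (card (\<sigma> xs)) * g i (take (Suc (k i)) xs)"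
        using g_avg[OF xs(1), of i] by (cases "length xs \<le> k i") auto
    qed auto
    also have "\<dots> = of_nat (card (\<sigma> xs)) * \<Psi> xs" by (simp add: \<Psi>_def ennreal_suminf_cmult)
    finally have *: "(\<Sum>a\<in>\<sigma> xs. \<Psi> (xs @ [a])) \<le> of_nat (card (\<sigma> xs)) * \<Psi> xs" .
    let ?M = "Min ((\<lambda>a. \<Psi> (xs @ [a])) ` \<sigma> xs)"
    have "of_nat (card (\<sigma> xs)) * ?M \<le> (\<Sum>a\<in>\<sigma> xs. \<Psi> (xs @ [a]))"
      using fin by (intro sum_bounded_below) simp
    then have "of_nat (card (\<sigma> xs)) * ?M \<le> of_nat (card (\<sigma> xs)) * \<Psi> xs" using * by (rule order_trans)
    then have "?M \<le> \<Psi> xs"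
      using fin by (subst (asm) ennreal_mult_le_mult_iff) auto
    moreover have "\<Psi> xs < ?M" using fin less by simp
    ultimately show False by simp
  qed
  define pick where "pick xs = (SOME a. a \<in> \<sigma> xs \<and> \<Psi> (xs @ [a]) \<le> \<Psi> xs)" for xs
  define hist where "hist = rec_nat [] (\<lambda>_ xs. xs @ [pick xs])"
  define x where "x n = pick (hist n)" for n
  have hist_Suc: "hist (Suc n) = hist n @ [x n]" and hist_0: "hist 0 = []" for n
    by (simp_all add: hist_def x_def)
  have hist: "hist n = map x [0..<n]" for n
    by (induction n) (auto simp: hist_0 hist_Suc)
  have inv: "legal_history \<sigma> (hist n) \<and> \<Psi> (hist n) \<le> \<Psi> []" for n
  proof (induction n)
    case (Suc n)
    then have "\<exists>a. a \<in> \<sigma> (hist n) \<and> \<Psi> (hist n @ [a]) \<le> \<Psi> (hist n)"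
      using choice[of "hist n"] \<Psi>0 by (metis le_less_trans)
    then have "x n \<in> \<sigma> (hist n) \<and> \<Psi> (hist n @ [x n]) \<le> \<Psi> (hist n)"
      unfolding x_def pick_def by (rule someI_ex)
    then show ?case using Suc by (simp add: hist_Suc legal_history_snoc) (meson order_trans)
  qed (simp add: hist_0)
  have play: "bob_play \<sigma> x"
    unfolding bob_play_def alice_moves_def
  proof
    fix n
    have "legal_history \<sigma> (hist n @ [x n])" using inv[of "Suc n"] by (simp add: hist_Suc)
    then show "x n \<in> \<sigma> (map x [0..<n])" by (simp add: legal_history_snoc hist)
  qed
  have "finite {i. y \<in> U i \<and> 1 \<le> (\<Prod>j\<le>k i. real (card (alice_moves \<sigma> x j))) * (\<beta> ^ k i) powr t}" (is "finite ?I")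
    if y: "x \<longlonglongrightarrow> y" for y
  proof (rule ccontr)
    assume inf: "infinite ?I"
    obtain m :: nat where m: "\<Psi> [] < of_nat m"
      using \<Psi>0 by (metis ennreal_Ex_less_of_nat infinity_ennreal_def less_top)
    \<comment> \<open>Each index of \<open>F\<close> has final charge at least 1, and there are more
      of them than the initial charge allows.\<close>
    obtain F where F: "F \<subseteq> ?I" "finite F" "card F = m"
      using inf infinite_arbitrarily_large by blast
    define n where "n = Suc (Max (insert 0 (k ` F)))"
    have "of_nat m = (\<Sum>i\<in>F. 1 :: ennreal)" using F by simp
    also have "\<dots> \<le> (\<Sum>i\<in>F. g i (take (Suc (k i)) (hist n)))"
    proof (rule sum_mono)
      fix i assume i: "i \<in> F"
      then have "k i < n" using F(2) by (auto simp: n_def less_Suc_eq_le)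
      then have tk: "take (Suc (k i)) (hist n) = hist (Suc (k i))"
        by (simp add: hist take_map del: upt_Suc)
      have "hit i (hist (Suc (k i)))"
        unfolding hit_def using limit_in_bob_balls[OF legal \<beta> \<rho>0 play y] i F
        by (auto simp: hist simp del: upt_Suc)
      moreover have "N (hist (Suc (k i))) = (\<Prod>j\<le>k i. real (card (alice_moves \<sigma> x j)))"
        unfolding N_def hist alice_moves_def
        by (intro prod.cong) (auto simp: take_map min_def simp del: upt_Suc)
      ultimately show "1 \<le> g i (take (Suc (k i)) (hist n))"
        using i F(1) by (auto simp: tk g_def simp flip: ennreal_1 intro!: ennreal_leI)
    qed
    also have "\<dots> \<le> \<Psi> (hist n)"
      unfolding \<Psi>_def using F by (intro sum_le_suminf) auto
    also have "\<dots> \<le> \<Psi> []" using inv by simp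
    finally show False using m by simp
  qed
  then show ?thesis using that play by blast
qed

section \<open>Scores, and covers of Hausdorff null sets\<close>

lemma average_score_less:
  assumes "0 < \<beta>" "\<beta> < 1" "0 < k" "\<And>j. j \<le> k \<Longrightarrow> 0 < card (A j)"
    and "(\<Prod>j\<le>k. real (card (A j))) * (\<beta> ^ k) powr t < 1"
  shows "average_score \<beta> A k < t"
proof -
  let ?P = "\<Prod>j\<le>k. real (card (A j))"
  have P: "0 < ?P" using assms(4) by (intro prod_pos) auto
  have "ln (?P * (\<beta> ^ k) powr t) < 0"
    using assms P by (subst ln_less_zero_iff) auto
  then have "ln ?P < t * (real k * - ln \<beta>)"
    using P assms by (simp add: ln_mult ln_powr ln_realpow)
  moreover have "real k * - ln \<beta> > 0" using assms by (intro mult_pos_pos) auto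
  ultimately have "ln ?P / (real k * - ln \<beta>) < t" by (simp only: pos_divide_less_eq)
  moreover have "ln ?P = (\<Sum>j\<le>k. ln (real (card (A j))))"
    using assms(4) by (intro ln_prod) auto
  ultimately show ?thesis
    unfolding average_score_def
    by (simp add: atLeast0AtMost sum_divide_distrib[symmetric] mult.commute del: divide_minus_right)
qed

text \<open>The level \<open>k\<close> is the last one whose radius is at least \<open>r\<close>, so
  the radius exceeds \<open>r\<close> by at most the factor \<open>1 / \<beta>\<close>. The summand
  \<open>\<eta>\<close> makes \<open>r\<close> strictly larger than \<open>d\<close> and gives a
  level even to sets of diameter 0; the bound by \<open>\<rho>0 powr s\<close> ensures that level 0
  is not too late.\<close>

lemma exists_game_level:
  fixes \<beta> \<rho>0 d s \<eta> :: real
  assumes "0 < \<beta>" "\<beta> < 1" "0 < \<rho>0" "0 < s" "0 \<le> d" "0 < \<eta>" "d powr s + \<eta> \<le> \<rho>0 powr s"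
  obtains k where "d < \<beta> ^ k * \<rho>0" "(\<beta> ^ k) powr s \<le> (d powr s + \<eta>) / (\<beta> * \<rho>0) powr s"
proof -
  define r where "r = (d powr s + \<eta>) powr (1 / s)"
  have pos: "0 < d powr s + \<eta>" using assms by (simp add: add_nonneg_pos)
  have r: "r powr s = d powr s + \<eta>" "0 < r" using pos assms by (simp_all add: r_def powr_powr)
  have dr: "d < r"
    using powr_mono2[of s r d] r assms by (cases "d < r") auto
  have r_le: "r \<le> \<rho>0"
    using powr_less_mono2[of s \<rho>0 r] r assms by (cases "r \<le> \<rho>0") auto
  obtain n where "\<beta> ^ n < r / \<rho>0"
    using real_arch_pow_inv[of "r / \<rho>0" \<beta>] assms r by auto
  then have ex: "\<exists>n. \<beta> ^ n * \<rho>0 < r" using assms by (auto simp: field_simps)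
  define n0 where "n0 = (LEAST n. \<beta> ^ n * \<rho>0 < r)"
  have n0: "\<beta> ^ n0 * \<rho>0 < r" using LeastI_ex[OF ex] by (simp add: n0_def)
  have "n0 \<noteq> 0" using n0 r_le by (cases n0) auto
  then obtain k where k: "n0 = Suc k" using not0_implies_Suc by blast
  have k1: "r \<le> \<beta> ^ k * \<rho>0"
    using not_less_Least[of k "\<lambda>n. \<beta> ^ n * \<rho>0 < r"] k by (simp add: n0_def)
  show ?thesis
  proof
    show "d < \<beta> ^ k * \<rho>0" using dr k1 by simp
    have "\<beta> ^ k * (\<beta> * \<rho>0) \<le> r" using n0 k by (simp add: mult_ac)
    then have "(\<beta> ^ k * (\<beta> * \<rho>0)) powr s \<le> r powr s" using assms by (intro powr_mono2) auto
    then have "(\<beta> ^ k) powr s * (\<beta> * \<rho>0) powr s \<le> d powr s + \<eta>" using r by (simp add: powr_mult)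
    then show "(\<beta> ^ k) powr s \<le> (d powr s + \<eta>) / (\<beta> * \<rho>0) powr s"
      using assms by (simp add: pos_le_divide_eq)
  qed
qed

text \<open>For each \<open>n\<close> there is a cover of total weight below
  \<open>a / 2 ^ n\<close>. All of them together have finite weight and catch each point once per
  \<open>n\<close>.\<close>

lemma hausdorff_null_limsup_cover:
  fixes S :: "'a::metric_space set"
  assumes "0 < \<beta>" "\<beta> < 1" "0 < \<rho>0" "0 < s" and null: "hausdorff_measure s S = 0"
  obtains U :: "nat \<Rightarrow> 'a set" and k where
    "\<And>i x y. x \<in> U i \<Longrightarrow> y \<in> U i \<Longrightarrow> dist x y < \<beta> ^ k i * \<rho>0"
    "summable (\<lambda>i. (\<beta> ^ k i) powr s)" "\<And>y. y \<in> S \<Longrightarrow> infinite {i. y \<in> U i}"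
proof -
  \<comment> \<open>Half of \<open>\<rho>0 powr s\<close> is reserved for the diameter and half for
    \<open>\<eta>\<close>, as \<open>exists_game_level\<close> requires.\<close>
  define a where "a = \<rho>0 powr s / 2"
  have a: "0 < a" using assms by (simp add: a_def)
  let ?Q = "\<lambda>n (U :: nat \<Rightarrow> 'a set). S \<subseteq> (\<Union>i. U i) \<and> (\<forall>i. bounded (U i)) \<and>
    (\<Sum>i. ennreal (diameter (U i) powr s)) < ennreal (a * (1 / 2) ^ n)"
  have "\<exists>U. ?Q n U" for n
  proof -
    have "hausdorff_premeasure s 1 S \<le> hausdorff_measure s S"
      unfolding hausdorff_measure_def by (intro SUP_upper) simp
    then have "hausdorff_premeasure s 1 S < ennreal (a * (1 / 2) ^ n)"
      using null a by simp
    then show ?thesis unfolding hausdorff_premeasure_def INF_less_iff by blast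
  qed
  then have "\<exists>V. \<forall>n. ?Q n (V n)" by (intro choice allI)
  then obtain V where V: "\<And>n. S \<subseteq> (\<Union>i. V n i)" "\<And>n i. bounded (V n i)"
    "\<And>n. (\<Sum>i. ennreal (diameter (V n i) powr s)) < ennreal (a * (1 / 2) ^ n)"
    by blast
  define \<eta> where "\<eta> n i = a * (1 / 2) ^ n * (1 / 2) ^ Suc i" for n i :: nat
  have "\<exists>k. diameter (V n i) < \<beta> ^ k * \<rho>0 \<and>
      (\<beta> ^ k) powr s \<le> (diameter (V n i) powr s + \<eta> n i) / (\<beta> * \<rho>0) powr s" for n i
  proof -
    have "ennreal (diameter (V n i) powr s) \<le> (\<Sum>i. ennreal (diameter (V n i) powr s))"
    proof -
      have "(\<Sum>j\<in>{i}. ennreal (diameter (V n j) powr s)) \<le> (\<Sum>j. ennreal (diameter (V n j) powr s))"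
        by (rule sum_le_suminf) auto
      then show ?thesis by simp
    qed
    also have "\<dots> < ennreal (a * (1 / 2) ^ n)" by (rule V)
    finally have "diameter (V n i) powr s < a * (1 / 2) ^ n" using a by (simp add: ennreal_less_iff)
    moreover have "a * (1 / 2) ^ n \<le> a" using a by (simp add: power_le_one)
    moreover have "\<eta> n i \<le> a"
      unfolding \<eta>_def using a by (simp add: mult_le_one power_le_one mult.assoc divide_le_eq_1 flip: power_Suc)
    moreover have "a + a = \<rho>0 powr s" by (simp add: a_def)
    ultimately have "diameter (V n i) powr s + \<eta> n i \<le> \<rho>0 powr s" by linarith
    moreover have "0 \<le> diameter (V n i)" using V by (simp add: diameter_ge_0)
    moreover have "0 < \<eta> n i" using a by (simp add: \<eta>_def)
    ultimately show ?thesis using exists_game_level[of \<beta> \<rho>0 s "diameter (V n i)" "\<eta> n i"] assms by metis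
  qed
  then obtain k where k: "\<And>n i. diameter (V n i) < \<beta> ^ k n i * \<rho>0"
    "\<And>n i. (\<beta> ^ k n i) powr s \<le> (diameter (V n i) powr s + \<eta> n i) / (\<beta> * \<rho>0) powr s"
    by metis
  let ?U = "\<lambda>i. case prod_decode i of (n, i) \<Rightarrow> V n i"
  let ?k = "\<lambda>i. case prod_decode i of (n, i) \<Rightarrow> k n i"
  let ?f = "\<lambda>(n, i). ennreal ((\<beta> ^ k n i) powr s)"
  have \<eta>_sums: "(\<lambda>i. \<eta> n i) sums (a * (1 / 2) ^ n)" for n
    unfolding \<eta>_def using sums_mult[OF power_half_series, of "a * (1 / 2) ^ n"] by simp
  show ?thesis
  proof
    show "dist x y < \<beta> ^ ?k i * \<rho>0" if "x \<in> ?U i" "y \<in> ?U i" for i x y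
    proof -
      obtain n j where i: "prod_decode i = (n, j)" by force
      have "dist x y \<le> diameter (V n j)" using that V i by (intro diameter_bounded_bound) auto
      then show ?thesis using k(1)[of n j] i by simp
    qed
    have inner: "(\<Sum>i. ?f (n, i)) \<le> ennreal (2 * a / (\<beta> * \<rho>0) powr s * (1 / 2) ^ n)" for n
    proof -
      have "(\<Sum>i. ?f (n, i)) \<le> (\<Sum>i. ennreal (1 / (\<beta> * \<rho>0) powr s) * (ennreal (diameter (V n i) powr s) + ennreal (\<eta> n i)))"
      proof (rule suminf_le)
        fix i
        have "0 \<le> \<eta> n i" using a by (simp add: \<eta>_def)
        then show "?f (n, i) \<le> ennreal (1 / (\<beta> * \<rho>0) powr s) * (ennreal (diameter (V n i) powr s) + ennreal (\<eta> n i))"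
          using k(2)[of n i] by (auto intro!: ennreal_leI simp flip: ennreal_plus ennreal_mult)
      qed auto
      also have "\<dots> = ennreal (1 / (\<beta> * \<rho>0) powr s) *
          ((\<Sum>i. ennreal (diameter (V n i) powr s)) + (\<Sum>i. ennreal (\<eta> n i)))"
        by (simp add: ennreal_suminf_cmult suminf_add)
      also have "(\<Sum>i. ennreal (\<eta> n i)) = ennreal (a * (1 / 2) ^ n)"
        using \<eta>_sums[of n] a by (intro suminf_ennreal_eq) (auto simp: \<eta>_def)
      also have "ennreal (1 / (\<beta> * \<rho>0) powr s) * ((\<Sum>i. ennreal (diameter (V n i) powr s)) + ennreal (a * (1 / 2) ^ n))
         \<le> ennreal (1 / (\<beta> * \<rho>0) powr s) * (ennreal (a * (1 / 2) ^ n) + ennreal (a * (1 / 2) ^ n))"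
        using V(3)[of n] by (intro mult_left_mono add_right_mono) auto
      also have "\<dots> = ennreal (2 * a / (\<beta> * \<rho>0) powr s * (1 / 2) ^ n)"
        using a by (simp flip: ennreal_plus ennreal_mult)
      finally show ?thesis .
    qed
    have "(\<Sum>i. ennreal ((\<beta> ^ ?k i) powr s)) = (\<Sum>i. ?f (prod_decode i))"
      by (intro suminf_cong) (simp add: split_beta)
    also have "\<dots> = (\<Sum>n. \<Sum>i. ?f (n, i))" by (rule suminf_ennreal_2dimen) simp
    also have "\<dots> \<le> (\<Sum>n. ennreal (2 * a / (\<beta> * \<rho>0) powr s * (1 / 2) ^ n))"
      by (intro suminf_le inner) auto
    also have "\<dots> = ennreal (\<Sum>n. 2 * a / (\<beta> * \<rho>0) powr s * (1 / 2) ^ n)"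
      using a by (intro suminf_ennreal2) (auto intro!: summable_mult summable_geometric)
    finally have "(\<Sum>i. ennreal ((\<beta> ^ ?k i) powr s)) \<noteq> top" by (auto simp: top_unique)
    then show "summable (\<lambda>i. (\<beta> ^ ?k i) powr s)" by (intro summable_suminf_not_top) auto
    show "infinite {i. y \<in> ?U i}" if "y \<in> S" for y
    proof -
      have "\<exists>j. y \<in> V n j" for n using V(1)[of n] that by auto
      then obtain j where j: "\<And>n. y \<in> V n (j n)" by metis
      \<comment> \<open>Occurrences are counted by index: equal sets from covers with different
        \<open>n\<close> count separately.\<close>
      have "inj (\<lambda>n. prod_encode (n, j n))" by (auto intro!: injI)
      then have "infinite (range (\<lambda>n. prod_encode (n, j n)))" by (simp add: finite_image_iff)
      moreover have "range (\<lambda>n. prod_encode (n, j n)) \<subseteq> {i. y \<in> ?U i}" using j by auto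
      ultimately show ?thesis by (rule infinite_super[rotated])
    qed
  qed
qed

lemma hausdorff_beta_winning_imp_measure_nonzero:
  fixes S :: "'a::heine_borel set"
  assumes win: "hausdorff_beta_winning \<beta> \<delta> S" and "0 < \<beta>" "\<beta> < 1" "0 < s" "s < \<delta>"
  shows "hausdorff_measure s S \<noteq> 0"
proof
  assume null: "hausdorff_measure s S = 0"
  obtain \<rho>0 \<sigma> where \<sigma>: "0 < \<rho>0" "legal_strategy \<beta> \<rho>0 \<sigma>"
    "\<And>x. bob_play \<sigma> x \<Longrightarrow> (\<exists>y\<in>S. x \<longlonglongrightarrow> y) \<and> ereal \<delta> \<le> lower_score \<beta> (alice_moves \<sigma> x)"
    using win unfolding hausdorff_beta_winning_def by blast
  obtain U :: "nat \<Rightarrow> 'a set" and k where U: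
    "\<And>i x y. x \<in> U i \<Longrightarrow> y \<in> U i \<Longrightarrow> dist x y < \<beta> ^ k i * \<rho>0"
    "summable (\<lambda>i. (\<beta> ^ k i) powr s)" "\<And>y. y \<in> S \<Longrightarrow> infinite {i. y \<in> U i}"
    using hausdorff_null_limsup_cover[OF assms(2,3) \<sigma>(1) assms(4) null] by blast
  have "summable (\<lambda>i. if U i = {} then 0 else (\<beta> ^ k i) powr s)"
    by (rule summable_comparison_test'[OF U(2), of 0]) auto
  then obtain x where x: "bob_play \<sigma> x" "\<And>y. x \<longlonglongrightarrow> y \<Longrightarrow>
      finite {i. y \<in> U i \<and> 1 \<le> (\<Prod>j\<le>k i. real (card (alice_moves \<sigma> x j))) * (\<beta> ^ k i) powr s}"
    using bob_avoids_small_sets[where U = U and k = k and t = s, OF assms(2,3) \<sigma>(1,2) U(1)] by blast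
  obtain y where y: "y \<in> S" "x \<longlonglongrightarrow> y" using \<sigma>(3)[OF x(1)] by blast
  have "ereal s < liminf (\<lambda>n. ereal (average_score \<beta> (alice_moves \<sigma> x) n))"
    using \<sigma>(3)[OF x(1)] \<open>s < \<delta>\<close> unfolding lower_score_def
    by (metis ereal_less_eq(3) less_le_trans not_le)
  from less_LiminfD[OF this] obtain K where K: "\<And>n. n \<ge> K \<Longrightarrow> s < average_score \<beta> (alice_moves \<sigma> x) n"
    by (auto simp: eventually_sequentially)
  \<comment> \<open>The weights tend to 0, hence the levels tend to infinity. So some set containing
    the outcome has a level beyond \<open>K\<close> and a product that is too small.\<close>
  have "finite {i. k i \<le> K}"
  proof -
    have "\<forall>\<^sub>F i in sequentially. (\<beta> ^ k i) powr s < (\<beta> ^ K) powr s"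
      using summable_LIMSEQ_zero[OF U(2)] assms by (intro order_tendstoD(2)) auto
    then obtain m where m: "\<And>i. i \<ge> m \<Longrightarrow> (\<beta> ^ k i) powr s < (\<beta> ^ K) powr s"
      by (auto simp: eventually_sequentially)
    have "{i. k i \<le> K} \<subseteq> {..<m}"
    proof
      fix i assume "i \<in> {i. k i \<le> K}"
      then have "(\<beta> ^ K) powr s \<le> (\<beta> ^ k i) powr s"
        using assms by (intro powr_mono2 power_decreasing) auto
      then have "\<not> m \<le> i" using m[of i] by (meson not_le)
      then show "i \<in> {..<m}" by simp
    qed
    then show ?thesis by (rule finite_subset) simp
  qed
  then have "infinite ({i. y \<in> U i} - ({i. k i \<le> K} \<union>
     {i. y \<in> U i \<and> 1 \<le> (\<Prod>j\<le>k i. real (card (alice_moves \<sigma> x j))) * (\<beta> ^ k i) powr s}))"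
    (is "infinite ?I")
    using U(3)[OF y(1)] x(2)[OF y(2)] by (intro Diff_infinite_finite finite_UnI)
  then obtain i where "i \<in> ?I" using infinite_imp_nonempty by blast
  then have i: "K < k i" "(\<Prod>j\<le>k i. real (card (alice_moves \<sigma> x j))) * (\<beta> ^ k i) powr s < 1"
    by (simp_all add: not_le)
  have "0 < card (alice_moves \<sigma> x j)" for j
    using legal_move_finite_nonempty[OF \<sigma>(2) assms(2) \<sigma>(1) bob_play_imp_legal_history[OF x(1)]]
    by (simp add: alice_moves_def card_gt_0_iff)
  then have "average_score \<beta> (alice_moves \<sigma> x) (k i) < s"
    using i assms by (intro average_score_less) auto
  then show False using K[of "k i"] i by simp
qed

section \<open>Covers of packing null sets\<close>

text \<open>Closed \<open>r\<close>-balls around points more than \<open>2 * r\<close> apart form a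
  packing, which bounds their number. A set of such points of largest size is maximal, so that the
  balls of radius \<open>2 * r\<close> cover.\<close>

lemma packing_premeasure_scale_cover:
  fixes T :: "'a::metric_space set"
  assumes "packing_premeasure_scale s \<epsilon> T \<le> ennreal M" "0 < r" "r \<le> \<epsilon>" "0 \<le> M"
  obtains F where "finite F" "T \<subseteq> (\<Union>x\<in>F. cball x (2 * r))" "real (card F) * (2 * r) powr s \<le> M"
proof -
  define P where "P F \<longleftrightarrow> finite F \<and> F \<subseteq> T \<and> (\<forall>x\<in>F. \<forall>y\<in>F. x \<noteq> y \<longrightarrow> 2 * r < dist x y)" for F
  have bound: "real (card F) * (2 * r) powr s \<le> M" if "P F" for F
  proof -
    have "cball x r \<inter> cball y r = {}" if "x \<in> F" "y \<in> F" "x \<noteq> y" for x y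
    proof (rule ccontr)
      assume "cball x r \<inter> cball y r \<noteq> {}"
      then obtain z where "dist x z \<le> r" "dist y z \<le> r" by auto
      then have "dist x y \<le> 2 * r" using dist_triangle[of x y z] by (simp add: dist_commute)
      then show False using \<open>P F\<close> that unfolding P_def by force
    qed
    then have "(\<lambda>x. (x, r)) ` F \<in> packings \<epsilon> T"
      unfolding packings_def disjoint_family_on_def using that assms by (auto simp: countable_finite P_def)
    then have "(\<Sum>\<^sub>\<infinity>(x, r)\<in>(\<lambda>x. (x, r)) ` F. ennreal ((2 * r) powr s)) \<le> packing_premeasure_scale s \<epsilon> T"
      unfolding packing_premeasure_scale_def by (rule SUP_upper)
    also have "\<dots> \<le> ennreal M" by (rule assms)
    also have "(\<Sum>\<^sub>\<infinity>(x, r)\<in>(\<lambda>x. (x, r)) ` F. ennreal ((2 * r) powr s)) = ennreal (real (card F) * (2 * r) powr s)"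
      using that by (simp add: P_def sum.reindex inj_on_def ennreal_mult' flip: ennreal_of_nat_eq_real_of_nat)
    finally show ?thesis using assms(4) by simp
  qed
  have "card F \<le> nat \<lceil>M / (2 * r) powr s\<rceil>" if "P F" for F
  proof -
    have "real (card F) \<le> M / (2 * r) powr s"
      using bound[OF that] assms by (simp add: pos_le_divide_eq)
    then show ?thesis by linarith
  qed
  then have bdd: "\<forall>F. P F \<longrightarrow> card F < Suc (nat \<lceil>M / (2 * r) powr s\<rceil>)"
    by (simp add: less_Suc_eq_le)
  have "\<exists>F. P F \<and> (\<forall>F'. P F' \<longrightarrow> card F' \<le> card F)"
    by (rule ex_has_greatest_nat[OF _ bdd, of "{}"]) (simp add: P_def)
  then obtain F where F: "P F" "\<And>F'. P F' \<Longrightarrow> card F' \<le> card F" by blast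
  have "T \<subseteq> (\<Union>x\<in>F. cball x (2 * r))"
  proof
    fix y assume y: "y \<in> T"
    show "y \<in> (\<Union>x\<in>F. cball x (2 * r))"
    proof (rule ccontr)
      assume "\<not> ?thesis"
      then have far: "\<And>x. x \<in> F \<Longrightarrow> 2 * r < dist x y" by (simp add: not_le)
      then have "y \<notin> F" using assms by force
      moreover have "P (insert y F)" using F(1) y far by (auto simp: P_def dist_commute)
      ultimately show False using F(2)[of "insert y F"] F(1) by (simp add: P_def)
    qed
  qed
  then show ?thesis using that[of F] F(1) bound[of F] by (simp add: P_def)
qed

text \<open>\<open>S\<close> splits into pieces of finite premeasure, and each is covered at every
  small scale by a number of balls bounded with exponent \<open>s\<close>. The gap up to
  \<open>t\<close> leaves room to sum over all levels and pieces. A point is thus caught at every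
  late level, not just at infinitely many, as is needed against a limsup.\<close>

lemma packing_null_eventual_cover:
  fixes S :: "'a::metric_space set"
  assumes \<beta>: "0 < \<beta>" "\<beta> < 1" and \<rho>0: "0 < \<rho>0" and st: "0 < s" "s < t"
    and null: "packing_measure s S = 0"
  obtains U :: "nat \<Rightarrow> 'a set" and k where
    "\<And>i x y. x \<in> U i \<Longrightarrow> y \<in> U i \<Longrightarrow> dist x y < \<beta> ^ k i * \<rho>0"
    "summable (\<lambda>i. if U i = {} then 0 else (\<beta> ^ k i) powr t)"
    "\<And>y. y \<in> S \<Longrightarrow> \<exists>K. \<forall>n\<ge>K. \<exists>i. y \<in> U i \<and> k i = n"
proof -
  have "packing_measure s S < 1" using null by simp
  then obtain T :: "nat \<Rightarrow> 'a set" where T: "S \<subseteq> (\<Union>n. T n)" "(\<Sum>n. packing_premeasure s (T n)) < 1"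
    unfolding packing_measure_def INF_less_iff by blast
  have "\<exists>\<epsilon>>0. packing_premeasure_scale s \<epsilon> (T n) \<le> ennreal 1" for n
  proof -
    have "(\<Sum>m\<in>{n}. packing_premeasure s (T m)) \<le> (\<Sum>m. packing_premeasure s (T m))"
      by (rule sum_le_suminf) auto
    then have "packing_premeasure s (T n) < 1" using T(2) by simp
    then obtain \<epsilon> where "\<epsilon> \<in> {0<..}" "packing_premeasure_scale s \<epsilon> (T n) < 1"
      unfolding packing_premeasure_def INF_less_iff by blast
    then show ?thesis by (intro exI[of _ \<epsilon>]) (auto intro: less_imp_le)
  qed
  then obtain \<epsilon> where \<epsilon>: "\<And>n. 0 < \<epsilon> n" "\<And>n. packing_premeasure_scale s (\<epsilon> n) (T n) \<le> ennreal 1" by metis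
  \<comment> \<open>Half of the gap, used twice: one factor \<open>\<gamma> ^ k\<close> is summed
    over the levels, the other pays for the piece \<open>n\<close> by a late start
    \<open>K n\<close>.\<close>
  define \<gamma> where "\<gamma> = \<beta> powr ((t - s) / 2)"
  have \<gamma>: "0 < \<gamma>" "\<gamma> < 1"
    using \<beta> st powr_less_mono2[of "(t - s) / 2" \<beta> 1] by (auto simp: \<gamma>_def)
  have \<gamma>2: "(\<beta> ^ k) powr t = (\<beta> ^ k) powr s * (\<gamma> ^ k * \<gamma> ^ k)" for k
  proof -
    have "\<gamma> ^ k = (\<beta> ^ k) powr ((t - s) / 2)"
      using \<beta> by (simp add: \<gamma>_def powr_realpow[symmetric] powr_powr mult.commute)
    then show ?thesis by (simp add: powr_add[symmetric] field_simps)
  qed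
  \<comment> \<open>The covering balls have radius \<open>2 * r k\<close>, hence diameter at most
    \<open>4 * r k\<close>, strictly below the game radius.\<close>
  define r where "r k = \<beta> ^ k * \<rho>0 / 5" for k
  have r: "0 < r k" for k using \<beta> \<rho>0 by (simp add: r_def)
  \<comment> \<open>Converts \<open>2 * r k\<close> back into \<open>\<beta> ^ k\<close>.\<close>
  define M where "M = (5 / (2 * \<rho>0)) powr s"
  have M: "0 < M" using \<rho>0 by (simp add: M_def)
  have "\<exists>K. \<beta> ^ K * \<rho>0 / 5 \<le> \<epsilon> n \<and> M * \<gamma> ^ K \<le> (1 / 2) ^ n" for n
  proof -
    obtain K1 where "\<beta> ^ K1 < 5 * \<epsilon> n / \<rho>0"
      using real_arch_pow_inv[of "5 * \<epsilon> n / \<rho>0" \<beta>] \<beta> \<rho>0 \<epsilon>(1) by auto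
    then have "\<beta> ^ K1 * \<rho>0 / 5 \<le> \<epsilon> n" using \<rho>0 by (simp add: field_simps)
    moreover obtain K2 where "\<gamma> ^ K2 < (1 / 2) ^ n / M"
      using real_arch_pow_inv[of "(1 / 2) ^ n / M" \<gamma>] \<gamma> M by auto
    then have "M * \<gamma> ^ K2 \<le> (1 / 2) ^ n" using M by (simp add: field_simps)
    moreover have "\<beta> ^ max K1 K2 * \<rho>0 / 5 \<le> \<beta> ^ K1 * \<rho>0 / 5"
      using \<beta> \<rho>0 by (intro divide_right_mono mult_right_mono power_decreasing) auto
    moreover have "M * \<gamma> ^ max K1 K2 \<le> M * \<gamma> ^ K2"
      using \<gamma> M by (intro mult_left_mono power_decreasing) auto
    ultimately show ?thesis by (meson order_trans)
  qed
  then obtain K where K: "\<And>n. \<beta> ^ K n * \<rho>0 / 5 \<le> \<epsilon> n" "\<And>n. M * \<gamma> ^ K n \<le> (1 / 2) ^ n" by metis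
  have "\<exists>L. T n \<subseteq> (\<Union>x\<in>set L. cball x (2 * r k)) \<and> real (length L) * (2 * r k) powr s \<le> 1"
    if "K n \<le> k" for n k
  proof -
    have "r k \<le> \<beta> ^ K n * \<rho>0 / 5"
      unfolding r_def using \<beta> \<rho>0 that by (intro divide_right_mono mult_right_mono power_decreasing) auto
    then have "r k \<le> \<epsilon> n" using K(1) order_trans by blast
    then obtain F where F: "finite F" "T n \<subseteq> (\<Union>x\<in>F. cball x (2 * r k))" "real (card F) * (2 * r k) powr s \<le> 1"
      using packing_premeasure_scale_cover[OF \<epsilon>(2) r] by (metis zero_le_one)
    then obtain L where "set L = F" "distinct L" using finite_distinct_list by blast
    then show ?thesis using F distinct_card[of L] by (intro exI[of _ L]) auto
  qed
  then obtain L where L: "\<And>n k. K n \<le> k \<Longrightarrow> T n \<subseteq> (\<Union>x\<in>set (L n k). cball x (2 * r k))"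
    "\<And>n k. K n \<le> k \<Longrightarrow> real (length (L n k)) * (2 * r k) powr s \<le> 1" by metis
  define V where "V n k l = (if K n \<le> k \<and> l < length (L n k) then cball (L n k ! l) (2 * r k) else {})" for n k l
  define w where "w n k l = (if V n k l = {} then 0 else (\<beta> ^ k) powr t)" for n k l
  have sum_l: "(\<Sum>l. ennreal (w n k l)) \<le> ennreal ((1 / 2) ^ n * \<gamma> ^ k)" for n k
  proof (cases "K n \<le> k")
    case False
    then show ?thesis by (simp add: w_def V_def)
  next
    case True
    have "(\<Sum>l. ennreal (w n k l)) = (\<Sum>l<length (L n k). ennreal (w n k l))"
      by (rule suminf_finite) (auto simp: w_def V_def)
    also have "\<dots> \<le> (\<Sum>l<length (L n k). ennreal ((\<beta> ^ k) powr t))"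
      by (intro sum_mono ennreal_leI) (simp add: w_def)
    also have "\<dots> = ennreal (real (length (L n k)) * (\<beta> ^ k) powr t)"
      by (simp add: ennreal_mult' flip: ennreal_of_nat_eq_real_of_nat)
    also have "\<dots> \<le> ennreal ((1 / 2) ^ n * \<gamma> ^ k)"
    proof (rule ennreal_leI)
      have "(\<beta> ^ k) powr s = (2 * r k) powr s * M"
        using \<beta> \<rho>0 by (simp add: M_def r_def flip: powr_mult)
      then have "real (length (L n k)) * (\<beta> ^ k) powr t
          = (real (length (L n k)) * (2 * r k) powr s) * (M * \<gamma> ^ k * \<gamma> ^ k)"
        unfolding \<gamma>2 by simp
      also have "\<dots> \<le> 1 * (M * \<gamma> ^ K n * \<gamma> ^ k)"
        using L(2)[OF True] M \<gamma> True by (intro mult_mono mult_right_mono mult_left_mono power_decreasing) auto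
      also have "\<dots> \<le> (1 / 2) ^ n * \<gamma> ^ k"
        using K(2)[of n] \<gamma> by (simp add: mult_right_mono)
      finally show "real (length (L n k)) * (\<beta> ^ k) powr t \<le> (1 / 2) ^ n * \<gamma> ^ k" .
    qed
    finally show ?thesis .
  qed
  define U where "U i = (case prod_decode i of (p, l) \<Rightarrow> case prod_decode p of (n, k) \<Rightarrow> V n k l)" for i
  define lv where "lv i = snd (prod_decode (fst (prod_decode i)))" for i
  have V: "dist x y < \<beta> ^ k * \<rho>0" if "x \<in> V n k l" "y \<in> V n k l" for x y n k l
  proof -
    obtain c where "dist c x \<le> 2 * r k" "dist c y \<le> 2 * r k"
      using \<open>x \<in> V n k l\<close> \<open>y \<in> V n k l\<close> by (auto simp: V_def split: if_splits)
    then have "dist x y \<le> 4 * r k" using dist_triangle[of x y c] by (simp add: dist_commute)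
    also have "\<dots> < \<beta> ^ k * \<rho>0" using r[of k] unfolding r_def by linarith
    finally show ?thesis .
  qed
  show ?thesis
  proof
    show "dist x y < \<beta> ^ lv i * \<rho>0" if "x \<in> U i" "y \<in> U i" for i x y
      using that V by (auto simp: U_def lv_def split: prod.splits)
    have "(\<Sum>i. ennreal (if U i = {} then 0 else (\<beta> ^ lv i) powr t))
        = (\<Sum>i. (\<lambda>(p, l). ennreal (case prod_decode p of (n, k) \<Rightarrow> w n k l)) (prod_decode i))"
      by (intro suminf_cong) (simp add: U_def lv_def w_def split_beta)
    also have "\<dots> = (\<Sum>p. \<Sum>l. ennreal (case prod_decode p of (n, k) \<Rightarrow> w n k l))"
      by (rule suminf_ennreal_2dimen) simp
    also have "\<dots> = (\<Sum>p. (\<lambda>(n, k). \<Sum>l. ennreal (w n k l)) (prod_decode p))"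
      by (intro suminf_cong) (simp add: split_beta)
    also have "\<dots> = (\<Sum>n. \<Sum>k. \<Sum>l. ennreal (w n k l))"
      by (rule suminf_ennreal_2dimen) simp
    also have "\<dots> \<le> (\<Sum>n. \<Sum>k. ennreal ((1 / 2) ^ n * \<gamma> ^ k))"
      by (intro suminf_le sum_l) auto
    also have "\<dots> = (\<Sum>n. ennreal ((1 / 2) ^ n * (1 / (1 - \<gamma>))))"
    proof (intro suminf_cong suminf_ennreal_eq)
      show "(\<lambda>k. (1 / 2) ^ n * \<gamma> ^ k) sums ((1 / 2) ^ n * (1 / (1 - \<gamma>)))" for n
        using \<gamma> by (intro sums_mult geometric_sums) auto
    qed (use \<gamma> in auto)
    also have "\<dots> = ennreal (\<Sum>n. (1 / 2) ^ n * (1 / (1 - \<gamma>)))"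
      using \<gamma> by (intro suminf_ennreal2) (auto intro!: summable_mult2 summable_geometric)
    finally have "(\<Sum>i. ennreal (if U i = {} then 0 else (\<beta> ^ lv i) powr t)) \<noteq> top"
      by (auto simp: top_unique)
    then show "summable (\<lambda>i. if U i = {} then 0 else (\<beta> ^ lv i) powr t)"
      by (intro summable_suminf_not_top) auto
    show "\<exists>K. \<forall>k\<ge>K. \<exists>i. y \<in> U i \<and> lv i = k" if "y \<in> S" for y
    proof -
      obtain n where n: "y \<in> T n" using T(1) \<open>y \<in> S\<close> by auto
      have "\<exists>i. y \<in> U i \<and> lv i = k" if k: "K n \<le> k" for k
      proof -
        obtain x where x: "x \<in> set (L n k)" "y \<in> cball x (2 * r k)" using L(1)[OF k] n by blast
        then obtain l where "l < length (L n k)" "x = L n k ! l" by (metis in_set_conv_nth)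
        then have "y \<in> V n k l" using k x by (simp add: V_def)
        then show ?thesis
          by (intro exI[of _ "prod_encode (prod_encode (n, k), l)"]) (simp add: U_def lv_def)
      qed
      then show ?thesis by blast
    qed
  qed
qed

text \<open>The outcome lies in some \<open>U i\<close> at each late level, and only finitely many
  of these allow a large product. Hence all late averages are below \<open>t\<close>, and so the
  limsup is at most \<open>t\<close>.\<close>

lemma packing_beta_winning_imp_measure_nonzero:
  fixes S :: "'a::heine_borel set"
  assumes win: "packing_beta_winning \<beta> \<delta> S" and "0 < \<beta>" "\<beta> < 1" "0 < s" "s < \<delta>"
  shows "packing_measure s S \<noteq> 0"
proof
  assume null: "packing_measure s S = 0"
  obtain t where t: "s < t" "t < \<delta>" using dense assms(5) by blast
  obtain \<rho>0 \<sigma> where \<sigma>: "0 < \<rho>0" "legal_strategy \<beta> \<rho>0 \<sigma>"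
    "\<And>x. bob_play \<sigma> x \<Longrightarrow> (\<exists>y\<in>S. x \<longlonglongrightarrow> y) \<and> ereal \<delta> \<le> upper_score \<beta> (alice_moves \<sigma> x)"
    using win unfolding packing_beta_winning_def by blast
  obtain U :: "nat \<Rightarrow> 'a set" and k where U:
    "\<And>i x y. x \<in> U i \<Longrightarrow> y \<in> U i \<Longrightarrow> dist x y < \<beta> ^ k i * \<rho>0"
    "summable (\<lambda>i. if U i = {} then 0 else (\<beta> ^ k i) powr t)"
    "\<And>y. y \<in> S \<Longrightarrow> \<exists>K. \<forall>n\<ge>K. \<exists>i. y \<in> U i \<and> k i = n"
    using packing_null_eventual_cover[OF assms(2,3) \<sigma>(1) assms(4) t(1) null] by blast
  obtain x where x: "bob_play \<sigma> x" "\<And>y. x \<longlonglongrightarrow> y \<Longrightarrow>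
      finite {i. y \<in> U i \<and> 1 \<le> (\<Prod>j\<le>k i. real (card (alice_moves \<sigma> x j))) * (\<beta> ^ k i) powr t}"
    using bob_avoids_small_sets[where U = U and k = k and t = t, OF assms(2,3) \<sigma>(1,2) U(1,2)] by blast
  obtain y where y: "y \<in> S" "x \<longlonglongrightarrow> y" using \<sigma>(3)[OF x(1)] by blast
  define I where "I = {i. y \<in> U i \<and> 1 \<le> (\<Prod>j\<le>k i. real (card (alice_moves \<sigma> x j))) * (\<beta> ^ k i) powr t}"
  obtain K where K: "\<And>n. n \<ge> K \<Longrightarrow> \<exists>i. y \<in> U i \<and> k i = n" using U(3)[OF y(1)] by blast
  have card: "0 < card (alice_moves \<sigma> x j)" for j
    using legal_move_finite_nonempty[OF \<sigma>(2) assms(2) \<sigma>(1) bob_play_imp_legal_history[OF x(1)]]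
    by (simp add: alice_moves_def card_gt_0_iff)
  have "finite (k ` I)" unfolding I_def using x(2)[OF y(2)] by (rule finite_imageI)
  then obtain m where m: "\<And>n. n \<in> k ` I \<Longrightarrow> n < m" unfolding finite_nat_set_iff_bounded by blast
  have "average_score \<beta> (alice_moves \<sigma> x) n < t" if n: "n \<ge> Suc (max K m)" for n
  proof -
    have le: "K \<le> n" "m \<le> n" using n by simp_all
    obtain i where i: "y \<in> U i" "k i = n" using K[OF le(1)] by blast
    then have "i \<notin> I" using m[of n] le(2) by auto
    then have "(\<Prod>j\<le>n. real (card (alice_moves \<sigma> x j))) * (\<beta> ^ n) powr t < 1" using i by (auto simp: I_def)
    then show ?thesis using card n assms by (intro average_score_less) auto
  qed
  then have "upper_score \<beta> (alice_moves \<sigma> x) \<le> ereal t"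
    unfolding upper_score_def
    by (intro Limsup_bounded eventually_sequentiallyI[of "Suc (max K m)"]) (simp add: less_imp_le)
  then have "ereal \<delta> \<le> ereal t" using \<sigma>(3)[OF x(1)] order_trans by blast
  then show False using t by simp
qed

section \<open>Playing the game as Alice\<close>

text \<open>Alice plays from a state instead of the whole history: \<open>step\<close> is local,
  \<open>R\<close> records what a transition guarantees, and \<open>pt\<close> ties the state to
  Bob's last point. As \<open>0 - 1 = 0\<close>, the first move is handled like the later ones, in a
  ball around \<open>pt s0\<close>.\<close>

lemma strategy_from_states:
  fixes \<rho>0 \<beta> :: real and pt :: "'s \<Rightarrow> 'a::metric_space"
  assumes init: "Inv 0 s0"
    and step: "\<And>k s. Inv k s \<Longrightarrow> \<exists>A. A \<noteq> {} \<and> finite A \<and> separated_set (3 * (\<beta> ^ k * \<rho>0)) A \<and>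
       A \<subseteq> cball (pt s) ((1 - \<beta>) * (\<beta> ^ (k - 1) * \<rho>0)) \<and>
       (\<forall>x\<in>A. \<exists>s'. Inv (Suc k) s' \<and> pt s' = x \<and> R k s A x s')"
  obtains \<sigma> where "legal_strategy \<beta> \<rho>0 \<sigma>"
    "\<And>x. bob_play \<sigma> x \<Longrightarrow> \<exists>S. S 0 = s0 \<and> (\<forall>k. Inv k (S k) \<and> R k (S k) (alice_moves \<sigma> x k) (x k) (S (Suc k)))"
proof -
  have "\<exists>A X. Inv k s \<longrightarrow> A \<noteq> {} \<and> finite A \<and> separated_set (3 * (\<beta> ^ k * \<rho>0)) A \<and>
       A \<subseteq> cball (pt s) ((1 - \<beta>) * (\<beta> ^ (k - 1) * \<rho>0)) \<and>
       (\<forall>x\<in>A. Inv (Suc k) (X x) \<and> pt (X x) = x \<and> R k s A x (X x))" for k s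
    using step[of k s] by metis
  then obtain A X where AX: "\<And>k s. Inv k s \<Longrightarrow> A k s \<noteq> {} \<and> finite (A k s) \<and>
       separated_set (3 * (\<beta> ^ k * \<rho>0)) (A k s) \<and>
       A k s \<subseteq> cball (pt s) ((1 - \<beta>) * (\<beta> ^ (k - 1) * \<rho>0)) \<and>
       (\<forall>x\<in>A k s. Inv (Suc k) (X k s x) \<and> pt (X k s x) = x \<and> R k s (A k s) x (X k s x))"
    by metis
  \<comment> \<open>The state is recomputed from the history; the counter is carried along because
    \<open>X\<close> depends on the turn.\<close>
  define st where "st xs = foldl (\<lambda>(k, s) x. (Suc k, X k s x)) (0, s0) xs" for xs
  define \<sigma> where "\<sigma> xs = A (length xs) (snd (st xs))" for xs
  have fst_st: "fst (st xs) = length xs" for xs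
    unfolding st_def by (induction xs rule: rev_induct) (auto simp: split_beta)
  have st_snoc: "snd (st (xs @ [x])) = X (length xs) (snd (st xs)) x" for xs x
    using fst_st[of xs] unfolding st_def by (simp add: split_beta)
  have st_Nil: "snd (st []) = s0" by (simp add: st_def)
  have inv: "Inv (length xs) (snd (st xs)) \<and> (xs \<noteq> [] \<longrightarrow> pt (snd (st xs)) = last xs)"
    if "legal_history \<sigma> xs" for xs
    using that
  proof (induction xs rule: rev_induct)
    case Nil
    then show ?case by (simp add: st_Nil init)
  next
    case (snoc x xs)
    then have "Inv (length xs) (snd (st xs))" "x \<in> A (length xs) (snd (st xs))"
      by (auto simp: legal_history_snoc \<sigma>_def)
    then show ?case using AX by (simp add: st_snoc)
  qed
  show ?thesis
  proof
    show "legal_strategy \<beta> \<rho>0 \<sigma>"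
      unfolding legal_strategy_def legal_alice_move_def
    proof (intro allI impI)
      fix xs assume "legal_history \<sigma> xs"
      note i = inv[OF this]
      show "\<sigma> xs \<noteq> {} \<and> separated_set (3 * (\<beta> ^ length xs * \<rho>0)) (\<sigma> xs) \<and>
         (if xs = [] then finite (\<sigma> xs) else \<sigma> xs \<subseteq> cball (last xs) ((1 - \<beta>) * (\<beta> ^ (length xs - 1) * \<rho>0)))"
        using AX[of "length xs" "snd (st xs)"] i unfolding \<sigma>_def by auto
    qed
    show "\<exists>S. S 0 = s0 \<and> (\<forall>k. Inv k (S k) \<and> R k (S k) (alice_moves \<sigma> x k) (x k) (S (Suc k)))"
      if "bob_play \<sigma> x" for x
    proof (intro exI[of _ "\<lambda>k. snd (st (map x [0..<k]))"] conjI allI)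
      show "snd (st (map x [0..<0])) = s0" by (simp add: st_Nil)
      fix k
      have L: "legal_history \<sigma> (map x [0..<k])" by (rule bob_play_imp_legal_history[OF that])
      show I: "Inv k (snd (st (map x [0..<k])))" using inv[OF L] by simp
      have "x k \<in> A k (snd (st (map x [0..<k])))"
        using that unfolding bob_play_def alice_moves_def \<sigma>_def by (metis diff_zero length_map length_upt)
      then show "R k (snd (st (map x [0..<k]))) (alice_moves \<sigma> x k) (x k) (snd (st (map x [0..<Suc k])))"
        using AX[OF I] by (simp add: st_snoc alice_moves_def \<sigma>_def)
    qed
  qed
qed

section \<open>A single turn of Alice\<close>

text \<open>For \<open>\<beta>\<close> between 0 and 1 this is the least level whose side is at most
  \<open>\<beta> ^ k\<close>. Arbitrary ratios are thus matched with dyadic cells up to a factor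
  2.\<close>

definition dyadic_level :: "real \<Rightarrow> nat \<Rightarrow> nat" where
  "dyadic_level \<beta> k = nat \<lceil>real k * log 2 (1 / \<beta>)\<rceil>"

lemma dyadic_level_0 [simp]: "dyadic_level \<beta> 0 = 0"
  by (simp add: dyadic_level_def)

lemma
  assumes "0 < \<beta>" "\<beta> < 1"
  shows dyadic_level_mono: "k \<le> k' \<Longrightarrow> dyadic_level \<beta> k \<le> dyadic_level \<beta> k'"
    and inverse_two_power_dyadic_level_le: "1 / 2 ^ dyadic_level \<beta> k \<le> \<beta> ^ k"
    and two_power_dyadic_level_less: "2 ^ dyadic_level \<beta> k * \<beta> ^ k < 2"
proof -
  let ?l = "log 2 (1 / \<beta>)"
  have l: "0 \<le> ?l" using assms by simp
  show "dyadic_level \<beta> k \<le> dyadic_level \<beta> k'" if "k \<le> k'"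
    unfolding dyadic_level_def using that l by (intro nat_mono ceiling_mono mult_right_mono) auto
  have eq: "2 powr (real k * ?l) = (1 / \<beta>) ^ k"
    using assms by (simp add: mult.commute[of "real k"] powr_powr[symmetric] powr_realpow)
  have lev: "real (dyadic_level \<beta> k) = of_int \<lceil>real k * ?l\<rceil>"
    unfolding dyadic_level_def using l by simp
  have "2 powr (real k * ?l) \<le> 2 powr real (dyadic_level \<beta> k)"
    unfolding lev by (intro powr_mono) auto
  then show "1 / 2 ^ dyadic_level \<beta> k \<le> \<beta> ^ k"
    using assms eq by (simp add: powr_realpow field_simps)
  have "2 powr real (dyadic_level \<beta> k) < 2 powr (real k * ?l + 1)"
    unfolding lev by (intro powr_less_mono) (linarith, simp)
  also have "\<dots> = 2 * (1 / \<beta>) ^ k" using eq by (simp add: powr_add)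
  finally show "2 ^ dyadic_level \<beta> k * \<beta> ^ k < 2"
    using assms by (simp add: powr_realpow field_simps)
qed

text \<open>The first factor counts the residue classes modulo \<open>12 * d\<close>; the second
  bounds the harmonic number of at most \<open>(2 / \<beta>) ^ d\<close> subcells.\<close>

definition step_loss :: "nat \<Rightarrow> real \<Rightarrow> real" where
  "step_loss d \<beta> = real (12 * d) ^ d * (1 + real d * ln (2 / \<beta>))"

lemma step_loss_ge_1:
  assumes "0 < d" "0 < \<beta>" "\<beta> < 1"
  shows "1 \<le> step_loss d \<beta>"
proof -
  have "1 \<le> real (12 * d) ^ d" using assms by (intro one_le_power) simp
  moreover have "1 \<le> 1 + real d * ln (2 / \<beta>)" using assms by simp
  ultimately show ?thesis unfolding step_loss_def using mult_mono[of 1 _ 1] by fastforce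
qed

text \<open>Alice offers the corners of the cells in a heavy residue class; a corner lies in its own
  half-open cell, so Bob's point determines the cell. Only nonnegativity and a positive total of
  \<open>a\<close> are assumed, which serves both games. For \<open>k = 0\<close> the only subcell
  is the cell of \<open>p\<close> itself.\<close>

lemma alice_step:
  fixes p :: "real ^ 'n::finite" and a :: "('n \<Rightarrow> int) \<Rightarrow> real"
  assumes \<beta>: "0 < \<beta>" "\<beta> \<le> 1 / 2" and \<rho>0: "\<rho>0 = 2 * real CARD('n)"
    and a: "\<And>z. 0 \<le> a z"
    and I: "I = {dyadic_index (dyadic_level \<beta> k) y |y.
      dyadic_index (dyadic_level \<beta> (k - 1)) y = dyadic_index (dyadic_level \<beta> (k - 1)) p}"
    and pos: "0 < sum a I"
  obtains A where "A \<noteq> {}" "finite A" "separated_set (3 * (\<beta> ^ k * \<rho>0)) A"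
    "A \<subseteq> cball p ((1 - \<beta>) * (\<beta> ^ (k - 1) * \<rho>0))"
    "\<And>x. x \<in> A \<Longrightarrow> sum a I \<le> step_loss CARD('n) \<beta> * real (card A) * a (dyadic_index (dyadic_level \<beta> k) x)"
proof -
  let ?D = "CARD('n)" and ?l = "dyadic_level \<beta> k" and ?l' = "dyadic_level \<beta> (k - 1)"
  have \<beta>1: "\<beta> < 1" using \<beta> by simp
  have le: "?l' \<le> ?l" by (rule dyadic_level_mono[OF \<beta>(1) \<beta>1]) simp
  have fin: "finite I" unfolding I by (rule finite_dyadic_subcells[OF le])
  have "I \<noteq> {}" using pos by auto
  then have cpos: "0 < card I" using fin by (simp add: card_gt_0_iff)
  have "real (card I) \<le> (2 ^ (?l - ?l')) ^ ?D"
    using card_dyadic_subcells_le[OF le, of p] unfolding I[symmetric]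
    by (metis of_nat_le_iff of_nat_numeral of_nat_power)
  also have "\<dots> \<le> (2 / \<beta>) ^ ?D"
  proof (intro power_mono)
    have "(2::real) ^ (?l - ?l') = 2 ^ ?l * (1 / 2 ^ ?l')" using le by (simp add: power_diff)
    also have "\<dots> \<le> 2 ^ ?l * \<beta> ^ (k - 1)"
      by (intro mult_left_mono inverse_two_power_dyadic_level_le[OF \<beta>(1) \<beta>1]) auto
    also have "\<dots> \<le> 2 / \<beta>"
    proof (cases k)
      case 0
      then show ?thesis using \<beta> by simp
    next
      case (Suc m)
      then show ?thesis using two_power_dyadic_level_less[OF \<beta>(1) \<beta>1, of k] \<beta>(1)
        by (simp add: pos_le_divide_eq mult_ac)
    qed
    finally show "(2::real) ^ (?l - ?l') \<le> 2 / \<beta>" .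
  qed simp
  finally have "ln (real (card I)) \<le> ln ((2 / \<beta>) ^ ?D)" using cpos \<beta> by simp
  then have harm: "harm (card I) \<le> 1 + real ?D * ln (2 / \<beta>)"
    using harm_le_1_plus_ln[OF cpos] \<beta> by (simp add: ln_realpow)
  obtain J where J: "J \<subseteq> I" "J \<noteq> {}"
      "\<And>z z' i. z \<in> J \<Longrightarrow> z' \<in> J \<Longrightarrow> z i mod (12 * int ?D) = z' i mod (12 * int ?D)"
    "\<And>z. z \<in> J \<Longrightarrow> sum a I \<le> real (nat (12 * int ?D)) ^ CARD('n) * harm (card I) * (real (card J) * a z)"
    using exists_heavy_residue_class[OF fin pos a, of "12 * int ?D"] by auto
  define A :: "(real ^ 'n) set" where "A = dyadic_corner ?l ` J"
  have inj: "inj_on (dyadic_corner ?l :: _ \<Rightarrow> real ^ 'n) J"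
    by (rule inj_on_inverseI[where g = "dyadic_index ?l"]) simp
  have cardA: "card A = card J" unfolding A_def by (rule card_image[OF inj])
  show ?thesis
  proof
    show "A \<noteq> {}" using J(2) by (simp add: A_def)
    show "finite A" unfolding A_def by (intro finite_imageI finite_subset[OF J(1) fin])
    show "separated_set (3 * (\<beta> ^ k * \<rho>0)) A"
      unfolding separated_set_def A_def
    proof (clarify)
      fix z z' assume z: "z \<in> J" "z' \<in> J" "(dyadic_corner ?l z :: real ^ 'n) \<noteq> dyadic_corner ?l z'"
      \<comment> \<open>The left side is \<open>6 * D * \<beta> ^ k\<close>, \<open>D\<close> the
        dimension, and \<open>2 ^ ?l * \<beta> ^ k < 2\<close>; hence the modulus
        \<open>12 * D\<close>.\<close>
      have "3 * (\<beta> ^ k * \<rho>0) \<le> real_of_int (12 * int ?D) / 2 ^ ?l"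
        using two_power_dyadic_level_less[OF \<beta>(1) \<beta>1, of k] \<rho>0 by (simp add: field_simps)
      also have "\<dots> \<le> dist (dyadic_corner ?l z :: real ^ 'n) (dyadic_corner ?l z')"
        using z(3) by (intro dist_dyadic_corner_ge J(3)[OF z(1,2)]) auto
      finally show "3 * (\<beta> ^ k * \<rho>0) \<le> dist (dyadic_corner ?l z :: real ^ 'n) (dyadic_corner ?l z')" .
    qed
    show "A \<subseteq> cball p ((1 - \<beta>) * (\<beta> ^ (k - 1) * \<rho>0))"
      unfolding A_def
    proof (rule image_subsetI)
      fix z assume "z \<in> J"
      then obtain y where y: "z = dyadic_index ?l y" "dyadic_index ?l' y = dyadic_index ?l' p"
        using J(1) I by auto
      have "dyadic_index ?l' (dyadic_corner ?l z :: real ^ 'n) = dyadic_index ?l' y"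
        by (rule dyadic_index_coarser[OF le]) (simp add: y)
      then have "dist p (dyadic_corner ?l z) \<le> real ?D * (1 / 2 ^ ?l')"
        using dist_dyadic_cell_le[of ?l' p "dyadic_corner ?l z"] y by simp
      also have "\<dots> \<le> real ?D * \<beta> ^ (k - 1)"
        by (intro mult_left_mono inverse_two_power_dyadic_level_le[OF \<beta>(1) \<beta>1]) simp
      \<comment> \<open>With \<open>\<rho>0 = 2 * D\<close> and \<open>\<beta> \<le> 1 / 2\<close>,
        Alice's ball around \<open>p\<close> contains the whole cell.\<close>
      also have "\<dots> \<le> (1 - \<beta>) * (\<beta> ^ (k - 1) * \<rho>0)"
      proof -
        have "1 * (real ?D * \<beta> ^ (k - 1)) \<le> (2 * (1 - \<beta>)) * (real ?D * \<beta> ^ (k - 1))"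
          using \<beta> by (intro mult_right_mono) auto
        then show ?thesis unfolding \<rho>0 by (simp only: mult_1 mult_ac)
      qed
      finally show "dyadic_corner ?l z \<in> cball p ((1 - \<beta>) * (\<beta> ^ (k - 1) * \<rho>0))" by simp
    qed
    fix x assume "x \<in> A"
    then obtain z where z: "z \<in> J" "x = dyadic_corner ?l z" by (auto simp: A_def)
    have "sum a I \<le> real (12 * ?D) ^ ?D * harm (card I) * (real (card A) * a z)"
      using J(4)[OF z(1)] by (simp add: cardA nat_mult_distrib)
    also have "\<dots> \<le> real (12 * ?D) ^ ?D * (1 + real ?D * ln (2 / \<beta>)) * (real (card A) * a z)"
      using harm a by (intro mult_right_mono mult_left_mono) auto
    finally show "sum a I \<le> step_loss ?D \<beta> * real (card A) * a (dyadic_index ?l x)"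
      by (simp add: step_loss_def z mult.assoc)
  qed
qed

section \<open>Alice and Hausdorff dimension\<close>

text \<open>Logarithms of the product bound, divided by \<open>k\<close>. The loss occurs
  \<open>Suc k\<close> times, which leaves one \<open>ln c\<close> in the error term of order
  \<open>1 / k\<close>.\<close>

lemma average_score_ge:
  assumes "0 < \<beta>" "\<beta> < 1" "0 < k" "\<And>j. j \<le> k \<Longrightarrow> 0 < card (A j)" "0 < m" "0 < c"
    and "m * (1 / \<beta> ^ k) powr s \<le> c ^ Suc k * (\<Prod>j\<le>k. real (card (A j)))"
  shows "s - ln c / - ln \<beta> + (ln m - ln c) / - ln \<beta> / real k \<le> average_score \<beta> A k"
proof -
  let ?P = "\<Prod>j\<le>k. real (card (A j))" and ?b = "- ln \<beta>"
  have P: "0 < ?P" using assms(4) by (intro prod_pos) auto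
  have b: "0 < ?b" using assms by simp
  have kb: "0 < real k * ?b" by (intro mult_pos_pos b) (use assms(3) in simp)
  have "ln (m * (1 / \<beta> ^ k) powr s) \<le> ln (c ^ Suc k * ?P)"
    using assms(7) assms P by (subst ln_le_cancel_iff) auto
  then have "ln m + s * (real k * ?b) \<le> real (Suc k) * ln c + ln ?P"
    using assms P by (simp add: ln_mult ln_powr ln_div ln_realpow del: of_nat_Suc power_Suc)
  then have "s * (real k * ?b) - ln c * real k + (ln m - ln c) \<le> ln ?P"
    by (simp add: algebra_simps)
  then have "(s * (real k * ?b) - ln c * real k + (ln m - ln c)) / (real k * ?b) \<le> ln ?P / (real k * ?b)"
    using less_imp_le[OF kb] by (rule divide_right_mono)
  also have "(s * (real k * ?b) - ln c * real k + (ln m - ln c)) / (real k * ?b)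
      = s - ln c / ?b + (ln m - ln c) / ?b / real k"
    using b assms(3) by (simp only: add_divide_distrib diff_divide_distrib) (simp add: field_simps)
  also have "ln ?P / (real k * ?b) = average_score \<beta> A k"
  proof -
    have "ln ?P = (\<Sum>j\<le>k. ln (real (card (A j))))" using assms(4) by (intro ln_prod) auto
    then show ?thesis
      unfolding average_score_def
      by (simp add: atLeast0AtMost sum_divide_distrib[symmetric] mult.commute del: divide_minus_right)
  qed
  finally show ?thesis .
qed

lemma average_score_bound_tendsto:
  "(\<lambda>k. L + C / real k) \<longlonglongrightarrow> L"
  using tendsto_add[OF tendsto_const[of L] lim_const_over_n[of C]] by simp

text \<open>Points chosen from the \<open>G (Suc k)\<close> share shrinking cells with
  \<open>x k\<close>, so their first components tend to \<open>y\<close>. This alone puts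
  \<open>y\<close> in the closure of the projection; the coordinate bounds supply a second component
  for it.\<close>

lemma outcome_in_projection:
  fixes x :: "nat \<Rightarrow> real ^ 'n::finite" and G :: "nat \<Rightarrow> ((real ^ 'n) \<times> (nat \<Rightarrow> nat)) set"
  assumes C: "seq_closed C" "G 0 \<subseteq> C" "\<And>k. G (Suc k) \<subseteq> G k" "\<And>k. G k \<noteq> {}"
    and \<beta>: "0 < \<beta>" "\<beta> < 1"
    and cell: "\<And>k g. g \<in> G (Suc k) \<Longrightarrow>
      dyadic_index (dyadic_level \<beta> k) (fst g) = dyadic_index (dyadic_level \<beta> k) (x k)"
    and bound: "\<And>i. \<exists>u K. \<forall>g\<in>G K. snd g i \<le> u"
    and x: "x \<longlonglongrightarrow> y"
  shows "y \<in> fst ` C"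
proof -
  have "\<exists>g. g \<in> G (Suc k)" for k using C(4) by blast
  then obtain g where g: "\<And>k. g k \<in> G (Suc k)" by metis
  have anti: "G k' \<subseteq> G k" if "k \<le> k'" for k k'
    using lift_Suc_antimono_le[of G, OF C(3) that] .
  show ?thesis
  proof (rule seq_closed_limit[OF C(1)])
    show "(fst (g k), snd (g k)) \<in> C" for k using g[of k] anti[of 0 "Suc k"] C(2) by auto
    have le: "dist (fst (g k)) (x k) \<le> real CARD('n) * \<beta> ^ k" for k
    proof -
      have "dist (fst (g k)) (x k) \<le> real CARD('n) * (1 / 2 ^ dyadic_level \<beta> k)"
        using dist_dyadic_cell_le[OF cell[OF g]] by simp
      also have "\<dots> \<le> real CARD('n) * \<beta> ^ k"
        by (intro mult_left_mono inverse_two_power_dyadic_level_le[OF \<beta>]) simp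
      finally show ?thesis .
    qed
    have "(\<lambda>k. real CARD('n) * \<beta> ^ k) \<longlonglongrightarrow> 0"
      using \<beta> by (intro tendsto_mult_right_zero LIMSEQ_power_zero) simp
    then have "(\<lambda>k. fst (g k) - x k) \<longlonglongrightarrow> 0"
      by (rule Lim_null_comparison[rotated]) (use le in \<open>simp add: dist_norm\<close>)
    then show "(\<lambda>k. fst (g k)) \<longlonglongrightarrow> y" using tendsto_add[OF _ x] by fastforce
    show "\<exists>u K. \<forall>k\<ge>K. snd (g k) i \<le> u" for i
    proof -
      obtain u K where uK: "\<forall>g\<in>G K. snd g i \<le> u" using bound by blast
      have "snd (g k) i \<le> u" if "k \<ge> K" for k
        using uK g[of k] anti[of K "Suc k"] that by auto
      then show ?thesis by blast
    qed
  qed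
qed

text \<open>By telescoping, the initial \<open>\<Phi>\<close> is at most \<open>c ^ Suc k\<close>
  times the product of the cardinalities times \<open>\<Phi> (G (Suc k))\<close>, and the last
  factor is at most \<open>(\<beta> ^ k) powr s\<close>, since this piece lies in one cell.\<close>

lemma hausdorff_beta_winning_if_measure_nonzero:
  fixes S :: "(real ^ 'n::finite) set"
  assumes S: "suslin S" and s: "0 < s" "hausdorff_measure s S \<noteq> 0"
    and \<beta>: "0 < \<beta>" "\<beta> \<le> 1 / 2"
    and \<delta>: "\<delta> \<le> s - ln (2 * step_loss CARD('n) \<beta>) / - ln \<beta>"
  shows "hausdorff_beta_winning \<beta> \<delta> S"
proof -
  let ?D = "CARD('n)" and ?l = "dyadic_level \<beta>"
  let ?cell = "\<lambda>j z. dyadic_cell (j, z) \<times> (UNIV :: (nat \<Rightarrow> nat) set)"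
  define \<rho>0 where "\<rho>0 = 2 * real ?D"
  \<comment> \<open>The factor 2 pays for bounding one more coordinate on each turn.\<close>
  define c where "c = 2 * step_loss ?D \<beta>"
  have \<beta>1: "\<beta> < 1" using \<beta> by simp
  have \<rho>0: "0 < \<rho>0" by (simp add: \<rho>0_def)
  have c: "0 < c" using step_loss_ge_1[of ?D \<beta>] \<beta> by (simp add: c_def)
  obtain C where C: "seq_closed C" "S = fst ` C" using S by (auto simp: suslin_def)
  \<comment> \<open>Real values suffice because every piece lies in a cell and so has finite
    content.\<close>
  define \<Phi> :: "((real ^ 'n) \<times> (nat \<Rightarrow> nat)) set \<Rightarrow> real"
    where "\<Phi> G = enn2real (dyadic_content s (fst ` G))" for G
  define in_cell where "in_cell k p G \<longleftrightarrow> (\<forall>g\<in>G. dyadic_index (?l k) (fst g) = dyadic_index (?l k) p)"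
    for k and p :: "real ^ 'n" and G :: "((real ^ 'n) \<times> (nat \<Rightarrow> nat)) set"
  have content_le: "dyadic_content s (fst ` G) \<le> ennreal ((1 / 2 ^ ?l k) powr s)" if "in_cell k p G" for k p G
    using dyadic_content_cell_le[of "fst ` G" "(?l k, dyadic_index (?l k) p)" s] that
    by (auto simp: in_cell_def dyadic_cell_def)
  have content_eq: "dyadic_content s (fst ` G) = ennreal (\<Phi> G)" if "in_cell k p G" for k p G
    using content_le[OF that] unfolding \<Phi>_def
    by (metis ennreal_enn2real ennreal_less_top le_less_trans)
  have \<Phi>_nonneg: "0 \<le> \<Phi> G" for G by (simp add: \<Phi>_def)
  have \<Phi>_le: "\<Phi> G \<le> (\<beta> ^ k) powr s" if "in_cell k p G" for k p G
  proof -
    have "\<Phi> G \<le> (1 / 2 ^ ?l k) powr s"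
      using content_le[OF that] unfolding content_eq[OF that] by simp
    also have "\<dots> \<le> (\<beta> ^ k) powr s"
      using inverse_two_power_dyadic_level_le[OF \<beta>(1) \<beta>1, of k] s by (intro powr_mono2) auto
    finally show ?thesis .
  qed
  \<comment> \<open>The unit cells are countably many, so they cannot all meet \<open>S\<close> in a
    null set; Alice starts in one of the others.\<close>
  have "\<exists>z :: 'n \<Rightarrow> int. dyadic_content s (S \<inter> dyadic_cell (0, z)) \<noteq> 0"
  proof (rule ccontr)
    assume "\<not> ?thesis"
    then have "dyadic_content s (\<Union>n. S \<inter> dyadic_cell (0, from_nat n :: 'n \<Rightarrow> int)) = 0"
      by (intro dyadic_content_UN_null) auto
    moreover have "S \<subseteq> (\<Union>n. S \<inter> dyadic_cell (0, from_nat n :: 'n \<Rightarrow> int))"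
    proof
      fix x assume "x \<in> S"
      then have "x \<in> S \<inter> dyadic_cell (0, from_nat (to_nat (dyadic_index 0 x)))" by (simp add: dyadic_cell_def)
      then show "x \<in> (\<Union>n. S \<inter> dyadic_cell (0, from_nat n :: 'n \<Rightarrow> int))" by blast
    qed
    ultimately have "dyadic_content s S = 0"
      using dyadic_content_mono by (metis le_zero_eq)
    then show False using s hausdorff_measure_eq_0_if_dyadic_content_eq_0 by blast
  qed
  then obtain z0 :: "'n \<Rightarrow> int" where z0: "dyadic_content s (S \<inter> dyadic_cell (0, z0)) \<noteq> 0" by blast
  define G0 where "G0 = C \<inter> ?cell 0 z0"
  define p0 :: "real ^ 'n" where "p0 = dyadic_corner 0 z0"
  have G0_cell: "in_cell 0 p0 G0" by (auto simp: in_cell_def G0_def p0_def dyadic_cell_def)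
  have "fst ` G0 = S \<inter> dyadic_cell (0, z0)" by (force simp: G0_def C)
  then have G0_pos: "0 < \<Phi> G0"
    using z0 content_eq[OF G0_cell] \<Phi>_nonneg[of G0] by (cases "\<Phi> G0 = 0") auto
  define Inv where "Inv k s \<longleftrightarrow> (case s of (p, G) \<Rightarrow> in_cell (k - 1) p G \<and> 0 < \<Phi> G)" for k s
  define R where "R k s A (x :: real ^ 'n) s' \<longleftrightarrow> (case (s, s') of ((p, G), (p', G')) \<Rightarrow>
     p' = x \<and> G' \<subseteq> G \<and> \<Phi> G \<le> c * real (card A) * \<Phi> G' \<and> (\<exists>u. \<forall>g\<in>G'. snd g k \<le> u))"
    for k :: nat and s :: "(real ^ 'n) \<times> ((real ^ 'n) \<times> (nat \<Rightarrow> nat)) set" and A :: "(real ^ 'n) set" and x s'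
  have init: "Inv 0 (p0, G0)" using G0_cell G0_pos by (simp add: Inv_def)
  have step: "\<exists>A. A \<noteq> {} \<and> finite A \<and> separated_set (3 * (\<beta> ^ k * \<rho>0)) A \<and>
       A \<subseteq> cball (fst st) ((1 - \<beta>) * (\<beta> ^ (k - 1) * \<rho>0)) \<and>
       (\<forall>x\<in>A. \<exists>st'. Inv (Suc k) st' \<and> fst st' = x \<and> R k st A x st')" if "Inv k st" for k st
  proof -
    obtain p G where st: "st = (p, G)" by force
    have G: "in_cell (k - 1) p G" "0 < \<Phi> G" using that by (auto simp: Inv_def st)
    define H where "H u = {g\<in>G. snd g k \<le> u}" for u
    have H_sub: "H u \<subseteq> G" for u by (auto simp: H_def)
    have H_cell: "in_cell (k - 1) p (H u)" for u using G(1) H_sub by (auto simp: in_cell_def)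
    \<comment> \<open>The sets \<open>H u\<close> increase to \<open>G\<close>, so by continuity
      from below some bound \<open>u\<close> on coordinate \<open>k\<close> keeps half of the
      content.\<close>
    have "\<exists>u. \<Phi> G \<le> 2 * \<Phi> (H u)"
    proof (rule ccontr)
      assume "\<not> ?thesis"
      then have "2 * \<Phi> (H u) < \<Phi> G" for u by (simp add: not_le)
      then have less: "\<Phi> (H u) \<le> \<Phi> G / 2" for u by (simp add: less_imp_le mult.commute)
      have "fst ` G = (\<Union>u. fst ` H u)" by (force simp: H_def)
      then have "dyadic_content s (fst ` G) \<le> (SUP u. dyadic_content s (fst ` H u))"
        using dyadic_content_incseq_UN_le[of "\<lambda>u. fst ` H u" s] by (force simp: H_def intro!: monoI image_mono)
      also have "\<dots> \<le> ennreal (\<Phi> G / 2)"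
        using less by (intro SUP_least) (simp add: content_eq[OF H_cell] ennreal_leI)
      finally show False using G(2) by (simp add: content_eq[OF G(1)])
    qed
    then obtain u where u: "\<Phi> G \<le> 2 * \<Phi> (H u)" by blast
    define I where "I = {dyadic_index (?l k) y |y. dyadic_index (?l (k - 1)) y = dyadic_index (?l (k - 1)) p}"
    have lev: "?l (k - 1) \<le> ?l k" by (rule dyadic_level_mono[OF \<beta>(1) \<beta>1]) simp
    have finI: "finite I" unfolding I_def by (rule finite_dyadic_subcells[OF lev])
    define a where "a z = \<Phi> (H u \<inter> ?cell (?l k) z)" for z
    have cell_a: "in_cell (k - 1) p (H u \<inter> ?cell (?l k) z)" for z
      using H_cell by (auto simp: in_cell_def)
    have "fst ` H u \<subseteq> (\<Union>z\<in>I. fst ` (H u \<inter> ?cell (?l k) z))"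
    proof
      fix y assume "y \<in> fst ` H u"
      then obtain g where g: "g \<in> H u" "y = fst g" by blast
      then have "dyadic_index (?l k) y \<in> I" using H_cell[of u] by (auto simp: I_def in_cell_def)
      moreover have "y \<in> fst ` (H u \<inter> ?cell (?l k) (dyadic_index (?l k) y))"
        by (rule image_eqI[of y fst g]) (use g in \<open>auto simp: dyadic_cell_def mem_Times_iff\<close>)
      ultimately show "y \<in> (\<Union>z\<in>I. fst ` (H u \<inter> ?cell (?l k) z))" by blast
    qed
    then have "dyadic_content s (fst ` H u) \<le> (\<Sum>z\<in>I. dyadic_content s (fst ` (H u \<inter> ?cell (?l k) z)))"
      by (rule order_trans[OF dyadic_content_mono dyadic_content_UN_le[OF finI]])
    then have "ennreal (\<Phi> (H u)) \<le> ennreal (sum a I)"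
      by (simp add: content_eq[OF H_cell] content_eq[OF cell_a] a_def \<Phi>_nonneg)
    then have sum_a: "\<Phi> (H u) \<le> sum a I"
      by (subst (asm) ennreal_le_iff) (auto simp: a_def \<Phi>_nonneg intro!: sum_nonneg)
    then have pos: "0 < sum a I" using u G(2) by simp
    obtain A where A: "A \<noteq> {}" "finite A" "separated_set (3 * (\<beta> ^ k * \<rho>0)) A"
      "A \<subseteq> cball p ((1 - \<beta>) * (\<beta> ^ (k - 1) * \<rho>0))"
      "\<And>x. x \<in> A \<Longrightarrow> sum a I \<le> step_loss ?D \<beta> * real (card A) * a (dyadic_index (?l k) x)"
      using alice_step[OF \<beta> \<rho>0_def _ I_def pos] by (auto simp: a_def \<Phi>_nonneg)
    have "\<exists>st'. Inv (Suc k) st' \<and> fst st' = x \<and> R k st A x st'" if x: "x \<in> A" for x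
    proof (intro exI[of _ "(x, H u \<inter> ?cell (?l k) (dyadic_index (?l k) x))"] conjI)
      let ?G = "H u \<inter> ?cell (?l k) (dyadic_index (?l k) x)"
      have le: "\<Phi> G \<le> c * real (card A) * \<Phi> ?G"
        using u sum_a A(5)[OF x] by (simp add: a_def c_def)
      then have "0 < \<Phi> ?G" using G(2) \<Phi>_nonneg[of ?G] by (cases "\<Phi> ?G = 0") auto
      moreover have "in_cell k x ?G" by (auto simp: in_cell_def dyadic_cell_def)
      ultimately show "Inv (Suc k) (x, ?G)" by (simp add: Inv_def)
      show "R k st A x (x, ?G)" using le H_sub[of u] by (auto simp: R_def st H_def)
    qed simp
    then show ?thesis using A(1-4) by (intro exI[of _ A]) (simp add: st)
  qed
  obtain \<sigma> where legal: "legal_strategy \<beta> \<rho>0 \<sigma>" and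
    play: "\<And>x. bob_play \<sigma> x \<Longrightarrow> \<exists>S. S 0 = (p0, G0) \<and> (\<forall>k. Inv k (S k) \<and> R k (S k) (alice_moves \<sigma> x k) (x k) (S (Suc k)))"
    using strategy_from_states[where Inv = Inv and R = R and pt = fst, OF init step] by blast
  show ?thesis
    unfolding hausdorff_beta_winning_def
  proof (intro exI conjI allI impI)
    show "0 < \<rho>0" by (rule \<rho>0)
    show "legal_strategy \<beta> \<rho>0 \<sigma>" by (rule legal)
    fix x assume x: "bob_play \<sigma> x"
    obtain T where T: "T 0 = (p0, G0)" "\<And>k. Inv k (T k)" "\<And>k. R k (T k) (alice_moves \<sigma> x k) (x k) (T (Suc k))"
      using play[OF x] by blast
    define G where "G k = snd (T k)" for k
    have fst_T: "fst (T (Suc k)) = x k" for k using T(3)[of k] by (auto simp: R_def split: prod.splits)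
    have G_cell: "in_cell k (x k) (G (Suc k))" for k
      using T(2)[of "Suc k"] fst_T[of k] by (auto simp: Inv_def G_def split: prod.splits)
    have G_pos: "0 < \<Phi> (G k)" for k using T(2)[of k] by (auto simp: Inv_def G_def split: prod.splits)
    have G_Suc: "G (Suc k) \<subseteq> G k" "\<Phi> (G k) \<le> c * real (card (alice_moves \<sigma> x k)) * \<Phi> (G (Suc k))"
      "\<exists>u. \<forall>g\<in>G (Suc k). snd g k \<le> u" for k
      using T(3)[of k] by (auto simp: R_def G_def split: prod.splits)
    obtain y where y: "x \<longlonglongrightarrow> y"
      using bob_play_convergent[OF legal \<beta>(1) \<beta>1 \<rho>0 x] by (auto simp: convergent_def)
    have "y \<in> fst ` C"
    proof (rule outcome_in_projection[where G = G and x = x, OF C(1) _ G_Suc(1) _ \<beta>(1) \<beta>1 _ _ y])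
      show "G 0 \<subseteq> C" by (auto simp: G_def T(1) G0_def)
      show "G k \<noteq> {}" for k using G_pos[of k] by (auto simp: \<Phi>_def)
      show "dyadic_index (?l k) (fst g) = dyadic_index (?l k) (x k)" if "g \<in> G (Suc k)" for k g
        using G_cell[of k] that by (simp add: in_cell_def)
      show "\<exists>u K. \<forall>g\<in>G K. snd g i \<le> u" for i using G_Suc(3)[of i] by blast
    qed
    then show "\<exists>y\<in>S. x \<longlonglongrightarrow> y" using y C(2) by blast
    have prod: "\<Phi> G0 \<le> c ^ k * (\<Prod>j<k. real (card (alice_moves \<sigma> x j))) * \<Phi> (G k)" for k
    proof (induction k)
      case 0
      then show ?case by (simp add: G_def T(1))
    next
      case (Suc k)
      have "c ^ k * (\<Prod>j<k. real (card (alice_moves \<sigma> x j))) * \<Phi> (G k)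
        \<le> c ^ k * (\<Prod>j<k. real (card (alice_moves \<sigma> x j))) * (c * real (card (alice_moves \<sigma> x k)) * \<Phi> (G (Suc k)))"
        using c by (intro mult_left_mono G_Suc(2)) (auto intro!: mult_nonneg_nonneg prod_nonneg)
      with Suc show ?case by (simp add: mult_ac)
    qed
    have card: "0 < card (alice_moves \<sigma> x j)" for j
      using legal_move_finite_nonempty[OF legal \<beta>(1) \<rho>0 bob_play_imp_legal_history[OF x]]
      by (simp add: alice_moves_def card_gt_0_iff)
    let ?f = "\<lambda>k. s - ln c / - ln \<beta> + (ln (\<Phi> G0) - ln c) / - ln \<beta> / real k"
    have "?f k \<le> average_score \<beta> (alice_moves \<sigma> x) k" if "0 < k" for k
    proof (rule average_score_ge[OF \<beta>(1) \<beta>1 that card G0_pos c])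
      have "\<Phi> G0 * (1 / \<beta> ^ k) powr s \<le>
          (c ^ Suc k * (\<Prod>j<Suc k. real (card (alice_moves \<sigma> x j))) * (\<beta> ^ k) powr s) * (1 / \<beta> ^ k) powr s"
        using prod[of "Suc k"] \<Phi>_le[OF G_cell[of k]] c
        by (intro mult_right_mono) (auto elim!: order_trans intro!: mult_left_mono mult_nonneg_nonneg prod_nonneg)
      also have "\<dots> = c ^ Suc k * (\<Prod>j\<le>k. real (card (alice_moves \<sigma> x j)))"
        using \<beta>(1) by (simp add: powr_divide lessThan_Suc_atMost)
      finally show "\<Phi> G0 * (1 / \<beta> ^ k) powr s \<le> c ^ Suc k * (\<Prod>j\<le>k. real (card (alice_moves \<sigma> x j)))" .
    qed
    then have "liminf (\<lambda>k. ereal (?f k)) \<le> lower_score \<beta> (alice_moves \<sigma> x)"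
      unfolding lower_score_def by (intro Liminf_mono eventually_sequentiallyI[of 1]) auto
    moreover have "liminf (\<lambda>k. ereal (?f k)) = ereal (s - ln c / - ln \<beta>)"
      by (intro lim_imp_Liminf tendsto_ereal average_score_bound_tendsto) simp
    ultimately show "ereal \<delta> \<le> lower_score \<beta> (alice_moves \<sigma> x)"
      using \<delta> unfolding c_def by (metis ereal_less_eq(3) order_trans)
  qed
qed

section \<open>Alice and packing dimension\<close>

text \<open>Box counting restricted to the levels visited by the game, hence dependent on
  \<open>\<beta>\<close>. Finiteness is demanded separately since \<open>card\<close> of an infinite
  set is 0.\<close>

definition box_bounded :: "real \<Rightarrow> real \<Rightarrow> (real ^ 'n::finite) set \<Rightarrow> bool" where
  "box_bounded \<beta> s E \<longleftrightarrow> (\<exists>K. \<forall>k\<ge>K. finite (dyadic_index (dyadic_level \<beta> k) ` E) \<and>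
     real (card (dyadic_index (dyadic_level \<beta> k) ` E)) \<le> (2 ^ dyadic_level \<beta> k) powr s)"

text \<open>The sigma-ideal generated by the box-bounded sets, modelled on packing dimension as
  modified upper box dimension.\<close>

definition box_negligible :: "real \<Rightarrow> real \<Rightarrow> (real ^ 'n::finite) set \<Rightarrow> bool" where
  "box_negligible \<beta> s E \<longleftrightarrow> (\<exists>T :: nat \<Rightarrow> _. E \<subseteq> (\<Union>n. T n) \<and> (\<forall>n. box_bounded \<beta> s (T n)))"

lemma box_negligible_mono: "box_negligible \<beta> s F \<Longrightarrow> E \<subseteq> F \<Longrightarrow> box_negligible \<beta> s E"
  unfolding box_negligible_def by (meson order_trans)

lemma box_negligible_empty [simp]: "box_negligible \<beta> s {}"
  unfolding box_negligible_def box_bounded_def by (intro exI[of _ "\<lambda>_. {}"]) auto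

lemma box_bounded_imp_negligible: "box_bounded \<beta> s E \<Longrightarrow> box_negligible \<beta> s E"
  unfolding box_negligible_def by (intro exI[of _ "\<lambda>_. E"]) auto

lemma box_negligible_UN:
  assumes "\<And>n::nat. box_negligible \<beta> s (E n)"
  shows "box_negligible \<beta> s (\<Union>n. E n)"
proof -
  have "\<exists>T :: nat \<Rightarrow> _. E n \<subseteq> (\<Union>m. T m) \<and> (\<forall>m. box_bounded \<beta> s (T m))" for n
    using assms[of n] by (simp add: box_negligible_def)
  then obtain T where T: "\<And>n. E n \<subseteq> (\<Union>m. T n m)" "\<And>n m::nat. box_bounded \<beta> s (T n m)"
    by metis
  define T' where "T' i = (case prod_decode i of (n, m) \<Rightarrow> T n m)" for i
  have "(\<Union>n. E n) \<subseteq> (\<Union>i. T' i)"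
  proof
    fix x assume "x \<in> (\<Union>n. E n)"
    then obtain n where "x \<in> E n" by blast
    then obtain m where "x \<in> T n m" using T(1) by blast
    then have "x \<in> T' (prod_encode (n, m))" by (simp add: T'_def)
    then show "x \<in> (\<Union>i. T' i)" by blast
  qed
  moreover have "box_bounded \<beta> s (T' i)" for i by (simp add: T'_def T(2) split: prod.splits)
  ultimately show ?thesis unfolding box_negligible_def by blast
qed

lemma box_negligible_Un:
  assumes "box_negligible \<beta> s E" "box_negligible \<beta> s F"
  shows "box_negligible \<beta> s (E \<union> F)"
proof (rule box_negligible_mono)
  show "box_negligible \<beta> s (\<Union>n::nat. if n = 0 then E else F)"
    using assms by (intro box_negligible_UN) simp
  show "E \<union> F \<subseteq> (\<Union>n::nat. if n = 0 then E else F)" by (auto split: if_splits)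
qed

text \<open>The balls of a packing are grouped by the coarsest level at which the diameter bound for cells
  does not exceed the radius; at that level their centres lie in different cells.\<close>

lemma packing_premeasure_box_bounded:
  fixes T :: "(real ^ 'n::finite) set"
  assumes \<beta>: "0 < \<beta>" "\<beta> < 1" and s: "0 \<le> s'" "s' < s" and T: "box_bounded \<beta> s' T"
  shows "packing_premeasure s T = 0"
proof -
  let ?l = "dyadic_level \<beta>" and ?D = "real CARD('n)"
  obtain K where K: "\<And>k. k \<ge> K \<Longrightarrow> finite (dyadic_index (?l k) ` T)"
    "\<And>k. k \<ge> K \<Longrightarrow> real (card (dyadic_index (?l k) ` T)) \<le> (2 ^ ?l k) powr s'"
    using T unfolding box_bounded_def by blast
  \<comment> \<open>Again half of the gap: one factor \<open>\<gamma> ^ k\<close> sums over levels,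
    the other is at most \<open>\<gamma> ^ K'\<close> and makes the total small.\<close>
  define \<gamma> where "\<gamma> = \<beta> powr ((s - s') / 2)"
  have \<gamma>: "0 < \<gamma>" "\<gamma> < 1"
    using \<beta> s powr_less_mono2[of "(s - s') / 2" \<beta> 1] by (auto simp: \<gamma>_def)
  \<comment> \<open>The first factor comes from \<open>2 ^ ?l k < 2 / \<beta> ^ k\<close> in the
    cell count, the second from a diameter bound at level \<open>k - 1\<close>.\<close>
  define M where "M = 2 powr s' * (2 * ?D / \<beta>) powr s"
  have M: "0 < M" using \<beta> by (simp add: M_def)
  have "packing_premeasure s T \<le> ennreal e" if e: "0 < e" for e
  proof -
    obtain K' where K': "\<gamma> ^ K' < e * (1 - \<gamma>) / M"
      using real_arch_pow_inv[of "e * (1 - \<gamma>) / M" \<gamma>] \<gamma> M e by auto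
    define N where "N = max K K'"
    \<comment> \<open>So small a radius belongs to a level beyond \<open>N\<close>, where the count
      is bounded and \<open>\<gamma>\<close> is already tiny.\<close>
    obtain \<epsilon> where \<epsilon>: "0 < \<epsilon>" "\<epsilon> < ?D / 2 ^ ?l N"
      using dense[of 0 "?D / 2 ^ ?l N"] by auto
    have "packing_premeasure_scale s \<epsilon> T \<le> ennreal e"
      unfolding packing_premeasure_scale_def
    proof (rule SUP_least)
      fix P assume P: "P \<in> packings \<epsilon> T"
      show "(\<Sum>\<^sub>\<infinity>(x, r)\<in>P. ennreal ((2 * r) powr s)) \<le> ennreal e"
      proof (subst nonneg_infsum_complete, simp, rule SUP_least)
        fix F assume "F \<in> {F. finite F \<and> F \<subseteq> P}"
        then have F: "finite F" "F \<subseteq> P" by auto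
        have F_T: "x \<in> T" "0 < r" "r \<le> \<epsilon>" if "(x, r) \<in> F" for x r
          using F P that by (auto simp: packings_def)
        have F_disj: "p = q" if "p \<in> F" "q \<in> F" "z \<in> cball (fst p) (snd p)" "z \<in> cball (fst q) (snd q)" for p q z
        proof (rule ccontr)
          assume "p \<noteq> q"
          moreover have "disjoint_family_on (\<lambda>(x, r). cball x r) P" using P by (simp add: packings_def)
          ultimately have "cball (fst p) (snd p) \<inter> cball (fst q) (snd q) = {}"
            using disjoint_family_onD[of "\<lambda>(x, r). cball x r" P p q] that(1,2) F(2) by (auto simp: split_beta)
          then show False using that(3,4) by blast
        qed
        define \<kappa> where "\<kappa> r = (LEAST k. ?D / 2 ^ ?l k \<le> r)" for r :: real
        have \<kappa>: "?D / 2 ^ ?l (\<kappa> r) \<le> r" if r: "0 < r" for r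
        proof -
          obtain k where "\<beta> ^ k < r / ?D" using real_arch_pow_inv[of "r / ?D" \<beta>] \<beta> r by auto
          then have "?D * \<beta> ^ k \<le> r" by (simp add: field_simps)
          moreover have "?D * (1 / 2 ^ ?l k) \<le> ?D * \<beta> ^ k"
            by (intro mult_left_mono inverse_two_power_dyadic_level_le[OF \<beta>]) simp
          ultimately have "?D / 2 ^ ?l k \<le> r" by simp
          then show ?thesis unfolding \<kappa>_def by (rule LeastI)
        qed
        have \<kappa>_gt: "N < \<kappa> r" if "0 < r" "r \<le> \<epsilon>" for r
        proof (rule ccontr)
          assume "\<not> N < \<kappa> r"
          then have "?l (\<kappa> r) \<le> ?l N" using dyadic_level_mono[OF \<beta>] by simp
          then have "?D / 2 ^ ?l N \<le> ?D / 2 ^ ?l (\<kappa> r)"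
            by (intro divide_left_mono power_increasing) auto
          then show False using \<kappa>[OF that(1)] that(2) \<epsilon>(2) by linarith
        qed
        have size: "(2 * r) powr s \<le> (2 * ?D / \<beta>) powr s * (\<beta> ^ \<kappa> r) powr s" if r: "0 < r" "r \<le> \<epsilon>" for r
        proof -
          obtain k where k: "\<kappa> r = Suc k" using \<kappa>_gt[OF r] by (cases "\<kappa> r") auto
          have "\<not> ?D / 2 ^ ?l k \<le> r"
            using not_less_Least[of k "\<lambda>k. ?D / 2 ^ ?l k \<le> r"] k by (simp add: \<kappa>_def)
          then have "r \<le> ?D * (1 / 2 ^ ?l k)" by simp
          also have "\<dots> \<le> ?D * \<beta> ^ k"
            by (intro mult_left_mono inverse_two_power_dyadic_level_le[OF \<beta>]) simp
          finally have "2 * r \<le> 2 * ?D / \<beta> * \<beta> ^ \<kappa> r" using \<beta> by (simp add: k)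
          then have "(2 * r) powr s \<le> (2 * ?D / \<beta> * \<beta> ^ \<kappa> r) powr s"
            using that s by (intro powr_mono2) auto
          then show ?thesis by (simp only: powr_mult)
        qed
        have level: "(\<Sum>(x, r) | (x, r) \<in> F \<and> \<kappa> r = k. (2 * r) powr s) \<le> M * \<gamma> ^ K' * \<gamma> ^ k" for k
        proof (cases "N < k")
          case False
          then have empty: "{(x, r). (x, r) \<in> F \<and> \<kappa> r = k} = {}" using F_T \<kappa>_gt by fastforce
          show ?thesis unfolding empty using M \<gamma> by simp
        next
          case True
          let ?F = "{(x, r). (x, r) \<in> F \<and> \<kappa> r = k}"
          have finF: "finite ?F" by (rule finite_subset[OF _ F(1)]) auto
          have inj: "inj_on (\<lambda>p. dyadic_index (?l k) (fst p)) ?F"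
          proof (rule inj_onI)
            fix p q assume pq: "p \<in> ?F" "q \<in> ?F" "dyadic_index (?l k) (fst p) = dyadic_index (?l k) (fst q)"
            have "dist (fst p) (fst q) \<le> ?D / 2 ^ ?l k" using pq(3) by (rule dist_dyadic_cell_le)
            also have "\<dots> \<le> snd p" using pq(1) \<kappa>[of "snd p"] F_T by (auto split: prod.splits)
            finally have "fst q \<in> cball (fst p) (snd p)" by simp
            moreover have "fst q \<in> cball (fst q) (snd q)" using pq(2) F_T by (force split: prod.splits)
            ultimately show "p = q" using F_disj[of p q] pq by auto
          qed
          have "card ?F = card ((\<lambda>p. dyadic_index (?l k) (fst p)) ` ?F)" by (rule card_image[OF inj, symmetric])
          also have "\<dots> \<le> card (dyadic_index (?l k) ` T)"
            using K(1)[of k] True F_T by (intro card_mono) (auto simp: N_def)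
          finally have "real (card ?F) \<le> real (card (dyadic_index (?l k) ` T))" by simp
          also have "\<dots> \<le> (2 ^ ?l k) powr s'" using K(2)[of k] True by (simp add: N_def)
          also have "\<dots> \<le> (2 / \<beta> ^ k) powr s'"
            using two_power_dyadic_level_less[OF \<beta>, of k] \<beta> s by (intro powr_mono2) (auto simp: field_simps)
          finally have card: "real (card ?F) \<le> (2 / \<beta> ^ k) powr s'" .
          have "(\<Sum>(x, r)\<in>?F. (2 * r) powr s) \<le> real (card ?F) * ((2 * ?D / \<beta>) powr s * (\<beta> ^ k) powr s)"
            using size F_T by (intro sum_bounded_above) (force split: prod.splits)
          also have "\<dots> \<le> (2 / \<beta> ^ k) powr s' * ((2 * ?D / \<beta>) powr s * (\<beta> ^ k) powr s)"
            using card by (intro mult_right_mono) auto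
          also have "\<dots> = M * ((\<beta> ^ k) powr s / (\<beta> ^ k) powr s')"
            by (simp add: M_def powr_divide mult_ac)
          also have "(\<beta> ^ k) powr s / (\<beta> ^ k) powr s' = \<gamma> ^ k * \<gamma> ^ k"
          proof -
            have "\<gamma> ^ k = (\<beta> ^ k) powr ((s - s') / 2)"
              using \<beta> by (simp add: \<gamma>_def powr_realpow[symmetric] powr_powr mult.commute)
            then show ?thesis by (simp add: powr_add[symmetric] powr_diff[symmetric])
          qed
          also have "M * (\<gamma> ^ k * \<gamma> ^ k) \<le> M * (\<gamma> ^ K' * \<gamma> ^ k)"
            using M \<gamma> True by (intro mult_left_mono mult_right_mono power_decreasing) (auto simp: N_def)
          finally show ?thesis by (simp add: mult.assoc)
        qed
        have "(\<Sum>(x, r)\<in>F. (2 * r) powr s) = (\<Sum>k\<in>(\<lambda>p. \<kappa> (snd p)) ` F. \<Sum>p | p \<in> F \<and> \<kappa> (snd p) = k. (2 * snd p) powr s)"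
          by (subst sum.image_gen[OF F(1), of _ "\<lambda>p. \<kappa> (snd p)"]) (simp add: split_beta)
        also have "\<dots> \<le> (\<Sum>k\<in>(\<lambda>p. \<kappa> (snd p)) ` F. M * \<gamma> ^ K' * \<gamma> ^ k)"
        proof (rule sum_mono)
          fix k
          have "{p. p \<in> F \<and> \<kappa> (snd p) = k} = {(x, r). (x, r) \<in> F \<and> \<kappa> r = k}" by auto
          then show "(\<Sum>p | p \<in> F \<and> \<kappa> (snd p) = k. (2 * snd p) powr s) \<le> M * \<gamma> ^ K' * \<gamma> ^ k"
            using level[of k] by (simp add: split_beta)
        qed
        also have "\<dots> = M * \<gamma> ^ K' * (\<Sum>k\<in>(\<lambda>p. \<kappa> (snd p)) ` F. \<gamma> ^ k)" by (simp add: sum_distrib_left)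
        also have "\<dots> \<le> M * \<gamma> ^ K' * (1 / (1 - \<gamma>))"
        proof (rule mult_left_mono)
          have "(\<Sum>k\<in>(\<lambda>p. \<kappa> (snd p)) ` F. \<gamma> ^ k) \<le> (\<Sum>k. \<gamma> ^ k)"
            using \<gamma> F(1) by (intro sum_le_suminf summable_geometric) auto
          then show "(\<Sum>k\<in>(\<lambda>p. \<kappa> (snd p)) ` F. \<gamma> ^ k) \<le> 1 / (1 - \<gamma>)" using \<gamma> by (simp add: suminf_geometric)
        qed (use M \<gamma> in simp)
        also have "\<dots> \<le> e" using K' M \<gamma> by (simp add: field_simps)
        finally have "(\<Sum>(x, r)\<in>F. (2 * r) powr s) \<le> e" .
        moreover have "(\<Sum>(x, r)\<in>F. ennreal ((2 * r) powr s)) = ennreal (\<Sum>(x, r)\<in>F. (2 * r) powr s)"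
          by (simp add: split_beta sum_ennreal)
        ultimately show "(\<Sum>(x, r)\<in>F. ennreal ((2 * r) powr s)) \<le> ennreal e" by (simp add: ennreal_leI)
      qed
    qed
    moreover have "packing_premeasure s T \<le> packing_premeasure_scale s \<epsilon> T"
      unfolding packing_premeasure_def using \<epsilon>(1) by (intro INF_lower) simp
    ultimately show ?thesis by (rule order_trans[rotated])
  qed
  then have "packing_premeasure s T \<le> 0" by (metis add_0 ennreal_le_epsilon)
  then show ?thesis by simp
qed

lemma packing_measure_box_negligible:
  assumes "0 < \<beta>" "\<beta> < 1" "0 \<le> s'" "s' < s" "box_negligible \<beta> s' E"
  shows "packing_measure s E = 0"
proof -
  obtain T :: "nat \<Rightarrow> _" where T: "E \<subseteq> (\<Union>n. T n)" "\<And>n. box_bounded \<beta> s' (T n)"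
    using assms(5) unfolding box_negligible_def by blast
  have "packing_measure s E \<le> (\<Sum>n. packing_premeasure s (T n))"
    unfolding packing_measure_def using T(1) by (intro INF_lower) simp
  also have "\<dots> = 0" using packing_premeasure_box_bounded[OF assms(1-4) T(2)] by simp
  finally show ?thesis by simp
qed

section \<open>Good cells and the block strategy\<close>

text \<open>Not every cell that meets \<open>E\<close> is counted: the cell reached at the end of a
  block must contain enough of the piece to start the next block.\<close>

definition good_cells :: "real \<Rightarrow> real \<Rightarrow> nat \<Rightarrow> (real ^ 'n::finite) set \<Rightarrow> ('n \<Rightarrow> int) set" where
  "good_cells \<beta> s e E = {z. \<not> box_negligible \<beta> s (E \<inter> dyadic_cell (dyadic_level \<beta> e, z))}"

lemma good_cells_subset: "good_cells \<beta> s e E \<subseteq> dyadic_index (dyadic_level \<beta> e) ` E"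
proof
  fix z assume "z \<in> good_cells \<beta> s e E"
  then have "E \<inter> dyadic_cell (dyadic_level \<beta> e, z) \<noteq> {}" by (auto simp: good_cells_def)
  then show "z \<in> dyadic_index (dyadic_level \<beta> e) ` E" by (auto simp: dyadic_cell_def)
qed

text \<open>The negligible parts of \<open>E\<close> in cells of all levels are countably many, so
  removing them all leaves a set that is not negligible, hence not box-bounded. At a level where
  this set has too many cells, each of them is good, since a negligible part would have been
  removed.\<close>

lemma exists_many_good_cells:
  fixes E :: "(real ^ 'n::finite) set"
  assumes "\<not> box_negligible \<beta> s E" "\<And>e. K \<le> e \<Longrightarrow> finite (dyadic_index (dyadic_level \<beta> e) ` E)"
  obtains e where "K \<le> e" "(2 ^ dyadic_level \<beta> e) powr s < real (card (good_cells \<beta> s e E))"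
proof -
  let ?cell = "\<lambda>e z. E \<inter> dyadic_cell (dyadic_level \<beta> e, z)"
  define f where "f i = (case from_nat i of (e, z :: 'n \<Rightarrow> int) \<Rightarrow>
    if box_negligible \<beta> s (?cell e z) then ?cell e z else {})" for i
  define B where "B = (\<Union>i. f i)"
  have "box_negligible \<beta> s B"
    unfolding B_def by (intro box_negligible_UN) (auto simp: f_def split: prod.splits)
  then have "\<not> box_negligible \<beta> s (E - B)"
    using assms(1) box_negligible_Un[of \<beta> s "E - B" B] box_negligible_mono[of \<beta> s "E - B \<union> B" E] by blast
  then have "\<not> box_bounded \<beta> s (E - B)" using box_bounded_imp_negligible by blast
  then obtain e where e: "K \<le> e" "finite (dyadic_index (dyadic_level \<beta> e) ` (E - B)) \<Longrightarrow>
      (2 ^ dyadic_level \<beta> e) powr s < real (card (dyadic_index (dyadic_level \<beta> e) ` (E - B)))"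
    unfolding box_bounded_def by (meson not_le)
  have fin: "finite (dyadic_index (dyadic_level \<beta> e) ` E)" using assms(2) e by blast
  have "dyadic_index (dyadic_level \<beta> e) ` (E - B) \<subseteq> good_cells \<beta> s e E"
  proof (rule image_subsetI)
    fix x assume x: "x \<in> E - B"
    let ?z = "dyadic_index (dyadic_level \<beta> e) x"
    have "x \<in> ?cell e ?z" using x by (simp add: dyadic_cell_def)
    moreover have "x \<notin> f (to_nat (e, ?z))" using x unfolding B_def by blast
    ultimately show "?z \<in> good_cells \<beta> s e E" by (auto simp: f_def good_cells_def split: if_splits)
  qed
  moreover have "finite (good_cells \<beta> s e E)" using good_cells_subset fin by (rule finite_subset)
  ultimately have "card (dyadic_index (dyadic_level \<beta> e) ` (E - B)) \<le> card (good_cells \<beta> s e E)"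
    by (rule card_mono[rotated])
  moreover have "finite (dyadic_index (dyadic_level \<beta> e) ` (E - B))"
    using fin by (rule finite_subset[rotated]) auto
  ultimately show ?thesis using that[of e] e by linarith
qed

text \<open>Subadditivity of the counting functional: a cell of level \<open>e\<close> lies in a
  single cell of the coarser level \<open>k\<close>, and it remains good for the part of
  \<open>E\<close> there.\<close>

lemma card_good_cells_le_sum:
  fixes E :: "(real ^ 'n::finite) set"
  assumes "0 < \<beta>" "\<beta> < 1" "k \<le> e" "finite I" "dyadic_index (dyadic_level \<beta> k) ` E \<subseteq> I"
    and fin: "finite (dyadic_index (dyadic_level \<beta> e) ` E)"
  shows "card (good_cells \<beta> s e E) \<le>
    (\<Sum>z\<in>I. card (good_cells \<beta> s e (E \<inter> dyadic_cell (dyadic_level \<beta> k, z))))"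
proof -
  let ?E = "\<lambda>z. E \<inter> dyadic_cell (dyadic_level \<beta> k, z)"
  have le: "dyadic_level \<beta> k \<le> dyadic_level \<beta> e" by (rule dyadic_level_mono[OF assms(1-3)])
  have "good_cells \<beta> s e E \<subseteq> (\<Union>z\<in>I. good_cells \<beta> s e (?E z))"
  proof
    fix w assume w: "w \<in> good_cells \<beta> s e E"
    then obtain x where x: "x \<in> E" "w = dyadic_index (dyadic_level \<beta> e) x" using good_cells_subset by blast
    let ?z = "dyadic_index (dyadic_level \<beta> k) x"
    have "E \<inter> dyadic_cell (dyadic_level \<beta> e, w) \<subseteq> ?E ?z \<inter> dyadic_cell (dyadic_level \<beta> e, w)"
      using dyadic_index_coarser[OF le] x by (auto simp: dyadic_cell_def)
    then have "w \<in> good_cells \<beta> s e (?E ?z)"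
      using w box_negligible_mono unfolding good_cells_def by blast
    then show "w \<in> (\<Union>z\<in>I. good_cells \<beta> s e (?E z))" using x assms(5) by blast
  qed
  moreover have "finite (good_cells \<beta> s e (?E z))" for z
    using good_cells_subset by (rule finite_subset[OF _ finite_subset[OF _ fin]]) auto
  ultimately have "card (good_cells \<beta> s e E) \<le> card (\<Union>z\<in>I. good_cells \<beta> s e (?E z))"
    using assms(4) by (intro card_mono) auto
  also have "\<dots> \<le> (\<Sum>z\<in>I. card (good_cells \<beta> s e (?E z)))" by (rule card_UN_le[OF assms(4)])
  finally show ?thesis .
qed

text \<open>A block ends at a level \<open>e\<close> fixed in advance, where at least
  \<open>(2 ^ dyadic_level \<beta> e) powr s\<close> cells are good at its start. Each turn loses at
  most the factor \<open>c * card A\<close>, and at the end a single cell is left. So the product of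
  the moves is large at the ends of blocks, which occur arbitrarily late.\<close>

lemma packing_beta_winning_if_not_box_negligible:
  fixes S :: "(real ^ 'n::finite) set"
  assumes S: "suslin S" "\<not> box_negligible \<beta> s S" and s: "0 \<le> s"
    and \<beta>: "0 < \<beta>" "\<beta> \<le> 1 / 2"
    and \<delta>: "\<delta> \<le> s - ln (step_loss CARD('n) \<beta>) / - ln \<beta>"
  shows "packing_beta_winning \<beta> \<delta> S"
proof -
  let ?D = "CARD('n)" and ?l = "dyadic_level \<beta>"
  let ?cell = "\<lambda>j z. dyadic_cell (j, z) \<times> (UNIV :: (nat \<Rightarrow> nat) set)"
  define \<rho>0 where "\<rho>0 = 2 * real ?D"
  define c where "c = step_loss ?D \<beta>"
  have \<beta>1: "\<beta> < 1" using \<beta> by simp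
  have \<rho>0: "0 < \<rho>0" by (simp add: \<rho>0_def)
  have c: "1 \<le> c" using step_loss_ge_1[of ?D \<beta>] \<beta> by (simp add: c_def)
  obtain C where C: "seq_closed C" "S = fst ` C" using S by (auto simp: suslin_def)
  define \<Phi> where "\<Phi> e G = real (card (good_cells \<beta> s e (fst ` G)))"
    for e and G :: "((real ^ 'n) \<times> (nat \<Rightarrow> nat)) set"
  define in_cell where "in_cell k p G \<longleftrightarrow> (\<forall>g\<in>G. dyadic_index (?l k) (fst g) = dyadic_index (?l k) p)"
    for k and p :: "real ^ 'n" and G :: "((real ^ 'n) \<times> (nat \<Rightarrow> nat)) set"
  have fst_cell: "fst ` (G \<inter> ?cell j z) = fst ` G \<inter> dyadic_cell (j, z)"
    for G :: "((real ^ 'n) \<times> (nat \<Rightarrow> nat)) set" and j z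
    by force
  have fin: "finite (dyadic_index (?l e) ` fst ` G)" if "in_cell k p G" "k \<le> e" for k p G e
  proof (rule finite_subset)
    show "finite {dyadic_index (?l e) y |y. dyadic_index (?l k) y = dyadic_index (?l k) p}"
      by (rule finite_dyadic_subcells[OF dyadic_level_mono[OF \<beta>(1) \<beta>1 that(2)]])
    show "dyadic_index (?l e) ` fst ` G \<subseteq> {dyadic_index (?l e) y |y. dyadic_index (?l k) y = dyadic_index (?l k) p}"
      using that(1) by (auto simp: in_cell_def)
  qed
  \<comment> \<open>The values of coordinate \<open>b\<close> split \<open>G\<close> into countably
    many classes, one of which is not negligible. The level \<open>e\<close> is chosen for that
    class, so what the split did to earlier counts is irrelevant.\<close>
  have refine: "\<exists>n e. K \<le> e \<and> (2 ^ ?l e) powr s \<le> \<Phi> e {g\<in>G. snd g b = n}"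
    if G: "in_cell k p G" "k \<le> K" "\<not> box_negligible \<beta> s (fst ` G)" for k p G K b
  proof -
    have "fst ` G = (\<Union>n. fst ` {g\<in>G. snd g b = n})" by force
    then obtain n where n: "\<not> box_negligible \<beta> s (fst ` {g\<in>G. snd g b = n})"
      using G(3) box_negligible_UN[of \<beta> s "\<lambda>n. fst ` {g\<in>G. snd g b = n}"] by auto
    have "in_cell k p {g\<in>G. snd g b = n}" using G(1) by (auto simp: in_cell_def)
    then have "finite (dyadic_index (?l e) ` fst ` {g\<in>G. snd g b = n})" if "K \<le> e" for e
      using G(2) that by (intro fin[of k p]) auto
    then obtain e where "K \<le> e" "(2 ^ ?l e) powr s < real (card (good_cells \<beta> s e (fst ` {g\<in>G. snd g b = n})))"
      using exists_many_good_cells[OF n] by blast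
    then show ?thesis unfolding \<Phi>_def by (meson less_imp_le)
  qed
  have "\<exists>z :: 'n \<Rightarrow> int. \<not> box_negligible \<beta> s (S \<inter> dyadic_cell (0, z))"
  proof (rule ccontr)
    assume "\<not> ?thesis"
    then have "box_negligible \<beta> s (\<Union>n. S \<inter> dyadic_cell (0, from_nat n :: 'n \<Rightarrow> int))"
      by (intro box_negligible_UN) auto
    moreover have "S \<subseteq> (\<Union>n. S \<inter> dyadic_cell (0, from_nat n :: 'n \<Rightarrow> int))"
    proof
      fix x assume "x \<in> S"
      then have "x \<in> S \<inter> dyadic_cell (0, from_nat (to_nat (dyadic_index 0 x)))" by (simp add: dyadic_cell_def)
      then show "x \<in> (\<Union>n. S \<inter> dyadic_cell (0, from_nat n :: 'n \<Rightarrow> int))" by blast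
    qed
    ultimately show False using S(2) box_negligible_mono by blast
  qed
  then obtain z0 :: "'n \<Rightarrow> int" where z0: "\<not> box_negligible \<beta> s (S \<inter> dyadic_cell (0, z0))" by blast
  define p0 :: "real ^ 'n" where "p0 = dyadic_corner 0 z0"
  have C_cell: "in_cell 0 p0 (C \<inter> ?cell 0 z0)" by (auto simp: in_cell_def p0_def dyadic_cell_def)
  obtain n0 e0 where e0: "(2 ^ ?l e0) powr s \<le> \<Phi> e0 {g\<in>C \<inter> ?cell 0 z0. snd g 0 = n0}"
    using refine[OF C_cell, of 0 0] z0 by (auto simp: fst_cell C)
  define G0 where "G0 = {g\<in>C \<inter> ?cell 0 z0. snd g 0 = n0}"
  \<comment> \<open>Here \<open>b\<close> is the coordinate to be fixed at the end of the block,
    \<open>e\<close> that end, and \<open>P\<close> the product of the cardinalities so far.\<close>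
  define Inv where "Inv k st \<longleftrightarrow> (case st of (p, G, b :: nat, e, P) \<Rightarrow> in_cell (k - 1) p G \<and> k \<le> e \<and>
      1 \<le> P \<and> (2 ^ ?l e) powr s \<le> P * c ^ k * \<Phi> e G)" for k st
  define R where "R k st A (x :: real ^ 'n) st' \<longleftrightarrow> (case (st, st') of ((p, G, b, e, P), (p', G', b', e', P')) \<Rightarrow>
     p' = x \<and> G' \<subseteq> G \<and> P' = P * real (card A) \<and> (k < e \<longrightarrow> b' = b \<and> e' = e) \<and>
     (k = e \<longrightarrow> b' = Suc b \<and> (\<exists>u. \<forall>g\<in>G'. snd g b \<le> u) \<and> (2 ^ ?l k) powr s \<le> P' * c ^ Suc k))"
    for k :: nat and st :: "(real ^ 'n) \<times> ((real ^ 'n) \<times> (nat \<Rightarrow> nat)) set \<times> nat \<times> nat \<times> real"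
      and A :: "(real ^ 'n) set" and x st'
  have init: "Inv 0 (p0, G0, 0, e0, 1)"
    using e0 C_cell by (auto simp: Inv_def G0_def in_cell_def)
  have step: "\<exists>A. A \<noteq> {} \<and> finite A \<and> separated_set (3 * (\<beta> ^ k * \<rho>0)) A \<and>
       A \<subseteq> cball (fst st) ((1 - \<beta>) * (\<beta> ^ (k - 1) * \<rho>0)) \<and>
       (\<forall>x\<in>A. \<exists>st'. Inv (Suc k) st' \<and> fst st' = x \<and> R k st A x st')" if inv: "Inv k st" for k st
  proof -
    obtain p G b e P where st: "st = (p, G, b, e, P)" by (metis prod.collapse)
    have G: "in_cell (k - 1) p G" "k \<le> e" "1 \<le> P" "(2 ^ ?l e) powr s \<le> P * c ^ k * \<Phi> e G"
      using inv by (auto simp: Inv_def st)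
    have "0 < (2 ^ ?l e) powr s" by simp
    then have "0 < \<Phi> e G" using G(4) by (cases "\<Phi> e G = 0") (auto simp: \<Phi>_def)
    define I where "I = {dyadic_index (?l k) y |y. dyadic_index (?l (k - 1)) y = dyadic_index (?l (k - 1)) p}"
    have lev: "?l (k - 1) \<le> ?l k" by (rule dyadic_level_mono[OF \<beta>(1) \<beta>1]) simp
    have finI: "finite I" unfolding I_def by (rule finite_dyadic_subcells[OF lev])
    define a where "a z = \<Phi> e (G \<inter> ?cell (?l k) z)" for z
    have "dyadic_index (?l k) ` fst ` G \<subseteq> I" using G(1) by (auto simp: I_def in_cell_def)
    then have "card (good_cells \<beta> s e (fst ` G)) \<le>
        (\<Sum>z\<in>I. card (good_cells \<beta> s e (fst ` G \<inter> dyadic_cell (?l k, z))))"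
      using fin[OF G(1), of e] G(2) by (intro card_good_cells_le_sum[OF \<beta>(1) \<beta>1 G(2) finI]) auto
    then have "real (card (good_cells \<beta> s e (fst ` G))) \<le>
        real (\<Sum>z\<in>I. card (good_cells \<beta> s e (fst ` G \<inter> dyadic_cell (?l k, z))))"
      by (rule of_nat_mono)
    then have sum_a: "\<Phi> e G \<le> sum a I" by (simp add: \<Phi>_def a_def fst_cell)
    then have pos: "0 < sum a I" using \<open>0 < \<Phi> e G\<close> by simp
    obtain A where A: "A \<noteq> {}" "finite A" "separated_set (3 * (\<beta> ^ k * \<rho>0)) A"
      "A \<subseteq> cball p ((1 - \<beta>) * (\<beta> ^ (k - 1) * \<rho>0))"
      "\<And>x. x \<in> A \<Longrightarrow> sum a I \<le> step_loss ?D \<beta> * real (card A) * a (dyadic_index (?l k) x)"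
      using alice_step[OF \<beta> \<rho>0_def _ I_def pos] by (auto simp: a_def \<Phi>_def)
    have "1 \<le> card A" using A(1,2) by (simp add: card_gt_0_iff Suc_leI)
    define P' where "P' = P * real (card A)"
    have P': "1 \<le> P'"
      unfolding P'_def using G(3) \<open>1 \<le> card A\<close> mult_mono[of 1 P 1 "real (card A)"] by simp
    have "\<exists>st'. Inv (Suc k) st' \<and> fst st' = x \<and> R k st A x st'" if x: "x \<in> A" for x
    proof -
      define G' where "G' = G \<inter> ?cell (?l k) (dyadic_index (?l k) x)"
      have G'_sub: "G' \<subseteq> G" by (auto simp: G'_def)
      have G'_cell: "in_cell k x G'" by (auto simp: in_cell_def dyadic_cell_def G'_def)
      have le: "\<Phi> e G \<le> c * real (card A) * \<Phi> e G'"
        using sum_a A(5)[OF x] by (simp add: a_def c_def G'_def)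
      have "P * c ^ k * \<Phi> e G \<le> P * c ^ k * (c * real (card A) * \<Phi> e G')"
        using le G(3) c by (intro mult_left_mono) auto
      with G(4) have bound: "(2 ^ ?l e) powr s \<le> P' * c ^ Suc k * \<Phi> e G'"
        by (simp add: P'_def mult_ac)
      show ?thesis
      proof (cases "k < e")
        case True
        then have "Inv (Suc k) (x, G', b, e, P')" using G'_cell P' bound by (simp add: Inv_def)
        moreover have "R k st A x (x, G', b, e, P')" using True G'_sub by (simp add: R_def st P'_def)
        ultimately show ?thesis by fastforce
      next
        case False
        then have e: "e = k" using G(2) by simp
        have "0 < \<Phi> e G'" using le \<open>0 < \<Phi> e G\<close> by (cases "\<Phi> e G' = 0") (auto simp: \<Phi>_def)
        then obtain z where "z \<in> good_cells \<beta> s e (fst ` G')"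
          unfolding \<Phi>_def by (metis card.empty ex_in_conv less_irrefl of_nat_0)
        then have "\<not> box_negligible \<beta> s (fst ` G')"
          using box_negligible_mono unfolding good_cells_def by blast
        then obtain n e' where e': "Suc k \<le> e'" "(2 ^ ?l e') powr s \<le> \<Phi> e' {g\<in>G'. snd g b = n}"
          using refine[OF G'_cell, of "Suc k" b] by auto
        let ?G = "{g\<in>G'. snd g b = n}"
        \<comment> \<open>A new block starts with the full count, so its invariant needs from the
          past only that this factor is at least 1.\<close>
        have "1 \<le> P' * c ^ Suc k" using P' one_le_power[OF c, of "Suc k"] mult_mono[of 1 P' 1 "c ^ Suc k"] by simp
        then have "1 * \<Phi> e' ?G \<le> P' * c ^ Suc k * \<Phi> e' ?G" by (rule mult_right_mono) (simp add: \<Phi>_def)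
        moreover have "in_cell k x ?G" using G'_cell by (auto simp: in_cell_def)
        ultimately have "Inv (Suc k) (x, ?G, Suc b, e', P')" using e' P' by (simp add: Inv_def)
        \<comment> \<open>The block ends at \<open>e = k\<close> and \<open>G'\<close> lies in one
          cell of that level, so the invariant becomes a bound on the product alone.\<close>
        moreover have "\<Phi> e G' \<le> 1"
        proof -
          have "good_cells \<beta> s e (fst ` G') \<subseteq> {dyadic_index (?l k) x}"
            using good_cells_subset[of \<beta> s e "fst ` G'"] G'_cell by (auto simp: e in_cell_def)
          then have "card (good_cells \<beta> s e (fst ` G')) \<le> card {dyadic_index (?l k) x}"
            by (intro card_mono) auto
          then show ?thesis by (simp add: \<Phi>_def)
        qed
        then have "P' * c ^ Suc k * \<Phi> e G' \<le> P' * c ^ Suc k * 1"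
          using P' c by (intro mult_left_mono) auto
        then have "(2 ^ ?l k) powr s \<le> P' * c ^ Suc k" using bound by (simp add: e)
        then have "R k st A x (x, ?G, Suc b, e', P')"
          using G'_sub by (auto simp: R_def st P'_def e intro!: exI[of _ n])
        ultimately show ?thesis by fastforce
      qed
    qed
    then show ?thesis using A(1-4) by (intro exI[of _ A]) (simp add: st)
  qed
  obtain \<sigma> where legal: "legal_strategy \<beta> \<rho>0 \<sigma>" and
    play: "\<And>x. bob_play \<sigma> x \<Longrightarrow> \<exists>S. S 0 = (p0, G0, 0, e0, 1) \<and>
      (\<forall>k. Inv k (S k) \<and> R k (S k) (alice_moves \<sigma> x k) (x k) (S (Suc k)))"
    using strategy_from_states[where Inv = Inv and R = R and pt = fst, OF init step] by blast
  show ?thesis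
    unfolding packing_beta_winning_def
  proof (intro exI conjI allI impI)
    show "0 < \<rho>0" by (rule \<rho>0)
    show "legal_strategy \<beta> \<rho>0 \<sigma>" by (rule legal)
    fix x assume x: "bob_play \<sigma> x"
    obtain T where T: "T 0 = (p0, G0, 0, e0, 1)" "\<And>k. Inv k (T k)"
      "\<And>k. R k (T k) (alice_moves \<sigma> x k) (x k) (T (Suc k))"
      using play[OF x] by blast
    define G where "G k = fst (snd (T k))" for k
    define b where "b k = fst (snd (snd (T k)))" for k
    define e where "e k = fst (snd (snd (snd (T k))))" for k
    define P where "P k = snd (snd (snd (snd (T k))))" for k
    have T_eq: "T (Suc k) = (x k, G (Suc k), b (Suc k), e (Suc k), P (Suc k))" for k
      using T(3)[of k] by (auto simp: R_def G_def b_def e_def P_def split: prod.splits)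
    have T_eq': "T k = (fst (T k), G k, b k, e k, P k)" for k
      by (simp add: G_def b_def e_def P_def)
    have inv: "k \<le> e k" "(2 ^ ?l (e k)) powr s \<le> P k * c ^ k * \<Phi> (e k) (G k)" for k
      using T(2)[of k] by (subst (asm) T_eq', simp add: Inv_def)+
    have G_cell: "in_cell k (x k) (G (Suc k))" for k
      using T(2)[of "Suc k"] by (simp add: T_eq Inv_def)
    have trans: "G (Suc k) \<subseteq> G k" "P (Suc k) = P k * real (card (alice_moves \<sigma> x k))"
      "k < e k \<Longrightarrow> b (Suc k) = b k \<and> e (Suc k) = e k"
      "k = e k \<Longrightarrow> b (Suc k) = Suc (b k) \<and> (\<exists>u. \<forall>g\<in>G (Suc k). snd g (b k) \<le> u) \<and>
         (2 ^ ?l k) powr s \<le> P (Suc k) * c ^ Suc k" for k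
      using T(3)[of k] unfolding T_eq by (subst (asm) T_eq', simp add: R_def)+
    have P_eq: "P k = (\<Prod>j<k. real (card (alice_moves \<sigma> x j)))" for k
      by (induction k) (simp_all add: trans(2), simp add: P_def T(1))
    have block: "e j = e k \<and> b j = b k" if "k \<le> j" "j \<le> e k" for j k
      using that
    proof (induction rule: dec_induct)
      case (step j)
      then show ?case using trans(3)[of j] by simp
    qed simp
    have block_end: "e (e k) = e k" "b (e k) = b k" for k
      using block[of k "e k"] inv(1)[of k] by auto
    \<comment> \<open>Each block ends after finitely many turns and raises \<open>b\<close> by one,
      so every coordinate is bounded at some time.\<close>
    have b_onto: "\<exists>k. b k = i" for i
    proof (induction i)
      case 0
      show ?case by (intro exI[of _ 0]) (simp add: b_def T(1))
    next
      case (Suc i)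
      then obtain k where "b k = i" by blast
      then have "b (Suc (e k)) = Suc i" using trans(4)[of "e k"] block_end[of k] by simp
      then show ?case by blast
    qed
    obtain y where y: "x \<longlonglongrightarrow> y"
      using bob_play_convergent[OF legal \<beta>(1) \<beta>1 \<rho>0 x] by (auto simp: convergent_def)
    have "y \<in> fst ` C"
    proof (rule outcome_in_projection[where G = G and x = x, OF C(1) _ trans(1) _ \<beta>(1) \<beta>1 _ _ y])
      show "G 0 \<subseteq> C" by (auto simp: G_def T(1) G0_def)
      show "G k \<noteq> {}" for k
      proof
        assume "G k = {}"
        then have "\<Phi> (e k) (G k) = 0" by (simp add: \<Phi>_def good_cells_def)
        then have "(2 ^ ?l (e k)) powr s \<le> 0" using inv(2)[of k] by simp
        moreover have "0 < (2 ^ ?l (e k)) powr s" by simp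
        ultimately show False by linarith
      qed
      show "dyadic_index (?l k) (fst g) = dyadic_index (?l k) (x k)" if "g \<in> G (Suc k)" for k g
        using G_cell[of k] that by (simp add: in_cell_def)
      show "\<exists>u K. \<forall>g\<in>G K. snd g i \<le> u" for i
      proof -
        obtain k where "b k = i" using b_onto by blast
        then show ?thesis using trans(4)[of "e k"] block_end[of k] by auto
      qed
    qed
    then show "\<exists>y\<in>S. x \<longlonglongrightarrow> y" using y C(2) by blast
    have card: "0 < card (alice_moves \<sigma> x j)" for j
      using legal_move_finite_nonempty[OF legal \<beta>(1) \<rho>0 bob_play_imp_legal_history[OF x]]
      by (simp add: alice_moves_def card_gt_0_iff)
    let ?L = "s - ln c / - ln \<beta>"
    let ?f = "\<lambda>k. ?L + (ln 1 - ln c) / - ln \<beta> / real k"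
    have score: "?f K \<le> average_score \<beta> (alice_moves \<sigma> x) K" if "0 < K" "e K = K" for K
    proof (rule average_score_ge[OF \<beta>(1) \<beta>1 that(1) card])
      have "(1 / \<beta> ^ K) powr s \<le> (2 ^ ?l K) powr s"
        using inverse_two_power_dyadic_level_le[OF \<beta>(1) \<beta>1, of K] \<beta>(1) s
        by (intro powr_mono2) (auto simp: field_simps)
      also have "\<dots> \<le> P (Suc K) * c ^ Suc K" using trans(4)[of K] that(2) by simp
      finally show "1 * (1 / \<beta> ^ K) powr s \<le> c ^ Suc K * (\<Prod>j\<le>K. real (card (alice_moves \<sigma> x j)))"
        by (simp add: P_eq lessThan_Suc_atMost mult.commute)
    qed (use c in auto)
    have "ereal ?L \<le> upper_score \<beta> (alice_moves \<sigma> x)"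
    proof (rule ccontr)
      assume "\<not> ?thesis"
      then obtain M where M: "upper_score \<beta> (alice_moves \<sigma> x) < ereal M" "ereal M < ereal ?L"
        using ereal_dense2 by (meson not_le)
      have "\<forall>\<^sub>F k in sequentially. average_score \<beta> (alice_moves \<sigma> x) k < M"
        using Limsup_lessD[OF M(1)[unfolded upper_score_def]] by simp
      moreover have "\<forall>\<^sub>F k in sequentially. M < ?f k"
        using average_score_bound_tendsto[of ?L "(ln 1 - ln c) / - ln \<beta>"] M(2)
        by (intro order_tendstoD(1)[of _ ?L]) auto
      ultimately have "\<forall>\<^sub>F k in sequentially. average_score \<beta> (alice_moves \<sigma> x) k < ?f k"
        by eventually_elim linarith
      then obtain N where N: "\<And>k. k \<ge> N \<Longrightarrow> average_score \<beta> (alice_moves \<sigma> x) k < ?f k"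
        by (auto simp: eventually_sequentially)
      \<comment> \<open>\<open>e (Suc N)\<close> is the end of a block and lies beyond
        \<open>N\<close>.\<close>
      show False
        using N[of "e (Suc N)"] score[of "e (Suc N)"] inv(1)[of "Suc N"] block_end(1)[of "Suc N"] by fastforce
    qed
    then show "ereal \<delta> \<le> upper_score \<beta> (alice_moves \<sigma> x)"
      using \<delta> unfolding c_def by (metis ereal_less_eq(3) order_trans)
  qed
qed

section \<open>Letting the ratio tend to zero\<close>

text \<open>\<open>step_loss\<close> is affine in \<open>ln (1 / \<beta>)\<close>, so the numerator
  is an iterated logarithm.\<close>

lemma step_loss_asymptotics:
  assumes "0 < d"
  shows "((\<lambda>\<beta>. ln (2 * step_loss d \<beta>) / - ln \<beta>) \<longlongrightarrow> 0) (at_right 0)"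
proof -
  have "((\<lambda>\<beta>. ln (a * (1 + b * ln (2 / \<beta>))) / - ln \<beta>) \<longlongrightarrow> 0) (at_right 0)" if "0 < a" "0 < b" for a b :: real
    using that by real_asymp
  from this[of "2 * real (12 * d) ^ d" "real d"] show ?thesis
    using assms by (simp add: step_loss_def mult.assoc)
qed

lemma eventually_step_loss:
  assumes "0 < d" "\<delta> < s"
  shows "\<forall>\<^sub>F \<beta> in at_right 0. 0 < \<beta> \<and> \<beta> \<le> 1 / 2 \<and> \<delta> \<le> s - ln (2 * step_loss d \<beta>) / - ln \<beta>"
proof -
  have "\<forall>\<^sub>F \<beta> in at_right 0. ln (2 * step_loss d \<beta>) / - ln \<beta> < s - \<delta>"
    using step_loss_asymptotics[OF assms(1)] assms(2) by (intro order_tendstoD(2)) auto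
  moreover have "\<forall>\<^sub>F \<beta> in at_right 0. \<beta> \<in> {0<..<1 / 2 :: real}"
    by (rule eventually_at_right_real) simp
  ultimately show ?thesis by eventually_elim auto
qed

lemma eventually_at_right_0_less_1:
  assumes "\<forall>\<^sub>F \<beta> in at_right (0::real). Q \<beta>"
  obtains \<beta> where "0 < \<beta>" "\<beta> < 1" "Q \<beta>"
proof -
  have "\<forall>\<^sub>F \<beta> in at_right 0. \<beta> \<in> {0<..<1 :: real}" by (rule eventually_at_right_real) simp
  with assms have "\<forall>\<^sub>F \<beta> in at_right 0. Q \<beta> \<and> \<beta> \<in> {0<..<1}" by (rule eventually_conj)
  then obtain \<beta> where "Q \<beta> \<and> \<beta> \<in> {0<..<1}"
    using eventually_happens trivial_limit_at_right_real by blast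
  then show ?thesis using that by auto
qed

section \<open>From winning exponents to dimensions\<close>

text \<open>Both implications leave a strict gap between \<open>\<delta>\<close> and
  \<open>s\<close>, which the infimum and the supremum absorb. If no exponent wins, the supremum is
  0, the least element of \<open>ennreal\<close>.\<close>

lemma dim_eq_SUP_winning:
  fixes W :: "real \<Rightarrow> bool" and Null :: "real \<Rightarrow> bool"
  assumes imp: "\<And>s \<delta>. 0 < s \<Longrightarrow> s < \<delta> \<Longrightarrow> W \<delta> \<Longrightarrow> \<not> Null s"
    and win: "\<And>s \<delta>. 0 \<le> \<delta> \<Longrightarrow> \<delta> < s \<Longrightarrow> \<not> Null s \<Longrightarrow> W \<delta>"
  shows "(INF s \<in> {s. 0 < s \<and> Null s}. ennreal s) = (SUP \<delta> \<in> {\<delta>. 0 \<le> \<delta> \<and> W \<delta>}. ennreal \<delta>)"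
    (is "?I = ?S")
proof (rule antisym)
  show "?S \<le> ?I"
  proof (intro SUP_least INF_greatest)
    fix \<delta> s assume "\<delta> \<in> {\<delta>. 0 \<le> \<delta> \<and> W \<delta>}" "s \<in> {s. 0 < s \<and> Null s}"
    then have "\<delta> \<le> s" using imp[of s \<delta>] by (cases "\<delta> \<le> s") auto
    then show "ennreal \<delta> \<le> ennreal s" by (rule ennreal_leI)
  qed
  show "?I \<le> ?S"
  proof (rule ccontr)
    assume "\<not> ?I \<le> ?S"
    then have "?S < ?I" by simp
    then obtain u where u: "?S < u" "u < ?I" using dense by blast
    then obtain v where v: "u < v" "v < ?I" using dense by blast
    obtain \<delta> where \<delta>: "0 \<le> \<delta>" "u = ennreal \<delta>"
      using v by (cases u) auto
    obtain s where s: "0 \<le> s" "v = ennreal s"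
      using v by (cases v) auto
    have "\<delta> < s" using v(1) \<delta> s by (simp add: ennreal_less_iff)
    have "\<not> Null s"
    proof
      assume "Null s"
      then have "?I \<le> ennreal s" using \<delta> \<open>\<delta> < s\<close> by (intro INF_lower) simp
      then show False using v(2) s(2) by simp
    qed
    then have "W \<delta>" using win \<delta>(1) \<open>\<delta> < s\<close> by blast
    then have "u \<le> ?S" unfolding \<delta>(2) using \<delta>(1) by (intro SUP_upper) simp
    then show False using u(1) by simp
  qed
qed

theorem theorem3p2:
  fixes S :: "(real ^ 'n::finite) set"
  assumes "S \<in> sets borel"
  shows "hausdorff_dim S = (SUP \<delta> \<in> {\<delta>. 0 \<le> \<delta> \<and> hausdorff_winning \<delta> S}. ennreal \<delta>) \<and>
         packing_dim S = (SUP \<delta> \<in> {\<delta>. 0 \<le> \<delta> \<and> packing_winning \<delta> S}. ennreal \<delta>)"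
proof
  have S: "suslin S" by (rule suslin_borel[OF assms])
  show "hausdorff_dim S = (SUP \<delta> \<in> {\<delta>. 0 \<le> \<delta> \<and> hausdorff_winning \<delta> S}. ennreal \<delta>)"
    unfolding hausdorff_dim_def
  proof (rule dim_eq_SUP_winning)
    fix s \<delta> :: real assume "0 < s" "s < \<delta>" "hausdorff_winning \<delta> S"
    then show "hausdorff_measure s S \<noteq> 0"
      using hausdorff_beta_winning_imp_measure_nonzero eventually_at_right_0_less_1
      unfolding hausdorff_winning_def by metis
  next
    fix s \<delta> :: real assume "0 \<le> \<delta>" "\<delta> < s" "hausdorff_measure s S \<noteq> 0"
    then show "hausdorff_winning \<delta> S"
      unfolding hausdorff_winning_def
      by (intro eventually_mono[OF eventually_step_loss[of "CARD('n)" \<delta> s]]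
            hausdorff_beta_winning_if_measure_nonzero[OF S, of s]) auto
  qed
  show "packing_dim S = (SUP \<delta> \<in> {\<delta>. 0 \<le> \<delta> \<and> packing_winning \<delta> S}. ennreal \<delta>)"
    unfolding packing_dim_def
  proof (rule dim_eq_SUP_winning)
    fix s \<delta> :: real assume "0 < s" "s < \<delta>" "packing_winning \<delta> S"
    then show "packing_measure s S \<noteq> 0"
      using packing_beta_winning_imp_measure_nonzero eventually_at_right_0_less_1
      unfolding packing_winning_def by metis
  next
    fix s \<delta> :: real assume \<delta>: "0 \<le> \<delta>" "\<delta> < s" and pos: "packing_measure s S \<noteq> 0"
    \<comment> \<open>Box-negligible at exponent \<open>m\<close> implies packing-null only for
      larger exponents, and the loss per turn needs \<open>\<delta> < m\<close>; hence room on both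
      sides.\<close>
    obtain m where m: "\<delta> < m" "m < s" using dense \<delta>(2) by blast
    show "packing_winning \<delta> S"
      unfolding packing_winning_def
      using eventually_step_loss[OF _ m(1), of "CARD('n)"]
    proof (rule eventually_mono)
      fix \<beta> :: real
      assume \<beta>: "0 < \<beta> \<and> \<beta> \<le> 1 / 2 \<and> \<delta> \<le> m - ln (2 * step_loss CARD('n) \<beta>) / - ln \<beta>"
      have "\<not> box_negligible \<beta> m S"
        using packing_measure_box_negligible[of \<beta> m s S] \<beta> m \<delta> pos by auto
      moreover have "ln (step_loss CARD('n) \<beta>) / - ln \<beta> \<le> ln (2 * step_loss CARD('n) \<beta>) / - ln \<beta>"
        using step_loss_ge_1[of "CARD('n)" \<beta>] \<beta> by (intro divide_right_mono) auto
      ultimately show "packing_beta_winning \<beta> \<delta> S"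
        using \<beta> m \<delta> by (intro packing_beta_winning_if_not_box_negligible[OF S, where s = m]) auto
    qed simp
  qed
qed

end
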